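(* Let $n_0\in\mathbb{N}$ and $\Omega=[0,1]^{n_0}$ with Lebesgue measure. Let $\Phi=\{f_n,g_n\}_{n\in\mathbb{N}}$ be any biorthonormal system on $\Omega$ such that (1) there is a constant $A$ with $\|f_n\|_\infty\le A$ and $\|g_n\|_\infty\le A$ for all $n\in\mathbb{N}$; and (2) for every measurable set $D\subset\Omega$, $$\lim_{n\to\infty}\int_D f_n(x)\,dx=0\quad\text{and}\quad \lim_{n\to\infty}\int_D g_n(x)\,dx=0.$$ Let $p:\Omega\to[1,\infty)$ be any measurable function such that $$\limsup_{t\to0+}\frac{(p')^*(t)}{\ln(e/t)}>0.$$ Then there exists a measure preserving transformation $\omega:\Omega\to\Omega$ such that there exist functions $F_1,F_2\in L^{p(\omega(\cdot))}(\Omega)$ and a set $E\subset\Omega$ with $|E|>0$ such that for all $x\in E$, $$\limsup_{N\to\infty}\sum_{n=1}^{N}\bigl((F_1,g_n)f_n(x)+(F_2,f_n)g_n(x)\bigr)=\infty.$$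
   Context: $|E|$ denotes the Lebesgue measure of a measurable set $E$. Functions are real-valued and Lebesgue measurable, and $(F,g)=\int_\Omega F(x)g(x)\,dx$. A system $\{f_n,g_n\}_{n\in\mathbb{N}}$ of functions in $L^\infty(\Omega)$ is biorthonormal if $(f_i,g_j)=1$ when $i=j$ and $(f_i,g_j)=0$ when $i\ne j$. For $p:\Omega\to[1,\infty)$, the Hölder conjugate is $p'(x)=p(x)/(p(x)-1)$, understood as $+\infty$ where $p(x)=1$. The decreasing rearrangement of a measurable function $f$ on $\Omega$ is $$f^*(s)=\inf\{\alpha\ge0: |\{x\in\Omega:|f(x)|>\alpha\}|\le s\},\quad s>0,$$ with $\inf\emptyset=+\infty$. For a measurable $r:\Omega\to[1,\infty)$, the variable exponent Lebesgue space $L^{r(\cdot)}(\Omega)$ is the set of all measurable functions $f$ on $\Omega$ such that $\int_\Omega(|f(x)|/\lambda)^{r(x)}\,dx<\infty$ for some $\lambda>0$, with norm $\|f\|_{r(\cdot)}=\inf\{\lambda>0:\int_\Omega(|f(x)|/\lambda)^{r(x)}\,dx\le1\}$. Here $L^{p(\omega(\cdot))}(\Omega)$ is the space with exponent $r(x)=p(\omega(x))$. Note $L^{r(\cdot)}(\Omega)\subset L^1(\Omega)$, so the coefficients $(F_1,g_n)$ and $(F_2,f_n)$ are defined. A transformation $\omega:\Omega\to\Omega$ is measure preserving if for every measurable $B\subset\Omega$ the set $\omega^{-1}(B)$ is measurable and $|\omega^{-1}(B)|=|B|$. *)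

theory Defs
  imports "HOL-Probability.Essential_Supremum" "HOL-Analysis.Analysis"
begin

abbreviation unit_cube :: "(real ^ 'n) set" where
  "unit_cube \<equiv> cbox 0 1"

(* Functions on the cube are total functions of which only the values on unit_cube matter;
   measurability and integrals refer to this measure space. *)
abbreviation cube_measure :: "(real ^ 'n) measure" where
  "cube_measure \<equiv> lebesgue_on unit_cube"

definition pairing :: "'a measure \<Rightarrow> ('a \<Rightarrow> real) \<Rightarrow> ('a \<Rightarrow> real) \<Rightarrow> real" where
  "pairing M F g = (LINT x|M. F x * g x)"

definition Linfty_norm :: "'a measure \<Rightarrow> ('a \<Rightarrow> real) \<Rightarrow> ereal" where
  "Linfty_norm M f = esssup M (\<lambda>x. ereal \<bar>f x\<bar>)"

definition Linfty :: "'a measure \<Rightarrow> ('a \<Rightarrow> real) set" where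
  "Linfty M = {f \<in> borel_measurable M. Linfty_norm M f < \<infinity>}"

(* Systems are indexed by the positive integers; the entries f 0 and g 0 are ignored. *)
definition biorthonormal ::
  "'a measure \<Rightarrow> (nat \<Rightarrow> 'a \<Rightarrow> real) \<Rightarrow> (nat \<Rightarrow> 'a \<Rightarrow> real) \<Rightarrow> bool" where
  "biorthonormal M f g \<longleftrightarrow>
     (\<forall>n\<ge>1. f n \<in> Linfty M \<and> g n \<in> Linfty M) \<and>
     (\<forall>i\<ge>1. \<forall>j\<ge>1. pairing M (f i) (g j) = (if i = j then 1 else 0))"

definition holder_conjugate :: "('a \<Rightarrow> real) \<Rightarrow> 'a \<Rightarrow> ereal" where
  "holder_conjugate p x = (if p x = 1 then \<infinity> else ereal (p x / (p x - 1)))"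

(* In ereal the infimum of the empty set is infinity, as the convention requires.
   The functions are extended-real-valued since holder_conjugate is. *)
definition decreasing_rearrangement :: "'a measure \<Rightarrow> ('a \<Rightarrow> ereal) \<Rightarrow> real \<Rightarrow> ereal" where
  "decreasing_rearrangement M f s =
     Inf {ereal \<alpha> | \<alpha>. 0 \<le> \<alpha> \<and> emeasure M {x \<in> space M. \<bar>f x\<bar> > ereal \<alpha>} \<le> ennreal s}"

definition variable_Lebesgue :: "'a measure \<Rightarrow> ('a \<Rightarrow> real) \<Rightarrow> ('a \<Rightarrow> real) set" where
  "variable_Lebesgue M r =
     {f \<in> borel_measurable M.
        \<exists>c>0. (\<integral>\<^sup>+ x. ennreal ((\<bar>f x\<bar> / c) powr r x) \<partial>M) < \<infinity>}"

(* Not assumed bijective. *)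
definition measure_preserving_map :: "'a measure \<Rightarrow> ('a \<Rightarrow> 'a) \<Rightarrow> bool" where
  "measure_preserving_map M \<omega> \<longleftrightarrow>
     \<omega> \<in> M \<rightarrow>\<^sub>M M \<and> (\<forall>B\<in>sets M. emeasure M (\<omega> -` B \<inter> space M) = emeasure M B)"

end

theory Submission
  imports Defs "HOL-Probability.Probability"
begin

text \<open>
  Write S_n F = \<Sum>k<n. (F, g_k) f_k for the partial sums of the first family of series; the
  second family arises by exchanging f and g. It is enough to make one of the two families diverge
  and to take the zero function for the other.

  Step one: the Lebesgue functions of the system are unbounded, uniformly over windows. Fix a point
  x and a window of 2^J consecutive indices for which \<Sum> f_k(x) g_k(x) is at least half of its
  length. If all the kernels \<Sum> f_k(x) g_k and \<Sum> g_k(x) f_k over initial parts of the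
  window had L1 norm at most B, then biorthonormality would force every sub-window of length l to
  contribute a set of measure about 1/l on which the kernel is about l. Summing over the dyadic
  lengths l gives B^2 at least a constant times J (kernel_L1_growth). Both kernels enter this
  argument, and hence both families enter the theorem.

  Step two: a density with large partial sums on a set of measure bounded below. Cut the values of
  the window at x to a finite alphabet. For a fixed letter one wants F with (F, D) large, where D is
  the kernel belonging to that letter. Starting from a density P, multiply it by a factor that
  prefers the points with D > 0 but preserves the mass of every cell of a fine partition
  (tilt_density). A window that lies far out is almost orthogonal to all cells, because the system
  is weakly null; hence the tilted density gains half of \<integral>P|D|, whereas the coefficients of
  the earlier windows are kept. That \<integral>P|D| is comparable with \<integral>|D| is arranged by
  letting the windows run along a subsequence on which all functions |D| converge weakly, and by
  keeping the integrals of P against the weak limits. Each step handles one letter, so it covers a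
  set of x of measure at least some kappa that depends only on the window length and on the bound of
  the system; after finitely many steps a fixed proportion of the cube is covered (large_maximal_function).

  Step three: from densities to the space of variable exponent. The hypothesis on p provides
  arbitrarily small t and sets of measure more than t on which (1/t)^(p-1) is bounded
  (small_exponent_scales_of_Limsup). On such a set a function of height 1/t has a modular
  comparable with its L1 norm. A bounded density is weakly close to 1_H / |H| for a set H of
  prescribed small measure (indicator_weak_approximation), and a measure preserving map carries H
  into the set where p is small (exists_measure_preserving_rearrangement). These blocks are made
  disjoint, and a gliding hump argument chooses summable coefficients for which the partial sums of
  the resulting series are unbounded on a set of positive measure (gliding_hump).
\<close>

section \<open>Growth of the Lebesgue functions over a window\<close>

text \<open>
  The discrete layer cake formula: the largest dyadic threshold below t dominates the geometric sum
  of the smaller ones.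
\<close>

lemma sum_dyadic_thresholds_le:
  fixes c t :: real
  assumes "c > 0" "t \<ge> 0"
  shows "(\<Sum>j<J. c * 2 ^ j * of_bool (c * 2 ^ j \<le> t)) \<le> 2 * t"
proof (induction J)
  case 0
  then show ?case using assms by simp
next
  case (Suc J)
  show ?case
  proof (cases "c * 2 ^ J \<le> t")
    case True
    have "(\<Sum>j<Suc J. c * 2 ^ j * of_bool (c * 2 ^ j \<le> t)) \<le> (\<Sum>j<Suc J. c * 2 ^ j)"
      by (rule sum_mono) (use assms in auto)
    also have "\<dots> = c * (\<Sum>j<Suc J. 2 ^ j)" by (simp add: sum_distrib_left distrib_left)
    also have "(\<Sum>j<Suc J. (2::real) ^ j) = 2 ^ Suc J - 1"
      by (induction J) auto
    also have "c * (2 ^ Suc J - 1) \<le> 2 * t" using True assms by (simp add: algebra_simps)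
    finally show ?thesis .
  next
    case False
    then show ?thesis using Suc by simp
  qed
qed

text \<open>
  Every index k < L lies in exactly l of the windows [n - l, min n L). The truncated subtraction
  cuts the windows at 0 and the minimum cuts them at L, so there is no boundary term.
\<close>

lemma sum_sliding_windows:
  fixes w :: "nat \<Rightarrow> real"
  shows "(\<Sum>n<L + l. \<Sum>k\<in>{n - l..<min n L}. w k) = real l * (\<Sum>k<L. w k)"
proof -
  have "(\<Sum>n<L + l. \<Sum>k\<in>{n - l..<min n L}. w k) = (\<Sum>n<L + l. \<Sum>k<L. of_bool (k < n \<and> n \<le> k + l) * w k)"
  proof (rule sum.cong[OF refl])
    fix n
    have "(\<Sum>k<L. of_bool (k < n \<and> n \<le> k + l) * w k) = (\<Sum>k\<in>{k\<in>{..<L}. k < n \<and> n \<le> k + l}. w k)"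
      unfolding sum.inter_filter[OF finite_lessThan] by (intro sum.cong) auto
    also have "{k\<in>{..<L}. k < n \<and> n \<le> k + l} = {n - l..<min n L}" by auto
    finally show "(\<Sum>k\<in>{n - l..<min n L}. w k) = (\<Sum>k<L. of_bool (k < n \<and> n \<le> k + l) * w k)" ..
  qed
  also have "\<dots> = (\<Sum>k<L. \<Sum>n<L + l. of_bool (k < n \<and> n \<le> k + l) * w k)"
    by (rule sum.swap)
  also have "\<dots> = (\<Sum>k<L. real l * w k)"
  proof (rule sum.cong[OF refl])
    fix k assume "k \<in> {..<L}"
    then have "{n\<in>{..<L + l}. k < n \<and> n \<le> k + l} = {k<..k + l}" by auto
    then have "(\<Sum>n<L + l. of_bool (k < n \<and> n \<le> k + l)) = real (card {k<..k + l})"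
      by (subst sum_of_bool_eq) (auto simp: Int_def)
    then show "(\<Sum>n<L + l. of_bool (k < n \<and> n \<le> k + l) * w k) = real l * w k"
      by (simp add: sum_distrib_right[symmetric])
  qed
  finally show ?thesis by (simp add: sum_distrib_left)
qed

lemma abs_sum_le_card_mult:
  fixes h :: "'b \<Rightarrow> real"
  assumes "\<And>k. k \<in> S \<Longrightarrow> \<bar>h k\<bar> \<le> C"
  shows "\<bar>\<Sum>k\<in>S. h k\<bar> \<le> real (card S) * C"
  using order.trans[OF sum_abs sum_bounded_above] assms by blast

lemma (in prob_space) integrable_bounded:
  fixes h :: "'a \<Rightarrow> real"
  assumes "h \<in> borel_measurable M" "\<And>y. y \<in> space M \<Longrightarrow> \<bar>h y\<bar> \<le> C"
  shows "integrable M h"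
  by (rule integrable_const_bound[of _ C]) (use assms in auto)

text \<open>
  Let D and D' be the increments of \<Phi> and \<Psi> over a window of length l. Biorthonormality
  evaluates \<integral>D D' as the sum of u_k v_k over the window, whereas |D| and |D'| are at most
  A^2 l. Where |D| is below a small multiple of l the integral is controlled by the L1 bound on
  \<Psi>; so |D|, and with it \<Phi> at one end of the window, must exceed that multiple of l on a
  set of measure about 1/l. As this happens on average over the position of the window and for every
  dyadic l, the layer cake formula bounds the L1 norm of \<Phi> below, on average, by J up to a
  constant factor that itself deteriorates like 1/B. This accounts for the square of B.
\<close>

lemma (in prob_space) kernel_L1_growth:
  fixes f g :: "nat \<Rightarrow> 'a \<Rightarrow> real" and u v :: "nat \<Rightarrow> real" and A B :: real
  defines "\<Phi> \<equiv> \<lambda>n y. \<Sum>k<n. u k * g k y" and "\<Psi> \<equiv> \<lambda>n y. \<Sum>k<n. v k * f k y"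
  assumes f[measurable]: "\<And>k. f k \<in> borel_measurable M" and g[measurable]: "\<And>k. g k \<in> borel_measurable M"
    and fA: "\<And>k y. y \<in> space M \<Longrightarrow> \<bar>f k y\<bar> \<le> A" and gA: "\<And>k y. y \<in> space M \<Longrightarrow> \<bar>g k y\<bar> \<le> A"
    and uA: "\<And>k. \<bar>u k\<bar> \<le> A" and vA: "\<And>k. \<bar>v k\<bar> \<le> A" and A: "A > 0"
    and biorth: "\<And>i j. expectation (\<lambda>y. f i y * g j y) = (if i = j then 1 else 0)"
    and diag: "(\<Sum>k<2 ^ J. u k * v k) \<ge> 2 ^ J / 2"
    and B: "B > 0"
    and \<Phi>B: "\<And>n. n \<le> 2 ^ J \<Longrightarrow> expectation (\<lambda>y. \<bar>\<Phi> n y\<bar>) \<le> B"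
    and \<Psi>B: "\<And>n. n \<le> 2 ^ J \<Longrightarrow> expectation (\<lambda>y. \<bar>\<Psi> n y\<bar>) \<le> B"
  shows "real J \<le> 768 * A ^ 4 * B ^ 2"
proof -
  define L :: nat where "L = 2 ^ J"
  have [measurable]: "\<Phi> n \<in> borel_measurable M" "\<Psi> n \<in> borel_measurable M" for n
    unfolding \<Phi>_def \<Psi>_def by measurable
  have ug: "\<bar>u k * g j y\<bar> \<le> A\<^sup>2" "\<bar>v k * f j y\<bar> \<le> A\<^sup>2" if "y \<in> space M" for k j y
    using mult_mono[OF uA[of k] gA[OF that, of j]] mult_mono[OF vA[of k] fA[OF that, of j]] A
    by (auto simp: abs_mult power2_eq_square)
  have bd: "\<bar>\<Phi> n y\<bar> \<le> n * A\<^sup>2" "\<bar>\<Psi> n y\<bar> \<le> n * A\<^sup>2" if "y \<in> space M" for n y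
    using abs_sum_le_card_mult[of "{..<n}" "\<lambda>k. u k * g k y" "A\<^sup>2"]
      abs_sum_le_card_mult[of "{..<n}" "\<lambda>k. v k * f k y" "A\<^sup>2"] ug[OF that]
    by (simp_all add: \<Phi>_def \<Psi>_def)
  have int: "integrable M (\<lambda>y. \<bar>\<Phi> n y\<bar>)" "integrable M (\<lambda>y. \<bar>\<Psi> n y\<bar>)" for n
    by (rule integrable_bounded[of _ "n * A\<^sup>2"]; use bd in auto)+
  have D: "\<Phi> n y - \<Phi> m y = (\<Sum>k\<in>{m..<n}. u k * g k y)" "\<Psi> n y - \<Psi> m y = (\<Sum>k\<in>{m..<n}. v k * f k y)"
    if "m \<le> n" for m n y
    using sum_diff_nat_ivl[of 0 m n "\<lambda>k. u k * g k y"] sum_diff_nat_ivl[of 0 m n "\<lambda>k. v k * f k y"] that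
    by (auto simp: \<Phi>_def \<Psi>_def lessThan_atLeast0)
  have fgA: "\<bar>f i y * g j y\<bar> \<le> A * A" if "y \<in> space M" for i j y
    using mult_mono[OF fA[OF that, of i] gA[OF that, of j]] A by (auto simp: abs_mult)
  have fgint: "integrable M (\<lambda>y. f i y * g j y)" for i j
    by (rule integrable_bounded[of _ "A * A"]) (use fgA in auto)
  have prod: "expectation (\<lambda>y. (\<Phi> n y - \<Phi> m y) * (\<Psi> n y - \<Psi> m y)) = (\<Sum>k\<in>{m..<n}. u k * v k)"
    if "m \<le> n" for m n
  proof -
    have "expectation (\<lambda>y. (\<Phi> n y - \<Phi> m y) * (\<Psi> n y - \<Psi> m y))
      = expectation (\<lambda>y. \<Sum>i\<in>{m..<n}. \<Sum>j\<in>{m..<n}. (u i * v j) * (f j y * g i y))"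
      unfolding D[OF that] sum_product
      by (intro Bochner_Integration.integral_cong sum.cong refl) (simp only: mult_ac)
    also have "\<dots> = (\<Sum>i\<in>{m..<n}. \<Sum>j\<in>{m..<n}. (u i * v j) * (if j = i then 1 else 0))"
      by (simp add: fgint biorth)
    also have "\<dots> = (\<Sum>k\<in>{m..<n}. u k * v k)"
      by (rule sum.cong[OF refl]) (simp add: if_distrib cong: if_cong)
    finally show ?thesis .
  qed
  define a where "a = (\<lambda>n s. prob {y\<in>space M. s \<le> \<bar>\<Phi> n y\<bar>})"
  have window: "(\<Sum>k\<in>{m..<n}. u k * v k) - 4 * B * s \<le> A ^ 4 * (real l)\<^sup>2 * (a n s + a m s)"
    if "m \<le> n" "n \<le> L" "n - m \<le> l" "s > 0" for m n l s
  proof -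
    let ?D = "\<lambda>y. \<Phi> n y - \<Phi> m y" and ?E = "\<lambda>y. \<Psi> n y - \<Psi> m y"
    let ?S = "\<lambda>k. {y\<in>space M. s \<le> \<bar>\<Phi> k y\<bar>}"
    have DE: "\<bar>?D y\<bar> \<le> A\<^sup>2 * l" "\<bar>?E y\<bar> \<le> A\<^sup>2 * l" if y: "y \<in> space M" for y
    proof -
      have "\<bar>?D y\<bar> \<le> card {m..<n} * A\<^sup>2"
        unfolding D[OF \<open>m \<le> n\<close>] by (rule order.trans[OF sum_abs sum_bounded_above]) (use ug y in auto)
      also have "\<dots> \<le> l * A\<^sup>2" using \<open>n - m \<le> l\<close> by (intro mult_right_mono) auto
      finally show "\<bar>?D y\<bar> \<le> A\<^sup>2 * l" by (simp add: mult.commute)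
      have "\<bar>?E y\<bar> \<le> card {m..<n} * A\<^sup>2"
        unfolding D[OF \<open>m \<le> n\<close>] by (rule order.trans[OF sum_abs sum_bounded_above]) (use ug y in auto)
      also have "\<dots> \<le> l * A\<^sup>2" using \<open>n - m \<le> l\<close> by (intro mult_right_mono) auto
      finally show "\<bar>?E y\<bar> \<le> A\<^sup>2 * l" by (simp add: mult.commute)
    qed
    have pt: "?D y * ?E y \<le> 2 * s * (\<bar>\<Psi> n y\<bar> + \<bar>\<Psi> m y\<bar>)
        + A ^ 4 * (real l)\<^sup>2 * (indicator (?S n) y + indicator (?S m) y)" if y: "y \<in> space M" for y
    proof (cases "\<bar>?D y\<bar> < 2 * s")
      case True
      have "?D y * ?E y \<le> \<bar>?D y\<bar> * \<bar>?E y\<bar>" by (metis abs_ge_self abs_mult)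
      also have "\<dots> \<le> 2 * s * (\<bar>\<Psi> n y\<bar> + \<bar>\<Psi> m y\<bar>)"
        using True by (intro mult_mono) auto
      finally show ?thesis using A by (simp add: add_increasing2)
    next
      case False
      then have "s \<le> \<bar>\<Phi> n y\<bar> \<or> s \<le> \<bar>\<Phi> m y\<bar>" by linarith
      then have 1: "1 \<le> indicator (?S n) y + (indicator (?S m) y :: real)"
        using y by (auto simp: indicator_def)
      have "?D y * ?E y \<le> \<bar>?D y\<bar> * \<bar>?E y\<bar>" by (metis abs_ge_self abs_mult)
      also have "\<dots> \<le> (A\<^sup>2 * l) * (A\<^sup>2 * l)"
        using DE[OF y] by (intro mult_mono) auto
      also have "\<dots> = A ^ 4 * (real l)\<^sup>2 * 1" by (simp add: power2_eq_square power4_eq_xxxx)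
      also have "\<dots> \<le> A ^ 4 * (real l)\<^sup>2 * (indicator (?S n) y + indicator (?S m) y)"
        using 1 by (intro mult_left_mono) auto
      finally show ?thesis using \<open>s > 0\<close> by (simp add: add_increasing)
    qed
    have iDE: "integrable M (\<lambda>y. ?D y * ?E y)"
    proof (rule integrable_bounded[of _ "(A\<^sup>2 * l) * (A\<^sup>2 * l)"])
      show "\<bar>?D y * ?E y\<bar> \<le> (A\<^sup>2 * l) * (A\<^sup>2 * l)" if "y \<in> space M" for y
        unfolding abs_mult using DE[OF that] by (intro mult_mono) auto
    qed measurable
    have iI: "integrable M (\<lambda>y. indicator (?S k) y :: real)" for k
      by (rule integrable_bounded[of _ 1]) (auto simp: indicator_def)
    have i\<Psi>: "integrable M (\<lambda>y. \<bar>\<Psi> n y\<bar> + \<bar>\<Psi> m y\<bar>)" and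
      iII: "integrable M (\<lambda>y. indicator (?S n) y + indicator (?S m) y :: real)"
      by (intro Bochner_Integration.integrable_add int iI)+
    have "(\<Sum>k\<in>{m..<n}. u k * v k) = expectation (\<lambda>y. ?D y * ?E y)"
      using prod[OF \<open>m \<le> n\<close>] by simp
    also have "\<dots> \<le> expectation (\<lambda>y. 2 * s * (\<bar>\<Psi> n y\<bar> + \<bar>\<Psi> m y\<bar>)
        + A ^ 4 * (real l)\<^sup>2 * (indicator (?S n) y + indicator (?S m) y))"
      by (rule integral_mono[OF iDE])
        (intro Bochner_Integration.integrable_add integrable_mult_right i\<Psi> iII, rule pt)
    also have "\<dots> = 2 * s * (expectation (\<lambda>y. \<bar>\<Psi> n y\<bar>) + expectation (\<lambda>y. \<bar>\<Psi> m y\<bar>))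
        + A ^ 4 * (real l)\<^sup>2 * (a n s + a m s)"
      by (subst Bochner_Integration.integral_add)
        (simp_all add: i\<Psi> iII int iI a_def Int_def conj_commute del: integrable_mult_right_iff)
    also have "\<dots> \<le> 2 * s * (B + B) + A ^ 4 * (real l)\<^sup>2 * (a n s + a m s)"
      using \<Psi>B[of n] \<Psi>B[of m] that unfolding L_def by (intro add_mono mult_left_mono) auto
    finally show ?thesis by (simp add: algebra_simps)
  qed
  have a0: "a n s \<ge> 0" for n s by (simp add: a_def)
  have a00: "a 0 s = 0" if "s > 0" for s
    using that by (simp add: a_def \<Phi>_def)
  have layer: "(\<Sum>j<J. c * 2 ^ j * a n (c * 2 ^ j)) \<le> 2 * B" if "n \<le> L" "c > 0" for n c
  proof -
    have iI: "integrable M (\<lambda>y. of_bool (c * 2 ^ j \<le> \<bar>\<Phi> n y\<bar>) :: real)" for j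
      by (rule integrable_bounded[of _ 1]) auto
    have eq: "a n s = expectation (\<lambda>y. of_bool (s \<le> \<bar>\<Phi> n y\<bar>))" for s
    proof -
      have "expectation (\<lambda>y. of_bool (s \<le> \<bar>\<Phi> n y\<bar>)) = expectation (indicator {y\<in>space M. s \<le> \<bar>\<Phi> n y\<bar>})"
        by (rule Bochner_Integration.integral_cong) (auto simp: indicator_def)
      also have "\<dots> = prob ({y\<in>space M. s \<le> \<bar>\<Phi> n y\<bar>} \<inter> space M)"
        by (rule Bochner_Integration.integral_indicator)
      also have "{y\<in>space M. s \<le> \<bar>\<Phi> n y\<bar>} \<inter> space M = {y\<in>space M. s \<le> \<bar>\<Phi> n y\<bar>}" by auto
      finally show ?thesis by (simp add: a_def)
    qed
    have "(\<Sum>j<J. c * 2 ^ j * a n (c * 2 ^ j)) = expectation (\<lambda>y. \<Sum>j<J. c * 2 ^ j * of_bool (c * 2 ^ j \<le> \<bar>\<Phi> n y\<bar>))"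
      unfolding eq by (simp only: Bochner_Integration.integral_sum integrable_mult_right[OF iI] integral_mult_right_zero)
    also have "\<dots> \<le> expectation (\<lambda>y. 2 * \<bar>\<Phi> n y\<bar>)"
      by (rule integral_mono)
        (intro Bochner_Integration.integrable_sum integrable_mult_right iI int
          sum_dyadic_thresholds_le \<open>c > 0\<close> abs_ge_zero)+
    also have "\<dots> \<le> 2 * B" using \<Phi>B[of n] that by (simp add: L_def)
    finally show ?thesis .
  qed
  \<comment> \<open>With this value the part where the increment is below \<open>\<eta> l\<close> uses up half of the available sum.\<close>
  define \<eta> where "\<eta> = 1 / (16 * B)"
  define c where "c = \<eta> / 2"
  have \<eta>: "\<eta> > 0" "c > 0" using B by (auto simp: \<eta>_def c_def)
  have level: "\<eta> * L / (8 * A ^ 4) \<le> 2 * (\<Sum>n<L. c * 2 ^ j * a n (c * 2 ^ j)) + L * (c * 2 ^ j * a L (c * 2 ^ j))"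
    if j: "j < J" for j
  proof -
    define l :: nat where "l = 2 ^ j"
    define s where "s = c * 2 ^ j"
    have l: "l \<le> L" "l > 0" using j by (auto simp: l_def L_def)
    have s: "s > 0" "s = \<eta> * l / 2" using \<eta> by (auto simp: s_def c_def l_def)
    have "real l * (L / 2) \<le> real l * (\<Sum>k<L. u k * v k)"
      using diag by (intro mult_left_mono) (auto simp: L_def)
    also have "\<dots> = (\<Sum>n<L + l. \<Sum>k\<in>{n - l..<min n L}. u k * v k)"
      by (rule sum_sliding_windows[symmetric])
    also have "\<dots> \<le> (\<Sum>n<L + l. 4 * B * s + A ^ 4 * (real l)\<^sup>2 * (a (min n L) s + a (n - l) s))"
    proof (rule sum_mono)
      fix n assume "n \<in> {..<L + l}"
      then have "n - l \<le> min n L" "min n L \<le> L" "min n L - (n - l) \<le> l" by auto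
      from window[OF this s(1)]
      show "(\<Sum>k\<in>{n - l..<min n L}. u k * v k) \<le> 4 * B * s + A ^ 4 * (real l)\<^sup>2 * (a (min n L) s + a (n - l) s)"
        by linarith
    qed
    also have "\<dots> = (L + l) * (4 * B * s) + A ^ 4 * (real l)\<^sup>2 * (\<Sum>n<L + l. a (min n L) s + a (n - l) s)"
      by (simp only: sum.distrib sum_distrib_left[symmetric] sum_constant card_lessThan mult_ac)
    also have "(\<Sum>n<L + l. a (min n L) s + a (n - l) s) \<le> 2 * (\<Sum>n<L. a n s) + L * a L s"
    proof -
      have 1: "(\<Sum>n<L + l. h n) = (\<Sum>n<L. h n) + (\<Sum>n<l. h (L + n))" for h :: "nat \<Rightarrow> real"
        by (induction l) auto
      have 2: "(\<Sum>n<l + L. h n) = (\<Sum>n<l. h n) + (\<Sum>n<L. h (l + n))" for h :: "nat \<Rightarrow> real"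
        by (induction L) auto
      have "(\<Sum>n<L + l. a (min n L) s) = (\<Sum>n<L. a n s) + l * a L s"
        unfolding 1 by simp
      moreover have "(\<Sum>n<L + l. a (n - l) s) = (\<Sum>n<L. a n s)"
        unfolding add.commute[of L l] 2 using a00[OF s(1)] by simp
      moreover have "l * a L s \<le> L * a L s" using l a0 by (intro mult_right_mono) auto
      ultimately show ?thesis by (simp add: sum.distrib)
    qed
    finally have "real l * (L / 2) \<le> (L + l) * (4 * B * s) + A ^ 4 * (real l)\<^sup>2 * (2 * (\<Sum>n<L. a n s) + L * a L s)"
      using A by (simp add: mult_left_mono)
    moreover have "(L + l) * (4 * B * s) \<le> real l * (L / 4)"
    proof -
      have q: "4 * B * s = l / 8" using B by (simp add: s \<eta>_def)
      have "real (L + l) * (l / 8) \<le> real (2 * L) * (l / 8)"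
        using l by (intro mult_right_mono) auto
      then show ?thesis unfolding q by (simp add: mult_ac)
    qed
    ultimately have "real l * (L / 4) \<le> A ^ 4 * (real l)\<^sup>2 * (2 * (\<Sum>n<L. a n s) + L * a L s)"
      by linarith
    then have "real l * (real L / 4) \<le> real l * (A ^ 4 * l * (2 * (\<Sum>n<L. a n s) + L * a L s))"
      by (simp only: power2_eq_square mult_ac)
    then have "real L / 4 \<le> A ^ 4 * l * (2 * (\<Sum>n<L. a n s) + L * a L s)"
      by (rule mult_left_le_imp_le) (use l in simp)
    then have "\<eta> / 2 * (real L / 4) \<le> \<eta> / 2 * (A ^ 4 * l * (2 * (\<Sum>n<L. a n s) + L * a L s))"
      using \<eta> by (intro mult_left_mono) auto
    also have "\<dots> = A ^ 4 * (s * (2 * (\<Sum>n<L. a n s) + L * a L s))"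
      by (simp add: s)
    also have "s * (2 * (\<Sum>n<L. a n s) + L * a L s) = 2 * (\<Sum>n<L. s * a n s) + L * (s * a L s)"
      by (simp add: sum_distrib_left algebra_simps)
    finally show ?thesis using A by (simp add: s_def[symmetric] field_simps)
  qed
  have "J * (\<eta> * L / (8 * A ^ 4)) \<le> (\<Sum>j<J. 2 * (\<Sum>n<L. c * 2 ^ j * a n (c * 2 ^ j)) + L * (c * 2 ^ j * a L (c * 2 ^ j)))"
    using sum_bounded_below[of "{..<J}" "\<eta> * L / (8 * A ^ 4)"] level by auto
  also have "\<dots> = 2 * (\<Sum>n<L. \<Sum>j<J. c * 2 ^ j * a n (c * 2 ^ j)) + L * (\<Sum>j<J. c * 2 ^ j * a L (c * 2 ^ j))"
    by (subst sum.swap) (simp add: sum.distrib sum_distrib_left)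
  also have "\<dots> \<le> 2 * (\<Sum>n<L. 2 * B) + L * (2 * B)"
    using layer \<eta> by (intro add_mono mult_left_mono sum_mono) auto
  finally have "real L * (J * \<eta> / (8 * A ^ 4)) \<le> real L * (6 * B)" by (simp add: mult_ac)
  then have "J * \<eta> / (8 * A ^ 4) \<le> 6 * B"
    by (rule mult_left_le_imp_le) (simp add: L_def)
  then show ?thesis using A B unfolding \<eta>_def by (simp add: field_simps power2_eq_square)
qed

section \<open>Weak sequential compactness\<close>

text \<open>
  A diagonal subsequence makes the integrals over a countable generating system converge. Dominated
  convergence for series extends the convergence to the generated sigma-algebra and shows that the
  limits form a measure; it is dominated by K times the given one, so its Radon-Nikodym derivative
  is the weak limit. The index i ranges over countably many sequences that are treated at once.
\<close>

lemma (in finite_measure) weakly_convergent_subsequence: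
  fixes h :: "'i::countable \<Rightarrow> nat \<Rightarrow> 'a \<Rightarrow> real" and K :: "'i \<Rightarrow> real"
  assumes cG: "countable G" and iG: "Int_stable G" and GM: "G \<subseteq> sets M"
    and gen: "\<And>D. D \<in> sets M \<Longrightarrow> \<exists>D'\<in>sigma_sets (space M) G. AE x in M. x \<in> D \<longleftrightarrow> x \<in> D'"
    and h[measurable]: "\<And>i N. h i N \<in> borel_measurable M"
    and h0: "\<And>i N x. x \<in> space M \<Longrightarrow> 0 \<le> h i N x" and hK: "\<And>i N x. x \<in> space M \<Longrightarrow> h i N x \<le> K i"
    and K: "\<And>i. 0 \<le> K i"
  shows "\<exists>r. strict_mono r \<and> (\<forall>i. \<exists>\<Lambda>\<in>borel_measurable M. (\<forall>x. 0 \<le> \<Lambda> x \<and> \<Lambda> x \<le> K i) \<and>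
    (\<forall>D\<in>sets M. (\<lambda>N. LINT x|M. indicator D x * h i (r N) x) \<longlonglongrightarrow> (LINT x|M. indicator D x * \<Lambda> x)))"
proof -
  define a where "a = (\<lambda>i D N. LINT x|M. indicator D x * h i N x)"
  have int: "integrable M (\<lambda>x. indicator D x * h i N x)" if [measurable]: "D \<in> sets M" for D i N
  proof (rule integrable_const_bound[of _ "K i"])
    show "AE x in M. norm (indicator D x * h i N x) \<le> K i"
      using h0 hK K by (intro AE_I2) (auto simp: indicator_def)
  qed measurable
  have a0: "0 \<le> a i D N" for i D N
    unfolding a_def by (rule Bochner_Integration.integral_nonneg) (use h0 in \<open>auto simp: indicator_def\<close>)
  have intI: "integrable M (\<lambda>x. indicator D x :: real)" if "D \<in> sets M" for D
    using that by (simp add: finite_measure.emeasure_finite less_top[symmetric])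
  have aK: "a i D N \<le> K i * measure M D" if D: "D \<in> sets M" for i D N
  proof -
    have "a i D N \<le> (LINT x|M. K i * indicator D x)"
      unfolding a_def using hK[of _ i N] intI[OF D]
      by (intro integral_mono int D integrable_mult_right) (auto simp: indicator_def)
    also have "\<dots> = K i * measure M D" using sets.sets_into_space[OF D] by (simp add: Int_absorb2)
    finally show ?thesis .
  qed
  have asuminf: "(\<lambda>j. a i (E j) N) sums a i (\<Union>j. E j) N"
    if dE: "disjoint_family E" and E[measurable]: "\<And>j. E j \<in> sets M" for i E N
  proof -
    have cov: "(\<lambda>j. indicator (E j) x * h i N x) sums (indicator (\<Union>j. E j) x * h i N x)" for x :: 'a
      using indicator_sums[of E x] dE
      by (intro sums_mult2) (auto simp: disjoint_family_on_def)
    have sm: "(\<lambda>j. measure M (E j)) sums measure M (\<Union>j. E j)"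
      using dE E by (intro finite_measure_UNION) auto
    have "(\<lambda>j. LINT x|M. indicator (E j) x * h i N x) sums (LINT x|M. (\<Sum>j. indicator (E j) x * h i N x))"
    proof (rule sums_integral)
      show "integrable M (\<lambda>x. indicator (E j) x * h i N x)" for j by (rule int) simp
      show "AE x in M. summable (\<lambda>j. norm (indicator (E j) x * h i N x))"
        using h0 by (intro AE_I2) (simp add: abs_mult sums_summable[OF cov])
      show "summable (\<lambda>j. LINT x|M. norm (indicator (E j) x * h i N x))"
      proof (rule summable_comparison_test')
        show "summable (\<lambda>j. K i * measure M (E j))" using sm by (intro summable_mult) (rule sums_summable)
        fix j
        have "(LINT x|M. norm (indicator (E j) x * h i N x)) = a i (E j) N"
          unfolding a_def using h0 by (intro Bochner_Integration.integral_cong) (auto simp: abs_mult)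
        then show "norm (LINT x|M. norm (indicator (E j) x * h i N x)) \<le> K i * measure M (E j)"
          using aK[OF E, of i j N] a0[of i "E j" N] by simp
      qed
    qed
    then show ?thesis using sums_unique[OF cov] by (simp add: a_def)
  qed
  define G' where "G' = insert (space M) (insert {} G)"
  have G': "countable G'" "G' \<noteq> {}" using cG by (auto simp: G'_def)
  define e where "e = from_nat_into G'"
  have eM: "e j \<in> sets M" for j
    using from_nat_into[OF G'(2), of j] GM by (auto simp: e_def G'_def)
  define P where "P = (\<lambda>n (s::nat\<Rightarrow>nat). convergent (\<lambda>N. a (from_nat (fst (prod_decode n))) (e (snd (prod_decode n))) (s N)))"
  interpret subseqs P
  proof
    fix n and s :: "nat \<Rightarrow> nat"
    let ?x = "\<lambda>N. a (from_nat (fst (prod_decode n))) (e (snd (prod_decode n))) (s N)"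
    have "bounded (range ?x)"
      using a0 aK[OF eM] by (intro boundedI[of _ "K (from_nat (fst (prod_decode n))) * measure M (e (snd (prod_decode n)))"]) auto
    then obtain l r where "strict_mono r" "(?x \<circ> r) \<longlonglongrightarrow> l"
      using bounded_imp_convergent_subsequence by blast
    then show "\<exists>r'. strict_mono r' \<and> P n (s \<circ> r')"
      by (auto simp: P_def convergent_def o_def)
  qed
  define r where "r = diagseq"
  have r: "strict_mono r" unfolding r_def by (rule subseq_diagseq)
  have convP: "P k r" for k
  proof -
    have "P k (diagseq \<circ> ((+) (Suc k)))"
    proof (rule diagseq_holds)
      fix q s :: "nat \<Rightarrow> nat" and n assume "strict_mono q" "P n s"
      then show "P n (s \<circ> q)"
        unfolding P_def using convergent_subseq_convergent[of _ q] by (auto simp: o_def)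
    qed
    then show ?thesis
      unfolding P_def r_def using convergent_ignore_initial_segment[of _ "Suc k"]
      by (auto simp: o_def add.commute)
  qed
  have convG: "convergent (\<lambda>N. a i D (r N))" if D: "D \<in> G'" for i D
  proof -
    obtain j where "e j = D" using from_nat_into_surj[OF G'(1) D] by (auto simp: e_def)
    then show ?thesis using convP[of "prod_encode (to_nat i, j)"] by (simp add: P_def)
  qed
  have tannery: "summable (\<lambda>j. lim (\<lambda>N. a i (E j) (r N)))"
      "(\<lambda>N. a i (\<Union>j. E j) (r N)) \<longlonglongrightarrow> (\<Sum>j. lim (\<lambda>N. a i (E j) (r N)))"
    if dE: "disjoint_family E" and E: "\<And>j. E j \<in> sets M" and c: "\<And>j. convergent (\<lambda>N. a i (E j) (r N))" for i E
  proof -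
    have sm: "summable (\<lambda>j. K i * measure M (E j))"
      using finite_measure_UNION[OF _ dE] E by (intro summable_mult) (auto simp: sums_iff)
    have *: "\<forall>\<^sub>F (k, n) in at_top \<times>\<^sub>F sequentially. norm (a i (E k) (r n)) \<le> K i * measure M (E k)"
      using aK[OF E] a0 by (intro always_eventually) auto
    have c': "(\<lambda>N. a i (E j) (r N)) \<longlonglongrightarrow> lim (\<lambda>N. a i (E j) (r N))" for j
      using c by (simp add: convergent_LIMSEQ_iff)
    have u: "a i (\<Union>j. E j) (r N) = (\<Sum>j. a i (E j) (r N))" for N
      using asuminf[OF dE E] by (simp add: sums_iff)
    note T = tannerys_theorem[where a="\<lambda>k n. a i (E k) (r n)" and F=sequentially, OF c' * sm]
    show "summable (\<lambda>j. lim (\<lambda>N. a i (E j) (r N)))" using T by (auto intro: summable_norm_cancel)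
    show "(\<lambda>N. a i (\<Union>j. E j) (r N)) \<longlonglongrightarrow> (\<Sum>j. lim (\<lambda>N. a i (E j) (r N)))"
      unfolding u using T by auto
  qed
  have Gpow: "G \<subseteq> Pow (space M)" using GM sets.space_closed by blast
  have sigM: "sigma_sets (space M) G \<subseteq> sets M" using GM by (rule sets.sigma_sets_subset)
  have "convergent (\<lambda>N. a i (space M) (r N))" for i
    using convG by (simp add: G'_def)
  have conv: "convergent (\<lambda>N. a i D (r N))" if D: "D \<in> sets M" for i D
  proof -
    obtain D' where D': "D' \<in> sigma_sets (space M) G" "AE x in M. x \<in> D \<longleftrightarrow> x \<in> D'"
      using gen[OF D] by blast
    have "convergent (\<lambda>N. a i D' (r N))"
      using iG Gpow D'(1)
    proof (induction rule: sigma_sets_induct_disjoint)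
      case (basic A)
      then show ?case using convG by (simp add: G'_def)
    next
      case empty
      then show ?case by (simp add: a_def convergent_const)
    next
      case (compl A)
      then have [measurable]: "A \<in> sets M" using sigM by auto
      have "a i (space M - A) N = a i (space M) N - a i A N" for N
      proof -
        have "a i (space M) N - a i A N = (LINT x|M. indicator (space M) x * h i N x - indicator A x * h i N x)"
          unfolding a_def by (rule Bochner_Integration.integral_diff[symmetric]; rule int) simp_all
        also have "\<dots> = a i (space M - A) N"
          unfolding a_def by (intro Bochner_Integration.integral_cong) (auto simp: indicator_def)
        finally show ?thesis ..
      qed
      then show ?case using compl \<open>convergent (\<lambda>N. a i (space M) (r N))\<close> by (simp add: convergent_diff)
    next
      case (union E)
      then have "\<And>j. E j \<in> sets M" using sigM by auto
      from tannery(2)[OF union(1) this union(3)] show ?case by (rule convergentI)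
    qed
    moreover have "a i D N = a i D' N" for N
      unfolding a_def
    proof (rule integral_cong_AE)
      show "AE x in M. indicator D x * h i N x = indicator D' x * h i N x"
        using D'(2) by eventually_elim (auto simp: indicator_def)
    qed (use D D'(1) sigM in auto)
    ultimately show ?thesis by simp
  qed
  have lims: "\<exists>\<Lambda>\<in>borel_measurable M. (\<forall>x. 0 \<le> \<Lambda> x \<and> \<Lambda> x \<le> K i) \<and>
    (\<forall>D\<in>sets M. (\<lambda>N. a i D (r N)) \<longlonglongrightarrow> (LINT x|M. indicator D x * \<Lambda> x))" for i
  proof -
    define \<nu> where "\<nu> = (\<lambda>D. lim (\<lambda>N. a i D (r N)))"
    have \<nu>: "(\<lambda>N. a i D (r N)) \<longlonglongrightarrow> \<nu> D" if "D \<in> sets M" for D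
      using conv[OF that] by (simp add: \<nu>_def convergent_LIMSEQ_iff)
    have \<nu>0: "0 \<le> \<nu> D" and \<nu>K: "\<nu> D \<le> K i * measure M D" if "D \<in> sets M" for D
      using LIMSEQ_le_const[OF \<nu>[OF that], of 0] LIMSEQ_le_const2[OF \<nu>[OF that], of "K i * measure M D"]
        a0 aK[OF that] by auto
    define N where "N = measure_of (space M) (sets M) (\<lambda>D. ennreal (\<nu> D))"
    have sN[simp]: "sets N = sets M" "space N = space M" by (simp_all add: N_def)
    have eN: "emeasure N D = ennreal (\<nu> D)" if "D \<in> sets M" for D
      unfolding N_def
    proof (rule emeasure_measure_of_sigma[OF sets.sigma_algebra_axioms _ _ that])
      show "positive (sets M) (\<lambda>D. ennreal (\<nu> D))"
        using \<nu>K[of "{}"] \<nu>0[of "{}"] by (simp add: positive_def)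
      show "countably_additive (sets M) (\<lambda>D. ennreal (\<nu> D))"
      proof (rule countably_additiveI)
        fix E :: "nat \<Rightarrow> 'a set" assume E: "range E \<subseteq> sets M" "disjoint_family E" "(\<Union>j. E j) \<in> sets M"
        then have EM: "E j \<in> sets M" for j by auto
        have "(\<lambda>N. a i (\<Union>j. E j) (r N)) \<longlonglongrightarrow> (\<Sum>j. \<nu> (E j))" and sm: "summable (\<lambda>j. \<nu> (E j))"
          using tannery[OF E(2) EM conv[OF EM]] by (simp_all add: \<nu>_def)
        then have "\<nu> (\<Union>j. E j) = (\<Sum>j. \<nu> (E j))"
          using LIMSEQ_unique[OF \<nu>[OF E(3)]] by simp
        then show "(\<Sum>j. ennreal (\<nu> (E j))) = ennreal (\<nu> (\<Union>j. E j))"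
          using sm \<nu>0[OF EM] by (simp add: suminf_ennreal2)
      qed
    qed
    have "\<exists>f\<in>borel_measurable M. density M f = N"
    proof (rule Radon_Nikodym_finite_measure)
      show "finite_measure N"
        by (rule finite_measureI) (simp add: eN)
      show "absolutely_continuous M N"
        unfolding absolutely_continuous_def
      proof
        fix D assume "D \<in> null_sets M"
        then have "D \<in> sets M" "measure M D = 0" by (auto simp: measure_eq_0_null_sets)
        then have "\<nu> D = 0" using \<nu>0[of D] \<nu>K[of D] by simp
        then show "D \<in> null_sets N" using \<open>D \<in> sets M\<close> by (auto simp: null_sets_def eN)
      qed
    qed simp
    then obtain f where f[measurable]: "f \<in> borel_measurable M" and fN: "density M f = N" by blast
    have fD: "(\<integral>\<^sup>+x. f x * indicator D x \<partial>M) = ennreal (\<nu> D)" if "D \<in> sets M" for D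
      using emeasure_density[OF f that] eN[OF that] by (simp add: fN)
    have AEK: "AE x in M. f x \<le> ennreal (K i)"
    proof -
      define D where "D = {x\<in>space M. ennreal (K i) < f x}"
      have D[measurable]: "D \<in> sets M" by (simp add: D_def)
      have KD: "(\<integral>\<^sup>+x. ennreal (K i) * indicator D x \<partial>M) = ennreal (K i * measure M D)"
        using K by (simp add: nn_integral_cmult_indicator emeasure_eq_measure ennreal_mult)
      have "(\<integral>\<^sup>+x. f x * indicator D x - ennreal (K i) * indicator D x \<partial>M)
        = (\<integral>\<^sup>+x. f x * indicator D x \<partial>M) - (\<integral>\<^sup>+x. ennreal (K i) * indicator D x \<partial>M)"
      proof (rule nn_integral_diff)
        show "(\<integral>\<^sup>+x. ennreal (K i) * indicator D x \<partial>M) \<noteq> \<infinity>" unfolding KD by simp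
        show "AE x in M. ennreal (K i) * indicator D x \<le> f x * indicator D x"
          by (intro AE_I2) (auto simp: D_def indicator_def)
      qed measurable
      also note KD
      also have "(\<integral>\<^sup>+x. f x * indicator D x \<partial>M) - ennreal (K i * measure M D) = 0"
        unfolding fD[OF D] by (intro diff_eq_0_ennreal ennreal_leI \<nu>K D) simp
      finally have "AE x in M. f x * indicator D x - ennreal (K i) * indicator D x = 0"
        by (subst (asm) nn_integral_0_iff_AE) simp_all
      then show ?thesis
      proof (rule AE_mp, intro AE_I2 impI)
        fix x assume x: "x \<in> space M" "f x * indicator D x - ennreal (K i) * indicator D x = 0"
        show "f x \<le> ennreal (K i)"
        proof (rule ccontr)
          assume "\<not> f x \<le> ennreal (K i)"
          then have "x \<in> D" using x by (simp add: D_def)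
          then have "f x - ennreal (K i) = 0" using x by simp
          then show False using \<open>\<not> f x \<le> ennreal (K i)\<close> by (simp add: diff_eq_0_iff_ennreal)
        qed
      qed
    qed
    define \<Lambda> where "\<Lambda> = (\<lambda>x. enn2real (min (f x) (ennreal (K i))))"
    have [measurable]: "\<Lambda> \<in> borel_measurable M" unfolding \<Lambda>_def by measurable
    have \<Lambda>b: "0 \<le> \<Lambda> x \<and> \<Lambda> x \<le> K i" for x
      using K enn2real_mono[of "min (f x) (ennreal (K i))" "ennreal (K i)"] by (auto simp: \<Lambda>_def)
    have "(LINT x|M. indicator D x * \<Lambda> x) = \<nu> D" if D[measurable]: "D \<in> sets M" for D
    proof -
      have "(LINT x|M. indicator D x * \<Lambda> x) = enn2real (\<integral>\<^sup>+x. ennreal (indicator D x * \<Lambda> x) \<partial>M)"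
        using \<Lambda>b by (intro integral_eq_nn_integral) auto
      also have "(\<integral>\<^sup>+x. ennreal (indicator D x * \<Lambda> x) \<partial>M) = (\<integral>\<^sup>+x. f x * indicator D x \<partial>M)"
      proof (rule nn_integral_cong_AE)
        show "AE x in M. ennreal (indicator D x * \<Lambda> x) = f x * indicator D x"
          using AEK by eventually_elim (auto simp: \<Lambda>_def indicator_def min_def ennreal_enn2real_if top_unique)
      qed
      finally show ?thesis using fD[OF D] \<nu>0[OF D] by simp
    qed
    then show ?thesis using \<nu> \<Lambda>b by (intro bexI[of _ \<Lambda>]) auto
  qed
  show ?thesis using r lims unfolding a_def by blast
qed

section \<open>Roundings, cells and tilted densities\<close>

definition grid_round :: "real \<Rightarrow> real \<Rightarrow> real" where
  "grid_round e v = e * of_int \<lfloor>v / e\<rfloor>"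

lemma grid_round_bounds:
  assumes "e > 0"
  shows "grid_round e v \<le> v" "v \<le> grid_round e v + e"
proof -
  have "of_int \<lfloor>v / e\<rfloor> \<le> v / e" "v / e \<le> of_int \<lfloor>v / e\<rfloor> + 1" by linarith+
  from mult_left_mono[OF this(1), of e] mult_left_mono[OF this(2), of e] assms
  show "grid_round e v \<le> v" "v \<le> grid_round e v + e"
    by (simp_all add: grid_round_def algebra_simps)
qed

lemma grid_round_close:
  assumes "e > 0"
  shows "\<bar>v - grid_round e v\<bar> \<le> e"
  using grid_round_bounds[OF assms, of v] by linarith

lemma simple_function_grid_index:
  fixes h :: "'a \<Rightarrow> real"
  assumes [measurable]: "h \<in> borel_measurable M" and hC: "\<And>x. x \<in> space M \<Longrightarrow> \<bar>h x\<bar> \<le> C" and "e > 0"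
  shows "simple_function M (\<lambda>x. \<lfloor>h x / e\<rfloor>)"
  unfolding simple_function_def
proof (intro conjI ballI)
  have "(\<lambda>x. \<lfloor>h x / e\<rfloor>) ` space M \<subseteq> {\<lfloor>- C / e\<rfloor>..\<lfloor>C / e\<rfloor>}"
  proof (rule image_subsetI)
    fix x assume "x \<in> space M"
    from hC[OF this] have "- C \<le> h x" "h x \<le> C" by linarith+
    then have "- C / e \<le> h x / e" "h x / e \<le> C / e"
      using \<open>e > 0\<close> by (intro divide_right_mono; simp)+
    then show "\<lfloor>h x / e\<rfloor> \<in> {\<lfloor>- C / e\<rfloor>..\<lfloor>C / e\<rfloor>}" by (simp add: floor_mono del: minus_divide_left)
  qed
  then show "finite ((\<lambda>x. \<lfloor>h x / e\<rfloor>) ` space M)" by (rule finite_subset) simp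
  show "(\<lambda>x. \<lfloor>h x / e\<rfloor>) -` {y} \<inter> space M \<in> sets M" for y
  proof -
    have "(\<lambda>x. \<lfloor>h x / e\<rfloor>) \<in> measurable M (count_space UNIV)" by measurable
    then show ?thesis by (rule measurable_sets) simp
  qed
qed

lemma simple_function_grid_round:
  fixes h :: "'a \<Rightarrow> real"
  assumes "h \<in> borel_measurable M" "\<And>x. x \<in> space M \<Longrightarrow> \<bar>h x\<bar> \<le> C" "e > 0"
  shows "simple_function M (\<lambda>x. grid_round e (h x))"
  using simple_function_compose1[OF simple_function_grid_index[OF assms], of "\<lambda>i. e * of_int i"]
  by (simp add: grid_round_def)

lemma simple_function_map:
  assumes "\<And>k. simple_function M (h k)"
  shows "simple_function M (\<lambda>y. map (\<lambda>k. h k y) ks)"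
proof (induction ks)
  case Nil
  then show ?case by simp
next
  case (Cons k ks)
  show ?case
    using simple_function_compose2[OF assms[of k] Cons, of "\<lambda>v l. v # l"] by simp
qed

text \<open>
  The conditional probability of Q given the cell c = j. On null cells the quotient is 0, which is
  harmless because integrals do not see such cells.
\<close>

definition cell_fraction :: "'a measure \<Rightarrow> ('a \<Rightarrow> 'b) \<Rightarrow> 'a set \<Rightarrow> 'b \<Rightarrow> real" where
  "cell_fraction M c Q j = measure M (c -` {j} \<inter> space M \<inter> Q) / measure M (c -` {j} \<inter> space M)"

context prob_space
begin

lemma integral_over_cells:
  fixes w :: "'b \<Rightarrow> real" and D :: "'a \<Rightarrow> real"
  assumes c: "simple_function M c" and D: "integrable M D"
  shows "integrable M (\<lambda>y. w (c y) * D y)"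
    and "expectation (\<lambda>y. w (c y) * D y)
      = (\<Sum>j\<in>c ` space M. w j * expectation (\<lambda>y. indicator (c -` {j} \<inter> space M) y * D y))"
proof -
  have cell[measurable]: "c -` {j} \<inter> space M \<in> sets M" for j using simple_functionD(2)[OF c] .
  have fin: "finite (c ` space M)" using simple_functionD(1)[OF c] .
  have eq: "w (c y) * D y = (\<Sum>j\<in>c ` space M. w j * (indicator (c -` {j} \<inter> space M) y * D y))"
    if "y \<in> space M" for y
  proof -
    have "(\<Sum>j\<in>c ` space M. w j * (indicator (c -` {j} \<inter> space M) y * D y))
        = (\<Sum>j\<in>{c y}. w j * (indicator (c -` {j} \<inter> space M) y * D y))"
      using that fin by (intro sum.mono_neutral_right) (auto simp: indicator_def)
    then show ?thesis using that by simp
  qed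
  have int: "integrable M (\<lambda>y. w j * (indicator (c -` {j} \<inter> space M) y * D y))" for j
  proof -
    have "(\<lambda>y. indicator (c -` {j} \<inter> space M) y * D y) = (\<lambda>y. D y * indicator (c -` {j} \<inter> space M) y)"
      by (rule ext) (rule mult.commute)
    then show ?thesis by (simp only: integrable_mult_right integrable_real_mult_indicator[OF cell D])
  qed
  have "integrable M (\<lambda>y. \<Sum>j\<in>c ` space M. w j * (indicator (c -` {j} \<inter> space M) y * D y))"
    by (intro Bochner_Integration.integrable_sum int)
  then show "integrable M (\<lambda>y. w (c y) * D y)"
    using eq by (subst Bochner_Integration.integrable_cong[OF refl]) auto
  have "expectation (\<lambda>y. w (c y) * D y)
      = expectation (\<lambda>y. \<Sum>j\<in>c ` space M. w j * (indicator (c -` {j} \<inter> space M) y * D y))"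
    by (intro Bochner_Integration.integral_cong refl eq)
  also have "\<dots> = (\<Sum>j\<in>c ` space M. w j * expectation (\<lambda>y. indicator (c -` {j} \<inter> space M) y * D y))"
    by (simp only: Bochner_Integration.integral_sum[OF int] integral_mult_right_zero)
  finally show "expectation (\<lambda>y. w (c y) * D y)
      = (\<Sum>j\<in>c ` space M. w j * expectation (\<lambda>y. indicator (c -` {j} \<inter> space M) y * D y))" .
qed

lemma cell_fraction_range: "0 \<le> cell_fraction M c Q j" "cell_fraction M c Q j \<le> 1"
  if c: "simple_function M c"
proof -
  have "c -` {j} \<inter> space M \<in> sets M" using simple_functionD(2)[OF c] .
  then have "prob (c -` {j} \<inter> space M \<inter> Q) \<le> prob (c -` {j} \<inter> space M)"
    by (intro finite_measure_mono) auto
  then show "0 \<le> cell_fraction M c Q j" "cell_fraction M c Q j \<le> 1"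
    by (simp_all add: cell_fraction_def divide_le_eq measure_nonneg zero_less_measure_iff)
qed

text \<open>
  Subtracting the conditional probability of Q given c leaves a function orthogonal to every function
  of c.
\<close>

lemma cell_fraction_mean_zero:
  fixes w :: "'b \<Rightarrow> real"
  assumes c: "simple_function M c" and Q[measurable]: "Q \<in> sets M"
  shows "expectation (\<lambda>y. w (c y) * (indicator Q y - cell_fraction M c Q (c y))) = 0"
proof -
  have cell[measurable]: "c -` {j} \<inter> space M \<in> sets M" for j using simple_functionD(2)[OF c] .
  have iQ: "integrable M (indicator Q :: 'a \<Rightarrow> real)" by (rule integrable_bounded[of _ 1]) (auto simp: indicator_def)
  have i1: "integrable M (\<lambda>y. 1 :: real)" by simp
  have "expectation (\<lambda>y. w (c y) * indicator Q y)
      = (\<Sum>j\<in>c ` space M. w j * expectation (\<lambda>y. indicator (c -` {j} \<inter> space M) y * indicator Q y))"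
    by (rule integral_over_cells(2)[OF c iQ])
  also have "\<dots> = (\<Sum>j\<in>c ` space M. w j * cell_fraction M c Q j * expectation (\<lambda>y. indicator (c -` {j} \<inter> space M) y * 1))"
  proof (rule sum.cong[OF refl])
    fix j
    have "prob (c -` {j} \<inter> space M \<inter> Q) = cell_fraction M c Q j * prob (c -` {j} \<inter> space M)"
    proof (cases "prob (c -` {j} \<inter> space M) = 0")
      case True
      then have "prob (c -` {j} \<inter> space M \<inter> Q) \<le> 0"
        using finite_measure_mono[of "c -` {j} \<inter> space M \<inter> Q" "c -` {j} \<inter> space M"] cell by auto
      then show ?thesis using True by (simp add: measure_le_0_iff)
    next
      case False
      then show ?thesis by (simp add: cell_fraction_def)
    qed
    moreover have "expectation (\<lambda>y. indicator (c -` {j} \<inter> space M) y * indicator Q y) = prob (c -` {j} \<inter> space M \<inter> Q)"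
    proof -
      have "expectation (\<lambda>y. indicator (c -` {j} \<inter> space M) y * indicator Q y :: real)
          = expectation (indicator (c -` {j} \<inter> space M \<inter> Q))"
        by (intro Bochner_Integration.integral_cong) (auto simp: indicator_def)
      then show ?thesis by (simp add: Int_absorb2 Int_assoc[symmetric] inf_commute)
    qed
    moreover have "expectation (\<lambda>y. indicator (c -` {j} \<inter> space M) y * 1) = prob (c -` {j} \<inter> space M)"
      by simp
    ultimately show "w j * expectation (\<lambda>y. indicator (c -` {j} \<inter> space M) y * indicator Q y)
      = w j * cell_fraction M c Q j * expectation (\<lambda>y. indicator (c -` {j} \<inter> space M) y * 1)"
      by simp
  qed
  also have "\<dots> = expectation (\<lambda>y. (w (c y) * cell_fraction M c Q (c y)) * 1)"
    by (rule integral_over_cells(2)[OF c i1, symmetric])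
  finally have e: "expectation (\<lambda>y. w (c y) * indicator Q y) = expectation (\<lambda>y. w (c y) * cell_fraction M c Q (c y))"
    by simp
  have "integrable M (\<lambda>y. w (c y) * cell_fraction M c Q (c y))"
    using integral_over_cells(1)[OF c i1, of "\<lambda>j. w j * cell_fraction M c Q j"] by simp
  then show ?thesis
    using e integral_over_cells(1)[OF c iQ, of w] by (simp add: right_diff_distrib)
qed

text \<open>
  The new density is w(c) (1 + 1_{D > 0} - \<theta>(c)), with \<theta> the conditional probability of
  {D > 0} given c. Its pairing with D contains w(c) times the positive part of D, which is
  half of \<integral>w(c)|D| up to \<integral>w(c) D; that term and the one with 1 - \<theta>(c) are
  integrals of D against functions of c, and these are small by assumption.
\<close>

lemma tilt_density:
  fixes w :: "'b \<Rightarrow> real" and D :: "'a \<Rightarrow> real"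
  assumes c: "simple_function M c" and w0: "\<And>j. 0 \<le> w j"
    and D[measurable]: "D \<in> borel_measurable M" and DC: "\<And>y. y \<in> space M \<Longrightarrow> \<bar>D y\<bar> \<le> C"
    and small: "\<And>v. (\<And>j. 0 \<le> v j \<and> v j \<le> w j) \<Longrightarrow> \<bar>expectation (\<lambda>y. v (c y) * D y)\<bar> \<le> 1"
  obtains P where "simple_function M P" "\<And>y. 0 \<le> P y"
    "\<And>v. expectation (\<lambda>y. P y * v (c y)) = expectation (\<lambda>y. w (c y) * v (c y))"
    "expectation (\<lambda>y. P y * D y) \<ge> expectation (\<lambda>y. w (c y) * \<bar>D y\<bar>) / 2 - 2"
proof -
  define Q where "Q = {y\<in>space M. D y > 0}"
  have Q[measurable]: "Q \<in> sets M" unfolding Q_def by measurable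
  define \<theta> where "\<theta> = cell_fraction M c Q"
  have \<theta>: "0 \<le> \<theta> j" "\<theta> j \<le> 1" for j using cell_fraction_range[OF c] by (auto simp: \<theta>_def)
  define P where "P = (\<lambda>y. w (c y) * (1 + indicator Q y - \<theta> (c y)))"
  have iD: "integrable M D" by (rule integrable_bounded[OF D DC])
  have iaD: "integrable M (\<lambda>y. \<bar>D y\<bar>)" using iD by (rule integrable_abs)
  have iQ: "integrable M (\<lambda>y. indicator Q y - \<theta> (c y))"
  proof (rule integrable_bounded[of _ 1])
    show "(\<lambda>y. indicator Q y - \<theta> (c y)) \<in> borel_measurable M"
      by (intro borel_measurable_diff borel_measurable_simple_function[OF simple_function_compose1[OF c]]) simp
    show "\<bar>indicator Q y - \<theta> (c y)\<bar> \<le> 1" for y using \<theta>[of "c y"] by (auto simp: indicator_def)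
  qed
  show thesis
  proof (rule that[of P])
    have "simple_function M (indicator Q :: 'a \<Rightarrow> real)" using Q by (rule simple_function_indicator)
    from simple_function_compose2[OF c this, of "\<lambda>j q. w j * (1 + q - \<theta> j)"]
    show "simple_function M P" by (simp add: P_def)
    show "0 \<le> P y" for y
      unfolding P_def using w0 \<theta>[of "c y"] by (intro mult_nonneg_nonneg) (auto simp: indicator_def)
    show "expectation (\<lambda>y. P y * v (c y)) = expectation (\<lambda>y. w (c y) * v (c y))" for v :: "'b \<Rightarrow> real"
    proof -
      have "expectation (\<lambda>y. P y * v (c y))
        = expectation (\<lambda>y. (w (c y) * v (c y)) * 1 + (w (c y) * v (c y)) * (indicator Q y - \<theta> (c y)))"
        by (intro Bochner_Integration.integral_cong) (auto simp: P_def algebra_simps)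
      also have "\<dots> = expectation (\<lambda>y. (w (c y) * v (c y)) * 1)
          + expectation (\<lambda>y. (w (c y) * v (c y)) * (indicator Q y - \<theta> (c y)))"
        using integral_over_cells(1)[OF c, of "\<lambda>_. 1" "\<lambda>j. w j * v j"]
          integral_over_cells(1)[OF c iQ, of "\<lambda>j. w j * v j"]
        by (intro Bochner_Integration.integral_add) auto
      also have "expectation (\<lambda>y. (w (c y) * v (c y)) * (indicator Q y - \<theta> (c y))) = 0"
        unfolding \<theta>_def by (rule cell_fraction_mean_zero[OF c Q, of "\<lambda>j. w j * v j"])
      finally show ?thesis by simp
    qed
    have i1: "integrable M (\<lambda>y. (w (c y) * (1 - \<theta> (c y))) * D y)"
      by (rule integral_over_cells(1)[OF c iD, of "\<lambda>j. w j * (1 - \<theta> j)"])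
    have i2: "integrable M (\<lambda>y. w (c y) * \<bar>D y\<bar>)" by (rule integral_over_cells(1)[OF c iaD])
    have i3: "integrable M (\<lambda>y. w (c y) * D y)" by (rule integral_over_cells(1)[OF c iD])
    have "expectation (\<lambda>y. P y * D y)
      = expectation (\<lambda>y. (w (c y) * (1 - \<theta> (c y))) * D y + (w (c y) * \<bar>D y\<bar> + w (c y) * D y) / 2)"
      by (intro Bochner_Integration.integral_cong) (auto simp: P_def Q_def indicator_def algebra_simps)
    also have "\<dots> = expectation (\<lambda>y. (w (c y) * (1 - \<theta> (c y))) * D y)
      + (expectation (\<lambda>y. w (c y) * \<bar>D y\<bar>) + expectation (\<lambda>y. w (c y) * D y)) / 2"
      using i1 i2 i3 by simp
    finally have e: "expectation (\<lambda>y. P y * D y) = expectation (\<lambda>y. (w (c y) * (1 - \<theta> (c y))) * D y)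
      + (expectation (\<lambda>y. w (c y) * \<bar>D y\<bar>) + expectation (\<lambda>y. w (c y) * D y)) / 2" .
    have "\<bar>expectation (\<lambda>y. (w (c y) * (1 - \<theta> (c y))) * D y)\<bar> \<le> 1"
      by (rule small[of "\<lambda>j. w j * (1 - \<theta> j)"]) (use w0 \<theta> in \<open>auto intro: mult_right_le_one_le\<close>)
    moreover have "\<bar>expectation (\<lambda>y. w (c y) * D y)\<bar> \<le> 1" by (rule small) (use w0 in auto)
    moreover have "e2 / 2 - 2 \<le> e1 + (e2 + e3) / 2" if "\<bar>e1\<bar> \<le> 1" "\<bar>e3\<bar> \<le> 1" for e1 e2 e3 :: real
      using that by argo
    ultimately show "expectation (\<lambda>y. P y * D y) \<ge> expectation (\<lambda>y. w (c y) * \<bar>D y\<bar>) / 2 - 2"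
      unfolding e by blast
  qed
qed

end

section \<open>Bounded biorthonormal systems\<close>

definition partial_sum ::
    "'a measure \<Rightarrow> (nat \<Rightarrow> 'a \<Rightarrow> real) \<Rightarrow> (nat \<Rightarrow> 'a \<Rightarrow> real) \<Rightarrow> ('a \<Rightarrow> real) \<Rightarrow> nat \<Rightarrow> 'a \<Rightarrow> real" where
  "partial_sum M f g F n x = (\<Sum>k<n. pairing M F (g k) * f k x)"

text \<open>
  The form of separability that gives weak sequential compactness for bounded sequences of functions.
\<close>

definition countably_generated_mod_null :: "'a measure \<Rightarrow> bool" where
  "countably_generated_mod_null M \<longleftrightarrow> (\<exists>G. countable G \<and> Int_stable G \<and> G \<subseteq> sets M \<and>
     (\<forall>D\<in>sets M. \<exists>D'\<in>sigma_sets (space M) G. AE x in M. x \<in> D \<longleftrightarrow> x \<in> D'))"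

text \<open>
  The standing hypotheses in a normalized form: indices start at 0, and the bounds hold everywhere
  on the space rather than almost everywhere.
\<close>

locale bounded_biorthonormal = prob_space M for M :: "'a measure" +
  fixes f g :: "nat \<Rightarrow> 'a \<Rightarrow> real" and A :: real
  assumes generated: "countably_generated_mod_null M"
    and f[measurable]: "\<And>k. f k \<in> borel_measurable M" and g[measurable]: "\<And>k. g k \<in> borel_measurable M"
    and f_le: "\<And>k x. x \<in> space M \<Longrightarrow> \<bar>f k x\<bar> \<le> A" and g_le: "\<And>k x. x \<in> space M \<Longrightarrow> \<bar>g k x\<bar> \<le> A"
    and A_ge_1: "A \<ge> 1"
    and biorth: "\<And>i j. expectation (\<lambda>x. f i x * g j x) = (if i = j then 1 else 0)"
    and f_null: "\<And>D. D \<in> sets M \<Longrightarrow> (\<lambda>n. expectation (\<lambda>x. indicator D x * f n x)) \<longlonglongrightarrow> 0"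
    and g_null: "\<And>D. D \<in> sets M \<Longrightarrow> (\<lambda>n. expectation (\<lambda>x. indicator D x * g n x)) \<longlonglongrightarrow> 0"

lemma (in bounded_biorthonormal) swapped: "bounded_biorthonormal M g f A"
proof
  show "expectation (\<lambda>x. g i x * f j x) = (if i = j then 1 else 0)" for i j
    using biorth[of j i] by (simp add: mult.commute eq_commute)
qed (use generated f g f_le g_le A_ge_1 f_null g_null in auto)

context prob_space
begin

lemma pairing_abs_le:
  fixes q h :: "'a \<Rightarrow> real"
  assumes q: "integrable M q" "\<And>y. 0 \<le> q y"
    and h[measurable]: "h \<in> borel_measurable M" and hC: "\<And>y. y \<in> space M \<Longrightarrow> \<bar>h y\<bar> \<le> C"
  shows "integrable M (\<lambda>y. q y * h y)" "\<bar>pairing M q h\<bar> \<le> C * expectation q"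
    "expectation (\<lambda>y. \<bar>q y * h y\<bar>) \<le> C * expectation q"
proof -
  have [measurable]: "q \<in> borel_measurable M" using q(1) by (rule borel_measurable_integrable)
  have ub: "\<bar>q y * h y\<bar> \<le> C * q y" if "y \<in> space M" for y
    using mult_left_mono[OF hC[OF that] q(2)[of y]] q(2)[of y] by (simp add: abs_mult mult.commute)
  show i: "integrable M (\<lambda>y. q y * h y)"
    by (rule Bochner_Integration.integrable_bound[of _ "\<lambda>y. C * q y"])
      (use q ub in \<open>auto intro!: AE_I2 order.trans[OF _ abs_ge_self]\<close>)
  have "expectation (\<lambda>y. \<bar>q y * h y\<bar>) \<le> expectation (\<lambda>y. C * q y)"
    by (rule integral_mono) (use i q ub in \<open>auto intro: integrable_abs\<close>)
  then show 3: "expectation (\<lambda>y. \<bar>q y * h y\<bar>) \<le> C * expectation q" by simp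
  have "\<bar>pairing M q h\<bar> \<le> expectation (\<lambda>y. \<bar>q y * h y\<bar>)"
    unfolding pairing_def by (rule integral_abs_bound)
  then show "\<bar>pairing M q h\<bar> \<le> C * expectation q" using 3 by linarith
qed

lemma density_pairing_le:
  fixes P h :: "'a \<Rightarrow> real"
  assumes P: "integrable M P" "\<And>y. 0 \<le> P y" "expectation P = 1"
    and h: "h \<in> borel_measurable M" and hC: "\<And>y. y \<in> space M \<Longrightarrow> \<bar>h y\<bar> \<le> C"
  shows "integrable M (\<lambda>y. P y * h y)" "\<bar>pairing M P h\<bar> \<le> C"
  using pairing_abs_le(1,2)[OF P(1,2) h hC] P(3) by simp_all

text \<open>
  Two roundings are compared at once: of the functions that are paired with the density, and of the
  values of the system at the point where the sum is evaluated.
\<close>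

lemma rounded_window_sum:
  fixes P :: "'a \<Rightarrow> real" and H H' :: "nat \<Rightarrow> 'a \<Rightarrow> real" and u \<phi> :: "nat \<Rightarrow> real"
  assumes P: "integrable M P" "\<And>y. 0 \<le> P y" "expectation P = 1"
    and H: "\<And>k. H k \<in> borel_measurable M" "\<And>k y. y \<in> space M \<Longrightarrow> \<bar>H k y\<bar> \<le> C"
    and H': "\<And>k. H' k \<in> borel_measurable M" "\<And>k y. y \<in> space M \<Longrightarrow> \<bar>H' k y\<bar> \<le> C"
    and e: "\<And>k y. y \<in> space M \<Longrightarrow> \<bar>H k y - H' k y\<bar> \<le> e" "\<And>k. k < n \<Longrightarrow> \<bar>\<phi> k - u k\<bar> \<le> e'"
    and u: "\<And>k. k < n \<Longrightarrow> \<bar>u k\<bar> \<le> C" and C: "C \<ge> 0"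
  shows "\<bar>(\<Sum>k<n. u k * pairing M P (H k)) - (\<Sum>k<n. pairing M P (H' k) * \<phi> k)\<bar> \<le> real n * (C * (e + e'))"
proof -
  have "\<bar>u k * pairing M P (H k) - pairing M P (H' k) * \<phi> k\<bar> \<le> C * (e + e')" if "k < n" for k
  proof -
    have i: "integrable M (\<lambda>y. P y * H k y)" "integrable M (\<lambda>y. P y * H' k y)"
      using density_pairing_le(1)[OF P H] density_pairing_le(1)[OF P H'] by auto
    have "pairing M P (H k) - pairing M P (H' k) = pairing M P (\<lambda>y. H k y - H' k y)"
      unfolding pairing_def using i by (simp add: right_diff_distrib)
    moreover have "\<bar>pairing M P (\<lambda>y. H k y - H' k y)\<bar> \<le> e"
      by (rule density_pairing_le(2)[OF P]) (use H H' e in auto)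
    ultimately have 1: "\<bar>pairing M P (H k) - pairing M P (H' k)\<bar> \<le> e" by simp
    have 2: "\<bar>pairing M P (H' k)\<bar> \<le> C" by (rule density_pairing_le(2)[OF P H'])
    have "u k * pairing M P (H k) - pairing M P (H' k) * \<phi> k
        = u k * (pairing M P (H k) - pairing M P (H' k)) - pairing M P (H' k) * (\<phi> k - u k)"
      by (simp add: algebra_simps)
    also have "\<bar>\<dots>\<bar> \<le> \<bar>u k\<bar> * \<bar>pairing M P (H k) - pairing M P (H' k)\<bar> + \<bar>pairing M P (H' k)\<bar> * \<bar>\<phi> k - u k\<bar>"
      by (metis abs_mult abs_triangle_ineq4)
    also have "\<dots> \<le> C * e + C * e'"
      using u[OF that] e(2)[OF that] 1 2 C by (intro add_mono mult_mono) auto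
    finally show ?thesis by (simp add: distrib_left)
  qed
  then show ?thesis
    unfolding sum_subtractf[symmetric]
    using abs_sum_le_card_mult[of "{..<n}" "\<lambda>k. u k * pairing M P (H k) - pairing M P (H' k) * \<phi> k" "C * (e + e')"]
    by simp
qed

lemma pigeonhole_measure:
  assumes S: "S \<in> sets M" and fin: "finite I" "I \<noteq> {}" and l: "\<And>x. x \<in> S \<Longrightarrow> l x \<in> I"
    and meas: "\<And>a. {x\<in>S. l x = a} \<in> sets M"
  obtains a where "a \<in> I" "prob {x\<in>S. l x = a} \<ge> prob S / card I"
proof -
  have "S = (\<Union>a\<in>I. {x\<in>S. l x = a})" using l by auto
  then have "prob S \<le> (\<Sum>a\<in>I. prob {x\<in>S. l x = a})"
    using measure_UNION_le[of I "\<lambda>a. {x\<in>S. l x = a}" M] fin meas by simp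
  moreover have "\<not> (\<forall>a\<in>I. prob {x\<in>S. l x = a} < prob S / card I)"
  proof
    assume "\<forall>a\<in>I. prob {x\<in>S. l x = a} < prob S / card I"
    then have "(\<Sum>a\<in>I. prob {x\<in>S. l x = a}) < (\<Sum>a\<in>I. prob S / card I)"
      using fin by (intro sum_strict_mono) auto
    then show False using \<open>prob S \<le> _\<close> fin by simp
  qed
  ultimately show thesis using that by (meson not_le)
qed

end

text \<open>
  The sum has mean L and is at most A^2 L, so it cannot be below 3/4 L on too large a set.
\<close>

lemma (in bounded_biorthonormal) diagonal_large:
  "prob {x\<in>space M. (\<Sum>k<L. f (N + k) x * g (N + k) x) \<ge> 3 / 4 * real L} \<ge> 1 / (4 * A\<^sup>2)" if "L > 0"
proof -
  let ?s = "\<lambda>x. \<Sum>k<L. f (N + k) x * g (N + k) x"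
  let ?Z = "{x\<in>space M. ?s x \<ge> 3 / 4 * real L}"
  have fgA: "\<bar>f i x * g i x\<bar> \<le> A\<^sup>2" if "x \<in> space M" for i x
    using mult_mono[OF f_le[OF that, of i] g_le[OF that, of i]] A_ge_1 by (auto simp: abs_mult power2_eq_square)
  have int: "integrable M (\<lambda>x. f i x * g i x)" for i
    by (rule integrable_bounded[of _ "A\<^sup>2"]) (use fgA in auto)
  have iZ: "integrable M (\<lambda>x. indicator ?Z x :: real)"
    by (rule integrable_bounded[of _ 1]) (auto simp: indicator_def)
  have "real L = expectation ?s" by (simp add: int biorth)
  also have "\<dots> \<le> expectation (\<lambda>x. L * A\<^sup>2 * indicator ?Z x + 3 / 4 * real L)"
  proof (rule integral_mono)
    fix x assume x: "x \<in> space M"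
    have "\<bar>?s x\<bar> \<le> L * A\<^sup>2" using abs_sum_le_card_mult[of "{..<L}" "\<lambda>k. f (N + k) x * g (N + k) x"] fgA[OF x] by simp
    then show "?s x \<le> L * A\<^sup>2 * indicator ?Z x + 3 / 4 * real L"
      using x by (auto simp: indicator_def)
  qed (use int iZ in auto)
  also have "\<dots> = L * A\<^sup>2 * prob ?Z + 3 / 4 * real L"
    using iZ by (simp add: prob_space Int_def conj_commute)
  finally have "real L * (1 / 4) \<le> real L * (A\<^sup>2 * prob ?Z)" by (simp add: algebra_simps)
  then have "1 / 4 \<le> A\<^sup>2 * prob ?Z" by (rule mult_left_le_imp_le) (use that in simp)
  then show ?thesis using A_ge_1 by (simp add: field_simps)
qed

section \<open>Densities with large partial sums\<close>

text \<open>
  This is the iteration described at the beginning. The invariant of a density P is that its pairings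
  with the rounded weak limits are those of the constant density 1. The coefficients of the windows
  that have already been treated are computed with the rounded functions gt k and ft k: these are
  constant on the cells, so that the later tilts preserve the coefficients exactly and no error
  accumulates over the number of steps.
\<close>

lemma (in bounded_biorthonormal) large_maximal_function:
  shows "\<exists>P n0. simple_function M P \<and> (\<forall>y. 0 \<le> P y) \<and> expectation P = 1 \<and>
    (prob {x\<in>space M. \<exists>n\<le>n0. R \<le> \<bar>partial_sum M f g P n x\<bar>} \<ge> 1 / (16 * A\<^sup>2) \<or>
     prob {x\<in>space M. \<exists>n\<le>n0. R \<le> \<bar>partial_sum M g f P n x\<bar>} \<ge> 1 / (16 * A\<^sup>2))"
proof -
  \<comment> \<open>A tilt halves the L1 norm B of a kernel, and a window sum is a difference of two partial sums, which halves it again;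
    the rest of B absorbs the rounding errors.\<close>
  define B where "B = 4 * \<bar>R\<bar> + 20"
  define T where "T = 2 * \<bar>R\<bar> + 1"
  have B: "B > 0" by (simp add: B_def add_nonneg_pos)
  define \<delta> where "\<delta> = 1 / (4 * A\<^sup>2)"
  have \<delta>: "\<delta> > 0" using A_ge_1 by (simp add: \<delta>_def)
  define J where "J = max 3 (nat \<lceil>768 * (A + 1) ^ 4 * B\<^sup>2\<rceil> + 1)"
  have J: "J \<ge> 3" "real J > 768 * (A + 1) ^ 4 * B\<^sup>2"
    unfolding J_def by (simp, linarith)
  define L :: nat where "L = 2 ^ J"
  have L8: "L \<ge> 8"
    using power_increasing[OF J(1), of "2::nat"] by (simp add: L_def)
  define e where "e = 1 / (real L * (A + 1))"
  have e: "e > 0" "e \<le> 1" "real L * ((A + 1) * e) = 1"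
    using L8 A_ge_1 by (auto simp: e_def divide_le_eq_1 intro: order.trans[OF _ mult_mono[of 1 "real L" 1 "A + 1"]])
  have eN: "real n * ((A + 1) * e) \<le> 1" if "n \<le> L" for n
    using e(3) mult_right_mono[of "real n" "real L" "(A + 1) * e"] that e(1) A_ge_1 by simp
  \<comment> \<open>The values of the system at x over the window N, ..., N + L - 1, as integer multiples of e.
    Integers make the alphabet countable, as the compactness lemma demands.\<close>
  define letter :: "(nat \<Rightarrow> 'a \<Rightarrow> real) \<Rightarrow> nat \<Rightarrow> 'a \<Rightarrow> int list"
    where "letter = (\<lambda>H N x. map (\<lambda>k. \<lfloor>H (N + k) x / e\<rfloor>) [0..<L])"
  define m where "m = \<lceil>(A + 1) / e\<rceil>"
  define \<A> where "\<A> = {us. set us \<subseteq> {-m..m} \<and> length us = L}"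
  have fin\<A>: "finite \<A>" unfolding \<A>_def by (rule finite_lists_length_eq) simp
  have \<A>0: "\<A> \<noteq> {}"
  proof -
    have "0 \<le> (A + 1) / e" using A_ge_1 e(1) by simp
    then have "0 \<le> m" unfolding m_def by linarith
    then have "replicate L 0 \<in> \<A>" by (auto simp: \<A>_def)
    then show ?thesis by blast
  qed
  have letter\<A>: "letter H N x \<in> \<A>" if H: "\<And>k. \<bar>H k x\<bar> \<le> A" for H N x
  proof -
    have "\<lfloor>H k x / e\<rfloor> \<in> {-m..m}" for k
    proof -
      have "-(A + 1) \<le> H k x" "H k x \<le> A + 1" using H[of k] by linarith+
      then have "-(A + 1) / e \<le> H k x / e" "H k x / e \<le> (A + 1) / e"
        using e(1) by (intro divide_right_mono; simp)+
      then have "-((A + 1) / e) \<le> H k x / e" "H k x / e \<le> (A + 1) / e" by (simp_all only: minus_divide_left)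
      then show ?thesis unfolding m_def atLeastAtMost_iff by linarith
    qed
    then show ?thesis by (auto simp: \<A>_def letter_def)
  qed
  have letter_simple: "simple_function M (letter H N)"
    if "\<And>k. H k \<in> borel_measurable M" "\<And>k x. x \<in> space M \<Longrightarrow> \<bar>H k x\<bar> \<le> A" for H N
  proof -
    have "simple_function M (\<lambda>x. map (\<lambda>k. \<lfloor>H (N + k) x / e\<rfloor>) [0..<L])"
      by (rule simple_function_map) (rule simple_function_grid_index[OF that(1) that(2) e(1)])
    then show ?thesis by (simp add: letter_def)
  qed

  \<comment> \<open>The kernels belonging to a letter us and an initial part of length n of a window; b selects one of the two systems.\<close>
  define h :: "int list \<times> nat \<times> bool \<Rightarrow> nat \<Rightarrow> 'a \<Rightarrow> real"
    where "h = (\<lambda>(us, n, b) N y. \<bar>\<Sum>k<n. e * of_int (us ! k) * (if b then g else f) (N + k) y\<bar>)"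
  define K :: "int list \<times> nat \<times> bool \<Rightarrow> real"
    where "K = (\<lambda>(us, n, b). \<Sum>k<n. \<bar>e * of_int (us ! k)\<bar> * A)"
  have h_meas[measurable]: "h i N \<in> borel_measurable M" for i N
    by (cases i) (simp add: h_def)
  have h0: "0 \<le> h i N y" for i N y by (cases i) (simp add: h_def)
  have hK: "h i N y \<le> K i" if "y \<in> space M" for i N y
  proof -
    obtain us n b where i: "i = (us, n, b)" by (cases i) auto
    show ?thesis unfolding i h_def K_def prod.case
      by (rule order.trans[OF sum_abs sum_mono]) (use f_le[OF that] g_le[OF that] in \<open>auto simp: abs_mult intro!: mult_left_mono\<close>)
  qed
  have K0: "0 \<le> K i" for i
    using A_ge_1 by (cases i) (auto simp: K_def intro!: sum_nonneg)
  obtain G where G: "countable G" "Int_stable G" "G \<subseteq> sets M"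
    "\<And>D. D \<in> sets M \<Longrightarrow> \<exists>D'\<in>sigma_sets (space M) G. AE x in M. x \<in> D \<longleftrightarrow> x \<in> D'"
    using generated unfolding countably_generated_mod_null_def by blast
  obtain r where r: "strict_mono r" and "\<forall>i. \<exists>\<Lambda>\<in>borel_measurable M. (\<forall>x. 0 \<le> \<Lambda> x \<and> \<Lambda> x \<le> K i) \<and>
    (\<forall>D\<in>sets M. (\<lambda>N. LINT x|M. indicator D x * h i (r N) x) \<longlonglongrightarrow> (LINT x|M. indicator D x * \<Lambda> x))"
  proof -
    have "\<exists>r. strict_mono r \<and> (\<forall>i. \<exists>\<Lambda>\<in>borel_measurable M. (\<forall>x. 0 \<le> \<Lambda> x \<and> \<Lambda> x \<le> K i) \<and>
      (\<forall>D\<in>sets M. (\<lambda>N. LINT x|M. indicator D x * h i (r N) x) \<longlonglongrightarrow> (LINT x|M. indicator D x * \<Lambda> x)))"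
      by (intro weakly_convergent_subsequence[where G=G and h=h and K=K] G h_meas h0 hK K0)
    then show ?thesis using that by blast
  qed
  then obtain \<Lambda> where \<Lambda>[measurable]: "\<And>i. \<Lambda> i \<in> borel_measurable M"
    and \<Lambda>0: "\<And>i x. 0 \<le> \<Lambda> i x" and \<Lambda>K: "\<And>i x. \<Lambda> i x \<le> K i"
    and \<Lambda>lim: "\<And>i D. D \<in> sets M \<Longrightarrow> (\<lambda>N. LINT x|M. indicator D x * h i (r N) x) \<longlonglongrightarrow> (LINT x|M. indicator D x * \<Lambda> i x)"
    by metis
  define I where "I = \<A> \<times> {..L} \<times> (UNIV :: bool set)"
  have finI: "finite I" using fin\<A> by (simp add: I_def)
  obtain il where il: "set il = I" using finite_list[OF finI] by blast
  define \<Lambda>t where "\<Lambda>t = (\<lambda>i y. grid_round 1 (\<Lambda> i y))"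
  define gt where "gt = (\<lambda>k y. grid_round e (g k y))"
  define ft where "ft = (\<lambda>k y. grid_round e (f k y))"
  have simple: "simple_function M (\<Lambda>t i)" "simple_function M (gt k)" "simple_function M (ft k)" for i k
    unfolding \<Lambda>t_def gt_def ft_def
    using simple_function_grid_round[OF \<Lambda>[of i], of "K i" 1] \<Lambda>0[of i] \<Lambda>K[of i]
      simple_function_grid_round[OF g g_le e(1)] simple_function_grid_round[OF f f_le e(1)]
    by (simp_all add: abs_of_nonneg)
  have int\<Lambda>: "integrable M (\<Lambda> i)" for i
    by (rule integrable_bounded[of _ "K i"]) (use \<Lambda>0 \<Lambda>K in auto)
  have inth: "integrable M (h i N)" for i N
    by (rule integrable_bounded[of _ "K i"]) (use h0 hK in auto)
  have simple_int: "integrable M p" if p: "simple_function M p" for p :: "'a \<Rightarrow> real"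
    using integral_over_cells(1)[OF p, of "\<lambda>_. 1" "\<lambda>v. v"] by simp

  define good where "good = (\<lambda>P Nm x. \<exists>N n. N + n \<le> Nm \<and> n \<le> L \<and>
     (T \<le> \<bar>\<Sum>k<n. pairing M P (gt (N + k)) * f (N + k) x\<bar> \<or>
      T \<le> \<bar>\<Sum>k<n. pairing M P (ft (N + k)) * g (N + k) x\<bar>))"
  define inv where "inv = (\<lambda>P. simple_function M P \<and> (\<forall>y. 0 \<le> P y) \<and> expectation P = 1 \<and>
     (\<forall>i\<in>I. expectation (\<lambda>y. P y * \<Lambda>t i y) = expectation (\<Lambda>t i)))"
  have fold_t: "(\<lambda>y. grid_round e (g k y)) = gt k" "(\<lambda>y. grid_round e (f k y)) = ft k" for k
    by (simp_all add: gt_def ft_def)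
  define \<kappa> where "\<kappa> = \<delta> / 2 / card (\<A> \<times> \<A>)"
  have \<kappa>: "\<kappa> > 0" using \<delta> fin\<A> \<A>0 by (simp add: \<kappa>_def card_gt_0_iff)

  have step: "\<exists>P' Nm' Y. inv P' \<and> Y \<in> sets M \<and> Y \<inter> X = {} \<and> prob Y \<ge> \<kappa> \<and> (\<forall>x\<in>Y. good P' Nm' x) \<and> Nm \<le> Nm' \<and>
      (\<forall>k<Nm. pairing M P' (gt k) = pairing M P (gt k) \<and> pairing M P' (ft k) = pairing M P (ft k))"
    if invP: "inv P" and X[measurable]: "X \<in> sets M" and X2: "prob X < \<delta> / 2" for P X Nm
  proof -
    have P: "simple_function M P" "\<And>y. 0 \<le> P y" "expectation P = 1"
      and P\<Lambda>: "\<And>i. i \<in> I \<Longrightarrow> expectation (\<lambda>y. P y * \<Lambda>t i y) = expectation (\<Lambda>t i)"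
      using invP by (auto simp: inv_def)
    have intP: "integrable M P" by (rule simple_int[OF P(1)])
    \<comment> \<open>Everything that the tilt has to preserve is a function of c.\<close>
    define c where "c = (\<lambda>y. (P y, map (\<lambda>k. gt k y) [0..<Nm], map (\<lambda>k. ft k y) [0..<Nm], map (\<lambda>i. \<Lambda>t i y) il))"
    have c: "simple_function M c"
      unfolding c_def by (intro simple_function_Pair P(1) simple_function_map simple)
    define w :: "real \<times> real list \<times> real list \<times> real list \<Rightarrow> real" where "w = (\<lambda>j. max 0 (fst j))"
    have w0: "0 \<le> w j" for j by (simp add: w_def)
    have wc: "w (c y) = P y" for y using P(2)[of y] by (simp add: w_def c_def)
    have finc: "finite (c ` space M)" using simple_functionD(1)[OF c] .
    have cell[measurable]: "c -` {j} \<inter> space M \<in> sets M" for j using simple_functionD(2)[OF c] .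
    let ?E = "\<lambda>j H. expectation (\<lambda>y. indicator (c -` {j} \<inter> space M) y * H y)"
    define W where "W = (\<Sum>j\<in>c ` space M. w j)"
    have W0: "W \<ge> 0" unfolding W_def by (rule sum_nonneg) (rule w0)
    define \<eta> where "\<eta> = 1 / ((W + 1) * (real L * (A + 1)))"
    have \<eta>: "\<eta> > 0" "W * (real L * ((A + 1) * \<eta>)) \<le> 1"
    proof -
      have q: "real L * (A + 1) > 0" using L8 A_ge_1 by simp
      then show "\<eta> > 0" using W0 by (simp only: \<eta>_def zero_less_divide_iff mult_pos_pos zero_less_one add_nonneg_pos simp_thms)
      have "real L * ((A + 1) * \<eta>) = (real L * (A + 1)) * \<eta>" by (simp only: mult.assoc)
      also have "\<dots> = 1 / (W + 1)"
      proof -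
        have "c * (1 / ((W + 1) * c)) = 1 / (W + 1)" if "c > 0" for c :: real using that by simp
        from this[OF q] show ?thesis unfolding \<eta>_def .
      qed
      finally show "W * (real L * ((A + 1) * \<eta>)) \<le> 1" using W0 by (simp add: divide_le_eq_1)
    qed

    have tends: "(\<lambda>q. expectation (\<lambda>y. P y * h i (r q) y)) \<longlonglongrightarrow> expectation (\<lambda>y. P y * \<Lambda> i y)" for i
    proof -
      have eq: "expectation (\<lambda>y. P y * H y) = (\<Sum>j\<in>c ` space M. w j * ?E j H)" if "integrable M H" for H
        using integral_over_cells(2)[OF c that, of w] by (simp only: wc)
      show ?thesis
        unfolding eq[OF inth] eq[OF int\<Lambda>] by (intro tendsto_sum tendsto_mult_left \<Lambda>lim cell)
    qed
    have tends1: "(\<lambda>q. expectation (h i (r q))) \<longlonglongrightarrow> expectation (\<Lambda> i)" for i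
    proof -
      have "expectation (\<lambda>y. indicator (space M) y * H y) = expectation H" for H :: "'a \<Rightarrow> real"
        by (rule Bochner_Integration.integral_cong) auto
      then show ?thesis using \<Lambda>lim[OF sets.top, of i] by simp
    qed
    have shift: "filterlim (\<lambda>q. r q + k) at_top sequentially" for k
      using filterlim_subseq[OF r] by (rule filterlim_at_top_mono) auto
    have ev: "\<forall>\<^sub>F q in sequentially. r q \<ge> Nm \<and>
        (\<forall>j\<in>c ` space M. \<forall>k\<in>{..<L}. \<bar>?E j (g (r q + k))\<bar> < \<eta> \<and> \<bar>?E j (f (r q + k))\<bar> < \<eta>) \<and>
        (\<forall>i\<in>I. \<bar>expectation (\<lambda>y. P y * h i (r q) y) - expectation (\<lambda>y. P y * \<Lambda> i y)\<bar> < 1 \<and>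
               \<bar>expectation (h i (r q)) - expectation (\<Lambda> i)\<bar> < 1)"
    proof (intro eventually_conj eventually_ball_finite ballI finc finI finite_lessThan)
      show "\<forall>\<^sub>F q in sequentially. Nm \<le> r q"
        using shift[of 0] by (simp add: filterlim_at_top)
      show "\<forall>\<^sub>F q in sequentially. \<bar>?E j (g (r q + k))\<bar> < \<eta>" for j k
        using tendstoD[OF filterlim_compose[OF g_null[OF cell] shift] \<eta>(1)] by (simp add: dist_real_def)
      show "\<forall>\<^sub>F q in sequentially. \<bar>?E j (f (r q + k))\<bar> < \<eta>" for j k
        using tendstoD[OF filterlim_compose[OF f_null[OF cell] shift] \<eta>(1)] by (simp add: dist_real_def)
      show "\<forall>\<^sub>F q in sequentially. \<bar>expectation (\<lambda>y. P y * h i (r q) y) - expectation (\<lambda>y. P y * \<Lambda> i y)\<bar> < 1" for i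
        using tendstoD[OF tends zero_less_one] by (simp add: dist_real_def)
      show "\<forall>\<^sub>F q in sequentially. \<bar>expectation (h i (r q)) - expectation (\<Lambda> i)\<bar> < 1" for i
        using tendstoD[OF tends1 zero_less_one] by (simp add: dist_real_def)
    qed
    obtain q where q: "r q \<ge> Nm"
        "\<And>j k. j \<in> c ` space M \<Longrightarrow> k < L \<Longrightarrow> \<bar>?E j (g (r q + k))\<bar> < \<eta> \<and> \<bar>?E j (f (r q + k))\<bar> < \<eta>"
        "\<And>i. i \<in> I \<Longrightarrow> \<bar>expectation (\<lambda>y. P y * h i (r q) y) - expectation (\<lambda>y. P y * \<Lambda> i y)\<bar> < 1 \<and>
               \<bar>expectation (h i (r q)) - expectation (\<Lambda> i)\<bar> < 1"
      using eventually_happens'[OF sequentially_bot ev] by blast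
    define N where "N = r q"
    have hP: "expectation (\<lambda>y. P y * h i N y) \<ge> expectation (h i N) - 3" if i: "i \<in> I" for i
    proof -
      have "expectation (\<lambda>y. P y * \<Lambda>t i y) \<le> expectation (\<lambda>y. P y * \<Lambda> i y)"
      proof (rule integral_mono)
        show "integrable M (\<lambda>y. P y * \<Lambda>t i y)" 
          using integral_over_cells(1)[OF c simple_int[OF simple(1)], of w] by (simp add: wc)
        show "integrable M (\<lambda>y. P y * \<Lambda> i y)" 
          using integral_over_cells(1)[OF c int\<Lambda>, of w] by (simp add: wc)
        show "P y * \<Lambda>t i y \<le> P y * \<Lambda> i y" for y
          unfolding \<Lambda>t_def by (intro mult_left_mono grid_round_bounds P(2)) simp
      qed
      moreover have "expectation (\<Lambda> i) \<le> expectation (\<lambda>y. \<Lambda>t i y + 1)"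
        by (rule integral_mono) (use int\<Lambda> simple_int[OF simple(1)] grid_round_bounds(2)[of 1] in \<open>auto simp: \<Lambda>t_def\<close>)
      moreover have "expectation (\<lambda>y. \<Lambda>t i y + 1) = expectation (\<Lambda>t i) + 1"
        using simple_int[OF simple(1)] by (simp add: prob_space)
      ultimately show ?thesis using q(3)[OF i] P\<Lambda>[OF i] unfolding N_def by linarith
    qed

    define Z where "Z = {x\<in>space M. (\<Sum>k<L. f (N + k) x * g (N + k) x) \<ge> 3 / 4 * real L} - X"
    have Z[measurable]: "Z \<in> sets M" unfolding Z_def by measurable
    have ZX: "prob Z \<ge> \<delta> / 2"
    proof -
      have "\<delta> \<le> prob {x\<in>space M. (\<Sum>k<L. f (N + k) x * g (N + k) x) \<ge> 3 / 4 * real L}"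
        unfolding \<delta>_def by (rule diagonal_large) (use L8 in simp)
      also have "\<dots> \<le> prob (Z \<union> X)" unfolding Z_def by (rule finite_measure_mono) auto
      also have "\<dots> \<le> prob Z + prob X" by (rule measure_Un_le) auto
      finally show ?thesis using X2 by linarith
    qed
    define l where "l = (\<lambda>x. (letter f N x, letter g N x))"
    have l: "simple_function M l"
      unfolding l_def by (intro simple_function_Pair letter_simple f g f_le g_le)
    obtain a where a: "a \<in> \<A> \<times> \<A>" "prob {x\<in>Z. l x = a} \<ge> prob Z / card (\<A> \<times> \<A>)"
    proof (rule pigeonhole_measure[OF Z, of "\<A> \<times> \<A>" l])
      show "finite (\<A> \<times> \<A>)" "\<A> \<times> \<A> \<noteq> {}" using fin\<A> \<A>0 by auto
      show "l x \<in> \<A> \<times> \<A>" if "x \<in> Z" for x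
        using that f_le g_le by (auto simp: l_def Z_def intro!: letter\<A>)
      show "{x\<in>Z. l x = b} \<in> sets M" for b
      proof -
        have "{x\<in>Z. l x = b} = Z \<inter> (l -` {b} \<inter> space M)" using sets.sets_into_space[OF Z] by auto
        then show ?thesis using simple_functionD(2)[OF l] by simp
      qed
    qed
    obtain us vs where usvs: "a = (us, vs)" "us \<in> \<A>" "vs \<in> \<A>" using a(1) by auto
    define Y where "Y = {x\<in>Z. l x = a}"
    have Y: "Y \<in> sets M"
    proof -
      have "Y = Z \<inter> (l -` {a} \<inter> space M)" using sets.sets_into_space[OF Z] by (auto simp: Y_def)
      then show ?thesis using simple_functionD(2)[OF l] by simp
    qed
    have Y\<kappa>: "prob Y \<ge> \<kappa>"
    proof -
      have "\<kappa> \<le> prob Z / card (\<A> \<times> \<A>)" unfolding \<kappa>_def using ZX by (intro divide_right_mono) auto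
      then show ?thesis using a(2) by (simp add: Y_def)
    qed
    have Yspace: "x \<in> space M" if "x \<in> Y" for x using that sets.sets_into_space[OF Y] by auto
    define u where "u = (\<lambda>k. if k < L then e * of_int (us ! k) else 0)"
    define v where "v = (\<lambda>k. if k < L then e * of_int (vs ! k) else 0)"
    have uY: "u k = grid_round e (f (N + k) x)" "v k = grid_round e (g (N + k) x)" if "x \<in> Y" "k < L" for x k
    proof -
      have "letter f N x = us" "letter g N x = vs" using that by (auto simp: Y_def l_def usvs)
      then show "u k = grid_round e (f (N + k) x)" "v k = grid_round e (g (N + k) x)"
        using that(2) by (auto simp: u_def v_def grid_round_def letter_def)
    qed
    have uYe: "\<bar>f (N + k) x - u k\<bar> \<le> e" "\<bar>g (N + k) x - v k\<bar> \<le> e" if "x \<in> Y" "k < L" for x k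
      using grid_round_close[OF e(1)] uY[OF that] by auto
    \<comment> \<open>One point of Y suffices to see that its letter satisfies the hypotheses of the growth estimate.\<close>
    obtain x0 where x0: "x0 \<in> Y"
      using Y\<kappa> \<kappa> by (metis all_not_in_conv measure_empty not_less)
    have uA: "\<bar>u k\<bar> \<le> A + 1" "\<bar>v k\<bar> \<le> A + 1" for k
    proof -
      have "\<bar>u k\<bar> \<le> A + 1 \<and> \<bar>v k\<bar> \<le> A + 1"
      proof (cases "k < L")
        case True
        then show ?thesis
          using uYe[OF x0 True] f_le[OF Yspace[OF x0], of "N + k"] g_le[OF Yspace[OF x0], of "N + k"] e(2) by linarith
      next
        case False
        then show ?thesis using A_ge_1 by (simp add: u_def v_def)
      qed
      then show "\<bar>u k\<bar> \<le> A + 1" "\<bar>v k\<bar> \<le> A + 1" by auto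
    qed
    have diag: "(\<Sum>k<L. u k * v k) \<ge> real L / 2"
    proof -
      have "\<bar>f (N + k) x0 * g (N + k) x0 - u k * v k\<bar> \<le> 2 * ((A + 1) * e)" if "k < L" for k
      proof -
        have "f (N + k) x0 * g (N + k) x0 - u k * v k
            = (f (N + k) x0 - u k) * g (N + k) x0 + u k * (g (N + k) x0 - v k)"
          by (simp add: algebra_simps)
        also have "\<bar>\<dots>\<bar> \<le> \<bar>f (N + k) x0 - u k\<bar> * \<bar>g (N + k) x0\<bar> + \<bar>u k\<bar> * \<bar>g (N + k) x0 - v k\<bar>"
          by (metis abs_mult abs_triangle_ineq)
        also have "\<dots> \<le> e * (A + 1) + (A + 1) * e"
          using uYe[OF x0 that] uA[of k] g_le[OF Yspace[OF x0], of "N + k"] A_ge_1 e(1)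
          by (intro add_mono mult_mono) auto
        finally show ?thesis by (simp add: mult.commute)
      qed
      then have "\<bar>\<Sum>k<L. f (N + k) x0 * g (N + k) x0 - u k * v k\<bar> \<le> L * (2 * ((A + 1) * e))"
        using abs_sum_le_card_mult[of "{..<L}" "\<lambda>k. f (N + k) x0 * g (N + k) x0 - u k * v k" "2 * ((A + 1) * e)"] by simp
      also have "\<dots> = 2" using e(3) by simp
      finally have "\<bar>(\<Sum>k<L. f (N + k) x0 * g (N + k) x0) - (\<Sum>k<L. u k * v k)\<bar> \<le> 2"
        by (simp add: sum_subtractf)
      moreover have "(\<Sum>k<L. f (N + k) x0 * g (N + k) x0) \<ge> 3 / 4 * real L" using x0 by (simp add: Y_def Z_def)
      moreover have "real L \<ge> 8" using L8 by simp
      ultimately show ?thesis by linarith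
    qed

    have tilt: "\<exists>P'. inv P' \<and>
        (\<forall>k<Nm. pairing M P' (gt k) = pairing M P (gt k) \<and> pairing M P' (ft k) = pairing M P (ft k)) \<and>
        (\<forall>x\<in>Y. T \<le> \<bar>\<Sum>k<n. pairing M P' (\<lambda>y. grid_round e (H (N + k) y)) * \<phi> k x\<bar>)"
      if H[measurable]: "\<And>k. H k \<in> borel_measurable M" and HA: "\<And>k y. y \<in> space M \<Longrightarrow> \<bar>H k y\<bar> \<le> A"
        and Hs: "\<And>j k. j \<in> c ` space M \<Longrightarrow> k < L \<Longrightarrow> \<bar>?E j (H (N + k))\<bar> < \<eta>"
        and n: "n \<le> L" and ws: "\<And>k. k < L \<Longrightarrow> ws k = e * of_int (us' ! k)" "\<And>k. \<bar>ws k\<bar> \<le> A + 1"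
        and \<phi>: "\<And>x k. x \<in> Y \<Longrightarrow> k < L \<Longrightarrow> \<bar>\<phi> k x - ws k\<bar> \<le> e"
        and us': "us' \<in> \<A>" and b: "H = (if b then g else f)"
        and big: "expectation (\<lambda>y. \<bar>\<Sum>k<n. ws k * H (N + k) y\<bar>) > B"
      for H ws us' b n and \<phi> :: "nat \<Rightarrow> 'a \<Rightarrow> real"
    proof -
      define D where "D = (\<lambda>y. \<Sum>k<n. ws k * H (N + k) y)"
      have D[measurable]: "D \<in> borel_measurable M" unfolding D_def by measurable
      have DC: "\<bar>D y\<bar> \<le> real n * ((A + 1) * A)" if "y \<in> space M" for y
        using abs_sum_le_card_mult[of "{..<n}" "\<lambda>k. ws k * H (N + k) y" "(A + 1) * A"]
          mult_mono[OF ws(2) HA[OF that]] A_ge_1 by (simp add: D_def abs_mult)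
      have intH: "integrable M (H k)" for k by (rule integrable_bounded[OF H HA])
      have hD: "h (us', n, b) N y = \<bar>D y\<bar>" for y
      proof -
        have "(\<Sum>k<n. e * of_int (us' ! k) * H (N + k) y) = (\<Sum>k<n. ws k * H (N + k) y)"
          by (rule sum.cong) (use ws(1) n in auto)
        then show ?thesis unfolding h_def prod.case D_def b by simp
      qed
      have iI: "(us', n, b) \<in> I" using us' n by (simp add: I_def)
      have small: "\<bar>expectation (\<lambda>y. z (c y) * D y)\<bar> \<le> 1" if z: "\<And>j. 0 \<le> z j \<and> z j \<le> w j" for z
      proof -
        have ED: "\<bar>?E j D\<bar> \<le> real L * ((A + 1) * \<eta>)" if j: "j \<in> c ` space M" for j
        proof -
          have i: "integrable M (\<lambda>y. indicator (c -` {j} \<inter> space M) y * H (N + k) y)" for k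
          proof (rule integrable_bounded[of _ A])
            show "(\<lambda>y. indicator (c -` {j} \<inter> space M) y * H (N + k) y) \<in> borel_measurable M"
              by (intro borel_measurable_times borel_measurable_indicator cell H)
            show "\<bar>indicator (c -` {j} \<inter> space M) y * H (N + k) y\<bar> \<le> A" if "y \<in> space M" for y
              using HA[OF that, of "N + k"] A_ge_1 by (simp add: indicator_def)
          qed
          have "?E j D = expectation (\<lambda>y. \<Sum>k<n. ws k * (indicator (c -` {j} \<inter> space M) y * H (N + k) y))"
            by (intro Bochner_Integration.integral_cong) (auto simp: D_def sum_distrib_left mult_ac)
          also have "\<dots> = (\<Sum>k<n. ws k * ?E j (H (N + k)))"
            by (simp only: Bochner_Integration.integral_sum[OF integrable_mult_right[OF i]] integral_mult_right_zero)
          also have "\<bar>\<dots>\<bar> \<le> real (card {..<n}) * ((A + 1) * \<eta>)"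
          proof (rule abs_sum_le_card_mult)
            fix k assume "k \<in> {..<n}"
            then show "\<bar>ws k * ?E j (H (N + k))\<bar> \<le> (A + 1) * \<eta>"
              unfolding abs_mult using ws(2)[of k] Hs[OF j, of k] n A_ge_1 by (intro mult_mono) auto
          qed
          also have "\<dots> \<le> real L * ((A + 1) * \<eta>)" using n A_ge_1 \<eta>(1) by (intro mult_right_mono) auto
          finally show ?thesis .
        qed
        have iD: "integrable M D" by (rule integrable_bounded[OF D DC])
        have "\<bar>expectation (\<lambda>y. z (c y) * D y)\<bar> \<le> (\<Sum>j\<in>c ` space M. \<bar>z j * ?E j D\<bar>)"
          unfolding integral_over_cells(2)[OF c iD] by (rule sum_abs)
        also have "\<dots> \<le> (\<Sum>j\<in>c ` space M. w j * (real L * ((A + 1) * \<eta>)))"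
          unfolding abs_mult using z ED w0 by (intro sum_mono mult_mono) (auto simp: abs_of_nonneg)
        also have "\<dots> = W * (real L * ((A + 1) * \<eta>))" by (simp add: W_def sum_distrib_right)
        finally show ?thesis using \<eta>(2) by linarith
      qed
      obtain P' where P': "simple_function M P'" "\<And>y. 0 \<le> P' y"
          "\<And>z :: _ \<Rightarrow> real. expectation (\<lambda>y. P' y * z (c y)) = expectation (\<lambda>y. w (c y) * z (c y))"
          "expectation (\<lambda>y. P' y * D y) \<ge> expectation (\<lambda>y. w (c y) * \<bar>D y\<bar>) / 2 - 2"
        proof (rule tilt_density[where c=c and w=w and D=D])
        show "\<bar>expectation (\<lambda>y. z (c y) * D y)\<bar> \<le> 1" if "\<And>j. 0 \<le> z j \<and> z j \<le> w j" for z
          by (rule small) (rule that)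
      qed (rule c w0 D DC that; assumption)+
      have intP': "integrable M P'" by (rule simple_int[OF P'(1)])
      have EP': "expectation P' = 1" using P'(3)[of "\<lambda>_. 1"] P(3) by (simp add: wc)
      show ?thesis
      proof (intro exI[of _ P'] conjI allI impI ballI)
        show "inv P'"
          unfolding inv_def
        proof (intro conjI allI ballI P'(1,2) EP')
          fix i assume i: "i \<in> I"
          then obtain s where s: "s < length il" "il ! s = i" using il by (metis in_set_conv_nth)
          have "\<Lambda>t i y = snd (snd (snd (c y))) ! s" for y using s by (simp add: c_def)
          then show "expectation (\<lambda>y. P' y * \<Lambda>t i y) = expectation (\<Lambda>t i)"
            using P'(3)[of "\<lambda>j. snd (snd (snd j)) ! s"] P\<Lambda>[OF i] by (simp add: wc)
        qed
      next
        fix k assume k: "k < Nm"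
        have "gt k y = fst (snd (c y)) ! k" "ft k y = fst (snd (snd (c y))) ! k" for y using k by (simp_all add: c_def)
        then show "pairing M P' (gt k) = pairing M P (gt k)" "pairing M P' (ft k) = pairing M P (ft k)"
          using P'(3)[of "\<lambda>j. fst (snd j) ! k"] P'(3)[of "\<lambda>j. fst (snd (snd j)) ! k"]
          by (simp_all add: wc pairing_def)
      next
        fix x assume x: "x \<in> Y"
        have "expectation (\<lambda>y. \<bar>D y\<bar>) > B" using big by (simp only: D_def)
        moreover have "expectation (\<lambda>y. w (c y) * \<bar>D y\<bar>) \<ge> expectation (\<lambda>y. \<bar>D y\<bar>) - 3"
          using hP[OF iI] unfolding hD wc .
        moreover have "t \<ge> B - 3" if "s > B" "t \<ge> s - 3" for s t :: real using that by argo
        ultimately have "expectation (\<lambda>y. w (c y) * \<bar>D y\<bar>) \<ge> B - 3" by blast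
        then have "expectation (\<lambda>y. P' y * D y) \<ge> (B - 3) / 2 - 2" using P'(4) by argo
        moreover have "expectation (\<lambda>y. P' y * D y) = (\<Sum>k<n. ws k * pairing M P' (H (N + k)))"
        proof -
          have i: "integrable M (\<lambda>y. P' y * H (N + k) y)" for k
            by (rule density_pairing_le(1)[OF intP' P'(2) EP' H HA])
          have "expectation (\<lambda>y. P' y * D y) = expectation (\<lambda>y. \<Sum>k<n. ws k * (P' y * H (N + k) y))"
            by (intro Bochner_Integration.integral_cong) (auto simp: D_def sum_distrib_left mult_ac)
          also have "\<dots> = (\<Sum>k<n. ws k * pairing M P' (H (N + k)))"
            unfolding pairing_def
            by (simp only: Bochner_Integration.integral_sum[OF integrable_mult_right[OF i]] integral_mult_right_zero)
          finally show ?thesis .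
        qed
        moreover have "\<bar>(\<Sum>k<n. ws k * pairing M P' (H (N + k)))
            - (\<Sum>k<n. pairing M P' (\<lambda>y. grid_round e (H (N + k) y)) * \<phi> k x)\<bar> \<le> real n * ((A + 1) * (e + e))"
        proof (rule rounded_window_sum[OF intP' P'(2) EP', where H="\<lambda>k. H (N + k)"])
          show "(\<lambda>y. grid_round e (H (N + k) y)) \<in> borel_measurable M" for k
            unfolding grid_round_def by measurable
          show "\<bar>H (N + k) y - grid_round e (H (N + k) y)\<bar> \<le> e" for k y by (rule grid_round_close[OF e(1)])
          show "\<bar>grid_round e (H (N + k) y)\<bar> \<le> A + 1" "\<bar>H (N + k) y\<bar> \<le> A + 1" if "y \<in> space M" for k y
            using grid_round_close[OF e(1), of "H (N + k) y"] HA[OF that, of "N + k"] e(2) by linarith+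
        qed (use \<phi>[OF x] ws(2) n A_ge_1 in auto)
        moreover have "real n * ((A + 1) * (e + e)) \<le> 2" using eN[OF n] by (simp add: algebra_simps)
        moreover have "(B - 3) / 2 - 2 = 2 * \<bar>R\<bar> + 13 / 2" by (simp add: B_def field_simps)
        ultimately show "T \<le> \<bar>\<Sum>k<n. pairing M P' (\<lambda>y. grid_round e (H (N + k) y)) * \<phi> k x\<bar>"
          unfolding T_def by linarith
      qed
    qed

    have "\<exists>n\<le>L. expectation (\<lambda>y. \<bar>\<Sum>k<n. u k * g (N + k) y\<bar>) > B \<or> expectation (\<lambda>y. \<bar>\<Sum>k<n. v k * f (N + k) y\<bar>) > B"
    proof (rule ccontr)
      assume neg: "\<not> ?thesis"
      have "real J \<le> 768 * (A + 1) ^ 4 * B\<^sup>2"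
      proof (rule kernel_L1_growth[where f="\<lambda>k. f (N + k)" and g="\<lambda>k. g (N + k)" and u=u and v=v])
        show "\<bar>f (N + k) y\<bar> \<le> A + 1" "\<bar>g (N + k) y\<bar> \<le> A + 1" if "y \<in> space M" for k y
          using f_le[OF that, of "N + k"] g_le[OF that, of "N + k"] by linarith+
        show "expectation (\<lambda>y. f (N + i) y * g (N + j) y) = (if i = j then 1 else 0)" for i j
          using biorth[of "N + i" "N + j"] by simp
      qed (use uA A_ge_1 diag B neg in \<open>auto simp: L_def not_less\<close>)
      then show False using J(2) by linarith
    qed
    then obtain n where n: "n \<le> L" and
      nbig: "expectation (\<lambda>y. \<bar>\<Sum>k<n. u k * g (N + k) y\<bar>) > B \<or> expectation (\<lambda>y. \<bar>\<Sum>k<n. v k * f (N + k) y\<bar>) > B"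
      by blast
    from nbig have "\<exists>P'. inv P' \<and>
        (\<forall>k<Nm. pairing M P' (gt k) = pairing M P (gt k) \<and> pairing M P' (ft k) = pairing M P (ft k)) \<and>
        (\<forall>x\<in>Y. good P' (N + n) x)"
    proof
      assume big: "expectation (\<lambda>y. \<bar>\<Sum>k<n. u k * g (N + k) y\<bar>) > B"
      have "\<exists>P'. inv P' \<and>
        (\<forall>k<Nm. pairing M P' (gt k) = pairing M P (gt k) \<and> pairing M P' (ft k) = pairing M P (ft k)) \<and>
        (\<forall>x\<in>Y. T \<le> \<bar>\<Sum>k<n. pairing M P' (\<lambda>y. grid_round e (g (N + k) y)) * f (N + k) x\<bar>)"
      proof (rule tilt[of g n u us "\<lambda>k. f (N + k)" True])
        show "u k = e * of_int (us ! k)" if "k < L" for k using that by (simp add: u_def)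
        show "g = (if True then g else f)" by simp
        show "\<bar>?E j (g (N + k))\<bar> < \<eta>" if "j \<in> c ` space M" "k < L" for j k
          using q(2)[OF that] by (simp add: N_def)
        show "\<bar>f (N + k) x - u k\<bar> \<le> e" if "x \<in> Y" "k < L" for x k by (rule uYe(1)[OF that])
      qed (fact g g_le n uA(1) usvs big)+
      then obtain P' where P': "inv P'"
        "\<forall>k<Nm. pairing M P' (gt k) = pairing M P (gt k) \<and> pairing M P' (ft k) = pairing M P (ft k)"
        "\<forall>x\<in>Y. T \<le> \<bar>\<Sum>k<n. pairing M P' (gt (N + k)) * f (N + k) x\<bar>"
        unfolding fold_t by (elim exE conjE)
      have "good P' (N + n) x" if xY: "x \<in> Y" for x
        unfolding good_def using bspec[OF P'(3) xY] n by (intro exI[of _ N] exI[of _ n] conjI disjI1) simp_all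
      then show ?thesis using P'(1,2) by (intro exI[of _ P'] conjI ballI)
    next
      assume big: "expectation (\<lambda>y. \<bar>\<Sum>k<n. v k * f (N + k) y\<bar>) > B"
      have "\<exists>P'. inv P' \<and>
        (\<forall>k<Nm. pairing M P' (gt k) = pairing M P (gt k) \<and> pairing M P' (ft k) = pairing M P (ft k)) \<and>
        (\<forall>x\<in>Y. T \<le> \<bar>\<Sum>k<n. pairing M P' (\<lambda>y. grid_round e (f (N + k) y)) * g (N + k) x\<bar>)"
      proof (rule tilt[of f n v vs "\<lambda>k. g (N + k)" False])
        show "v k = e * of_int (vs ! k)" if "k < L" for k using that by (simp add: v_def)
        show "f = (if False then g else f)" by simp
        show "\<bar>?E j (f (N + k))\<bar> < \<eta>" if "j \<in> c ` space M" "k < L" for j k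
          using q(2)[OF that] by (simp add: N_def)
        show "\<bar>g (N + k) x - v k\<bar> \<le> e" if "x \<in> Y" "k < L" for x k by (rule uYe(2)[OF that])
      qed (fact f f_le n uA(2) usvs big)+
      then obtain P' where P': "inv P'"
        "\<forall>k<Nm. pairing M P' (gt k) = pairing M P (gt k) \<and> pairing M P' (ft k) = pairing M P (ft k)"
        "\<forall>x\<in>Y. T \<le> \<bar>\<Sum>k<n. pairing M P' (ft (N + k)) * g (N + k) x\<bar>"
        unfolding fold_t by (elim exE conjE)
      have "good P' (N + n) x" if xY: "x \<in> Y" for x
        unfolding good_def using bspec[OF P'(3) xY] n by (intro exI[of _ N] exI[of _ n] conjI disjI2) simp_all
      then show ?thesis using P'(1,2) by (intro exI[of _ P'] conjI ballI)
    qed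
    then obtain P' where "inv P'"
      "\<forall>k<Nm. pairing M P' (gt k) = pairing M P (gt k) \<and> pairing M P' (ft k) = pairing M P (ft k)"
      "\<forall>x\<in>Y. good P' (N + n) x" by (elim exE conjE)
    moreover have "Y \<inter> X = {}" by (auto simp: Y_def Z_def)
    moreover have "Nm \<le> N + n" using q(1) by (simp add: N_def)
    ultimately show ?thesis using Y Y\<kappa> by (intro exI[of _ P'] exI[of _ "N + n"] exI[of _ Y] conjI)
  qed

  have iterate: "\<exists>P Nm X. inv P \<and> X \<in> sets M \<and> prob X \<ge> min (real s * \<kappa>) (\<delta> / 2) \<and> (\<forall>x\<in>X. good P Nm x)" for s
  proof (induction s)
    case 0
    have "inv (\<lambda>_. 1)" by (simp add: inv_def prob_space)
    moreover have "min (real 0 * \<kappa>) (\<delta> / 2) \<le> prob {}" by simp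
    ultimately show ?case
      by (intro exI[of _ "\<lambda>_. 1"] exI[of _ 0] exI[of _ "{}"] conjI) simp_all
  next
    case (Suc s)
    then obtain P Nm X where P: "inv P" "X \<in> sets M" "prob X \<ge> min (real s * \<kappa>) (\<delta> / 2)" "\<forall>x\<in>X. good P Nm x"
      by (elim exE conjE)
    show ?case
    proof (cases "prob X < \<delta> / 2")
      case False
      then have "min (real (Suc s) * \<kappa>) (\<delta> / 2) \<le> prob X" by linarith
      then show ?thesis using P by (intro exI[of _ P] exI[of _ Nm] exI[of _ X] conjI)
    next
      case True
      from step[OF P(1,2) True, of Nm] obtain P' Nm' Y where Y: "inv P'" "Y \<in> sets M" "Y \<inter> X = {}" "prob Y \<ge> \<kappa>"
        "\<forall>x\<in>Y. good P' Nm' x" "Nm \<le> Nm'"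
        "\<forall>k<Nm. pairing M P' (gt k) = pairing M P (gt k) \<and> pairing M P' (ft k) = pairing M P (ft k)"
        by (elim exE conjE)
      have "good P' Nm' x" if xX: "x \<in> X" for x
      proof -
        obtain N n where Nn: "N + n \<le> Nm" "n \<le> L"
          "T \<le> \<bar>\<Sum>k<n. pairing M P (gt (N + k)) * f (N + k) x\<bar> \<or> T \<le> \<bar>\<Sum>k<n. pairing M P (ft (N + k)) * g (N + k) x\<bar>"
          using bspec[OF P(4) xX] unfolding good_def by (elim exE conjE)
        have "(\<Sum>k<n. pairing M P' (gt (N + k)) * f (N + k) x) = (\<Sum>k<n. pairing M P (gt (N + k)) * f (N + k) x)"
          "(\<Sum>k<n. pairing M P' (ft (N + k)) * g (N + k) x) = (\<Sum>k<n. pairing M P (ft (N + k)) * g (N + k) x)"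
          using Nn(1) Y(7) by (auto intro!: sum.cong)
        then show ?thesis
          unfolding good_def using Nn Y(6) by (intro exI[of _ N] exI[of _ n] conjI) simp_all
      qed
      moreover have "prob (X \<union> Y) = prob X + prob Y"
        using P(2) Y by (intro finite_measure_Union) auto
      moreover have "min (real (Suc s) * \<kappa>) (\<delta> / 2) \<le> prob X + prob Y"
        using P(3) Y(4) True by (simp add: distrib_right min_def split: if_splits)
      ultimately show ?thesis
        using P(2) Y(1,2,5) by (intro exI[of _ P'] exI[of _ Nm'] exI[of _ "X \<union> Y"] conjI) auto
    qed
  qed
  obtain s :: nat where s: "\<delta> / 2 \<le> real s * \<kappa>"
    using reals_Archimedean3[OF \<kappa>] by (meson less_imp_le)
  obtain P Nm X where invP: "inv P" and X1: "X \<in> sets M" "prob X \<ge> min (real s * \<kappa>) (\<delta> / 2)"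
    and goodX: "\<forall>x\<in>X. good P Nm x"
    using iterate[of s] by (elim exE conjE)
  have X: "X \<in> sets M" "prob X \<ge> \<delta> / 2" using X1 s by (simp_all add: min_absorb2)
  have P: "simple_function M P" "\<And>y. 0 \<le> P y" "expectation P = 1" using invP by (auto simp: inv_def)
  have intP: "integrable M P" by (rule simple_int[OF P(1)])
  have window: "\<exists>n\<le>Nm. R \<le> \<bar>partial_sum M \<phi> H P n x\<bar>"
    if H: "\<And>k. H k \<in> borel_measurable M" "\<And>k y. y \<in> space M \<Longrightarrow> \<bar>H k y\<bar> \<le> A"
      and \<phi>: "\<And>k. \<bar>\<phi> k x\<bar> \<le> A" and n: "N + n \<le> Nm" "n \<le> L"
      and T: "T \<le> \<bar>\<Sum>k<n. pairing M P (\<lambda>y. grid_round e (H (N + k) y)) * \<phi> (N + k) x\<bar>"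
    for H \<phi> :: "nat \<Rightarrow> 'a \<Rightarrow> real" and N n x
  proof -
    have "\<bar>(\<Sum>k<n. \<phi> (N + k) x * pairing M P (H (N + k)))
        - (\<Sum>k<n. pairing M P (\<lambda>y. grid_round e (H (N + k) y)) * \<phi> (N + k) x)\<bar> \<le> real n * ((A + 1) * (e + 0))"
    proof (rule rounded_window_sum[OF intP P(2) P(3), where H="\<lambda>k. H (N + k)"])
      show "(\<lambda>y. grid_round e (H (N + k) y)) \<in> borel_measurable M" for k
        using H(1)[of "N + k", measurable] unfolding grid_round_def by measurable
      show "\<bar>H (N + k) y - grid_round e (H (N + k) y)\<bar> \<le> e" for k y by (rule grid_round_close[OF e(1)])
      show "\<bar>grid_round e (H (N + k) y)\<bar> \<le> A + 1" "\<bar>H (N + k) y\<bar> \<le> A + 1" if "y \<in> space M" for k y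
        using grid_round_close[OF e(1), of "H (N + k) y"] H(2)[OF that, of "N + k"] e(2) by linarith+
      show "\<bar>\<phi> (N + k) x\<bar> \<le> A + 1" for k using \<phi>[of "N + k"] by simp
    qed (use H(1) A_ge_1 in auto)
    also have "\<dots> \<le> 1" using eN[OF n(2)] by simp
    finally have "\<bar>\<Sum>k<n. \<phi> (N + k) x * pairing M P (H (N + k))\<bar> \<ge> 2 * \<bar>R\<bar>" using T unfolding T_def by linarith
    moreover have "(\<Sum>k<n. \<phi> (N + k) x * pairing M P (H (N + k))) = partial_sum M \<phi> H P (N + n) x - partial_sum M \<phi> H P N x"
      unfolding partial_sum_def by (induction n) (auto simp: algebra_simps)
    ultimately have "R \<le> \<bar>partial_sum M \<phi> H P (N + n) x\<bar> \<or> R \<le> \<bar>partial_sum M \<phi> H P N x\<bar>" by linarith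
    then show ?thesis using n(1) by (auto intro: exI[of _ "N + n"] exI[of _ N])
  qed
  let ?S1 = "{x\<in>space M. \<exists>n\<le>Nm. R \<le> \<bar>partial_sum M f g P n x\<bar>}"
  let ?S2 = "{x\<in>space M. \<exists>n\<le>Nm. R \<le> \<bar>partial_sum M g f P n x\<bar>}"
  have [measurable]: "partial_sum M f g P n \<in> borel_measurable M" "partial_sum M g f P n \<in> borel_measurable M" for n
    unfolding partial_sum_def by measurable
  have [measurable]: "?S1 \<in> sets M" "?S2 \<in> sets M" by measurable
  have "X \<subseteq> ?S1 \<union> ?S2"
  proof
    fix x assume x: "x \<in> X"
    then have xM: "x \<in> space M" using sets.sets_into_space[OF X(1)] by auto
    obtain N n where Nn: "N + n \<le> Nm" "n \<le> L"
      "T \<le> \<bar>\<Sum>k<n. pairing M P (gt (N + k)) * f (N + k) x\<bar> \<or> T \<le> \<bar>\<Sum>k<n. pairing M P (ft (N + k)) * g (N + k) x\<bar>"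
      using bspec[OF goodX x] unfolding good_def by (elim exE conjE)
    from Nn(3) show "x \<in> ?S1 \<union> ?S2"
    proof
      assume "T \<le> \<bar>\<Sum>k<n. pairing M P (gt (N + k)) * f (N + k) x\<bar>"
      then have "T \<le> \<bar>\<Sum>k<n. pairing M P (\<lambda>y. grid_round e (g (N + k) y)) * f (N + k) x\<bar>"
        by (simp only: fold_t)
      then have "\<exists>n\<le>Nm. R \<le> \<bar>partial_sum M f g P n x\<bar>"
        by (intro window[of g f x N n] Nn(1,2) g g_le f_le[OF xM] g_le[OF xM])
      then show ?thesis using xM by simp
    next
      assume "T \<le> \<bar>\<Sum>k<n. pairing M P (ft (N + k)) * g (N + k) x\<bar>"
      then have "T \<le> \<bar>\<Sum>k<n. pairing M P (\<lambda>y. grid_round e (f (N + k) y)) * g (N + k) x\<bar>"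
        by (simp only: fold_t)
      then have "\<exists>n\<le>Nm. R \<le> \<bar>partial_sum M g f P n x\<bar>"
        by (intro window[of f g x N n] Nn(1,2) f f_le f_le[OF xM] g_le[OF xM])
      then show ?thesis using xM by simp
    qed
  qed
  then have "\<delta> / 2 \<le> prob (?S1 \<union> ?S2)"
    using X(2) finite_measure_mono[of X "?S1 \<union> ?S2"] by auto
  also have "\<dots> \<le> prob ?S1 + prob ?S2" by (rule measure_Un_le) auto
  finally have "\<delta> / 4 \<le> prob ?S1 \<or> \<delta> / 4 \<le> prob ?S2" by linarith
  moreover have "\<delta> / 4 = 1 / (16 * A\<^sup>2)" by (simp add: \<delta>_def)
  ultimately have "1 / (16 * A\<^sup>2) \<le> prob ?S1 \<or> 1 / (16 * A\<^sup>2) \<le> prob ?S2" by simp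
  with P show ?thesis by (intro exI[of _ P] exI[of _ Nm] conjI allI)
qed

section \<open>Coding the cube by real numbers\<close>

text \<open>
  Only the ternary digits 0 and 1 occur, so the tail of the expansion never causes a carry and the
  digits can be read off by rounding down.
\<close>

definition ternary_code :: "(nat \<Rightarrow> bool) \<Rightarrow> real" where
  "ternary_code b = (\<Sum>k. of_bool (b k) / 3 ^ Suc k)"

lemma ternary_code_bounds: "0 \<le> ternary_code b" "ternary_code b \<le> 1 / 2"
  and summable_ternary: "summable (\<lambda>k. of_bool (b k) / 3 ^ Suc k :: real)"
proof -
  have g: "(\<lambda>k. (1 / 3 :: real) ^ k * (1 / 3)) sums (1 / (1 - 1 / 3) * (1 / 3))"
    by (intro sums_mult2 geometric_sums) simp
  have le: "norm (of_bool (b k) / 3 ^ Suc k :: real) \<le> (1 / 3) ^ k * (1 / 3)" for k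
    by (auto simp: power_divide)
  show s: "summable (\<lambda>k. of_bool (b k) / 3 ^ Suc k :: real)"
    by (rule summable_comparison_test'[OF sums_summable[OF g]]) (rule le)
  show "0 \<le> ternary_code b" unfolding ternary_code_def by (rule suminf_nonneg[OF s]) simp
  have "ternary_code b \<le> (\<Sum>k. (1 / 3) ^ k * (1 / 3))"
    unfolding ternary_code_def using le s sums_summable[OF g] by (intro suminf_le) (auto simp: power_divide)
  then show "ternary_code b \<le> 1 / 2" using sums_unique[OF g] by simp
qed

lemma ternary_code_shift: "3 * ternary_code b = of_bool (b 0) + ternary_code (\<lambda>k. b (Suc k))"
proof -
  have "ternary_code b = (\<Sum>k. of_bool (b (Suc k)) / 3 ^ Suc (Suc k)) + of_bool (b 0) / 3"
    unfolding ternary_code_def using suminf_split_head[OF summable_ternary[of b]] by simp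
  also have "(\<Sum>k. of_bool (b (Suc k)) / 3 ^ Suc (Suc k)) = (\<Sum>k. (of_bool (b (Suc k)) / 3 ^ Suc k) / (3::real))"
    by (intro suminf_cong) simp
  also have "\<dots> = ternary_code (\<lambda>k. b (Suc k)) / 3"
    unfolding ternary_code_def by (rule suminf_divide[OF summable_ternary])
  finally show ?thesis by simp
qed

lemma ternary_digit: "\<lfloor>3 ^ Suc k * ternary_code b\<rfloor> mod 3 = of_bool (b k)"
proof (induction k arbitrary: b)
  case 0
  have "\<lfloor>3 * ternary_code b\<rfloor> = of_bool (b 0)"
    using ternary_code_bounds[of "\<lambda>k. b (Suc k)"] by (simp add: ternary_code_shift floor_eq_iff)
  then show ?case by simp
next
  case (Suc k)
  have "3 ^ Suc (Suc k) * ternary_code b = 3 ^ Suc k * (3 * ternary_code b)" by simp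
  also have "\<dots> = of_int (3 ^ Suc k * of_bool (b 0)) + 3 ^ Suc k * ternary_code (\<lambda>k. b (Suc k))"
    unfolding ternary_code_shift[of b] by (simp add: distrib_left)
  finally have "\<lfloor>3 ^ Suc (Suc k) * ternary_code b\<rfloor> = 3 ^ Suc k * of_bool (b 0) + \<lfloor>3 ^ Suc k * ternary_code (\<lambda>k. b (Suc k))\<rfloor>"
    by (simp only: int_add_floor)
  then show ?case using Suc[of "\<lambda>k. b (Suc k)"] by (simp add: mod_add_eq[symmetric])
qed

text \<open>
  A point is determined by the truth values of the inequalities q < x_i for rational q; these are
  written as a digit sequence.
\<close>

definition cube_encode :: "real ^ 'n::finite \<Rightarrow> real" where
  "cube_encode x = ternary_code (\<lambda>k. case from_nat k of (i :: 'n, q :: rat) \<Rightarrow> of_rat q < x $ i)"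

text \<open>
  Values are clipped to [0, 1], so that decoding an arbitrary real number ends in the cube.
\<close>

definition decode_term :: "'n::finite \<Rightarrow> real \<Rightarrow> nat \<Rightarrow> real" where
  "decode_term i r k = (case from_nat k of (j :: 'n, q :: rat) \<Rightarrow>
     if j = i \<and> \<lfloor>3 ^ Suc k * r\<rfloor> mod 3 = 1 then min 1 (max 0 (of_rat q)) else 0)"

definition cube_decode :: "real \<Rightarrow> real ^ 'n::finite" where
  "cube_decode r = (\<chi> i. SUP k. decode_term i r k)"

lemma cube_encode_measurable[measurable]: "(cube_encode :: real ^ 'n::finite \<Rightarrow> real) \<in> borel_measurable borel"
  unfolding cube_encode_def ternary_code_def
proof (rule borel_measurable_suminf)
  fix k
  obtain i :: 'n and q :: rat where k: "(from_nat k :: 'n \<times> rat) = (i, q)" by (cases "from_nat k :: 'n \<times> rat") auto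
  show "(\<lambda>x::real^'n. of_bool (case from_nat k of (i :: 'n, q :: rat) \<Rightarrow> of_rat q < x $ i) / 3 ^ Suc k :: real) \<in> borel_measurable borel"
    unfolding k prod.case by measurable
qed

lemma decode_term: "0 \<le> decode_term i r k" "decode_term i r k \<le> 1" "(\<lambda>r. decode_term i r k) \<in> borel_measurable borel"
  for i :: "'n::finite"
proof -
  obtain j :: 'n and q :: rat where k: "(from_nat k :: 'n \<times> rat) = (j, q)" by (cases "from_nat k :: 'n \<times> rat") auto
  show "0 \<le> decode_term i r k" "decode_term i r k \<le> 1" by (auto simp: decode_term_def k)
  show "(\<lambda>r. decode_term i r k) \<in> borel_measurable borel" unfolding decode_term_def k prod.case by measurable
qed

lemma bdd_above_decode_term: "bdd_above (range (decode_term i r))"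
  by (rule bdd_aboveI[of _ 1]) (auto intro: decode_term(2))

lemma cube_decode_measurable[measurable]: "(cube_decode :: real \<Rightarrow> real ^ 'n::finite) \<in> borel_measurable borel"
proof (subst borel_measurable_euclidean_space, intro ballI)
  fix b :: "real ^ 'n" assume "b \<in> Basis"
  then obtain i where b: "b = axis i 1" by (auto simp: Basis_vec_def)
  have "(\<lambda>r. (cube_decode r :: real ^ 'n) $ i) \<in> borel_measurable borel"
    unfolding cube_decode_def vec_lambda_beta
    by (rule borel_measurable_cSUP) (auto intro: decode_term(3) bdd_above_decode_term)
  then show "(\<lambda>r. (cube_decode r :: real ^ 'n) \<bullet> b) \<in> borel_measurable borel"
    by (simp add: b inner_axis)
qed

lemma cube_decode_in_cube: "cube_decode r \<in> (unit_cube :: (real ^ 'n::finite) set)"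
proof -
  have "0 \<le> (cube_decode r :: real ^ 'n) $ i" "(cube_decode r :: real ^ 'n) $ i \<le> 1" for i
    unfolding cube_decode_def vec_lambda_beta
    by (rule order.trans[OF decode_term(1) cSUP_upper[OF UNIV_I bdd_above_decode_term]])
      (rule cSUP_least, simp, rule decode_term(2))
  then show ?thesis by (simp add: mem_box_cart)
qed

text \<open>
  Each coordinate is the supremum of the rationals below it.
\<close>

lemma cube_decode_encode:
  fixes x :: "real ^ 'n::finite"
  assumes "x \<in> unit_cube"
  shows "cube_decode (cube_encode x) = x"
proof -
  have x: "0 \<le> x $ i" "x $ i \<le> 1" for i using assms by (auto simp: mem_box_cart)
  have digit: "\<lfloor>3 ^ Suc k * cube_encode x\<rfloor> mod 3 = 1 \<longleftrightarrow> of_rat q < x $ j"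
    if k: "(from_nat k :: 'n \<times> rat) = (j, q)" for k j q
    unfolding cube_encode_def ternary_digit k prod.case by simp
  let ?t = "\<lambda>i. decode_term i (cube_encode x)"
  have "(SUP k. ?t i k) = x $ i" for i
  proof (rule antisym)
    show "(SUP k. ?t i k) \<le> x $ i"
    proof (rule cSUP_least)
      fix k
      obtain j :: 'n and q :: rat where k: "(from_nat k :: 'n \<times> rat) = (j, q)" by (cases "from_nat k :: 'n \<times> rat") auto
      have "min 1 (max 0 s) \<le> x $ i" if "s < x $ i" for s using that x[of i] by auto
      then show "?t i k \<le> x $ i" using x[of i] digit[OF k] by (auto simp: decode_term_def k simp del: power_Suc)
    qed simp
    show "x $ i \<le> (SUP k. ?t i k)"
    proof (rule dense_le)
      fix y assume y: "y < x $ i"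
      show "y \<le> (SUP k. ?t i k)"
      proof (cases "y < 0")
        case True
        then show ?thesis
          using order.trans[OF decode_term(1) cSUP_upper[OF UNIV_I bdd_above_decode_term], of i "cube_encode x"] by auto
      next
        case False
        obtain q where q: "q \<in> \<rat>" "y < q" "q < x $ i" using Rats_dense_in_real[OF y] by blast
        obtain q' where q': "q = of_rat q'" using q(1) by (auto elim: Rats_cases)
        define k where "k = to_nat (i, q')"
        have k: "(from_nat k :: 'n \<times> rat) = (i, q')" by (simp add: k_def)
        have "min 1 (max 0 q) = q" using q(2,3) x[of i] False by auto
        then have "?t i k = q" using digit[OF k] q(3) unfolding q' by (simp add: decode_term_def k del: power_Suc)
        then show ?thesis using cSUP_upper[OF _ bdd_above_decode_term, of k i "cube_encode x"] q by auto
      qed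
    qed
  qed
  then show ?thesis by (simp add: cube_decode_def vec_eq_iff)
qed



section \<open>Maps with a prescribed law\<close>

abbreviation uniform01 :: "real measure" where
  "uniform01 \<equiv> distr (restrict_space lborel {0<..<1::real}) borel (\<lambda>x. x)"

lemma prob_space_uniform01: "prob_space (restrict_space lborel {0<..<1::real})"
  by (auto simp add: emeasure_restrict_space space_restrict_space intro!: prob_spaceI)

lemma measurable_ident_uniform01[measurable]: "(\<lambda>x. x) \<in> borel_measurable (restrict_space lborel {0<..<1::real})"
  by (intro measurable_restrict_space1) simp

lemma cdf_uniform01: "cdf uniform01 x = max 0 (min 1 x)"
proof -
  have "cdf uniform01 x = measure lborel ({..x} \<inter> {0<..<1})"
    unfolding cdf_def
    by (subst measure_distr[OF measurable_ident_uniform01]) (auto simp: space_restrict_space measure_restrict_space Int_commute)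
  also have "\<dots> = max 0 (min 1 x)"
  proof (cases "x \<ge> 1")
    case True
    then have "{..x} \<inter> {0<..<1} = {0<..<1::real}" by auto
    then show ?thesis using True by simp
  next
    case False
    then have "{..x} \<inter> {0<..<1} = {0<..x}" by auto
    then show ?thesis using False by (cases "x \<ge> 0") (auto simp: min_def max_def)
  qed
  finally show ?thesis .
qed

lemma real_distribution_uniform01: "real_distribution uniform01"
proof -
  interpret prob_space "restrict_space lborel {0<..<1::real}" by (rule prob_space_uniform01)
  show ?thesis by (rule real_distribution_distr[OF measurable_ident_uniform01])
qed

lemma (in real_distribution) cdf_surj:
  assumes cont: "\<And>c. measure M {c} = 0" and s: "0 < s" "s < 1"
  shows "\<exists>c. cdf M c = s"
proof -
  have icont: "isCont (cdf M) x" for x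
    using cont[of x] isCont_cdf[of x] by simp
  obtain a where a: "cdf M a < s"
    using order_tendstoD(2)[OF cdf_lim_at_bot s(1)] eventually_happens'[OF trivial_limit_at_bot_linorder] by blast
  obtain b where b: "s < cdf M b"
    using order_tendstoD(1)[OF cdf_lim_at_top_prob s(2)] eventually_happens'[OF trivial_limit_at_top_linorder] by blast
  have "a \<le> b" using a b cdf_nondecreasing[of b a] by (meson le_cases less_le_trans not_less)
  then show ?thesis using IVT[of "cdf M" a s b] a b icont by auto
qed

text \<open>
  The probability integral transform. Without atoms the distribution function takes every value
  between 0 and 1, and the law of its composition is determined by squeezing.
\<close>

lemma (in real_distribution) distr_cdf_uniform:
  assumes cont: "\<And>c. measure M {c} = 0"
  shows "distr M borel (cdf M) = uniform01"
proof (rule cdf_unique[OF real_distribution_distr real_distribution_uniform01])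
  have F[measurable]: "cdf M \<in> borel_measurable M"
  proof -
    have "cdf M \<in> borel_measurable borel" by (rule borel_measurable_mono) (auto intro: monoI cdf_nondecreasing)
    then show ?thesis by simp
  qed
  then show "cdf M \<in> borel_measurable M" .
  have ivt: "\<exists>c. cdf M c = s" if "0 < s" "s < 1" for s
    by (rule cdf_surj[OF cont that])
  have le: "prob {x. cdf M x \<le> s} \<le> s" if s: "0 \<le> s" "s < 1" for s
  proof (rule dense_ge)
    fix s' assume "s < s'"
    show "prob {x. cdf M x \<le> s} \<le> s'"
    proof (cases "s' < 1")
      case True
      then obtain c where c: "cdf M c = s'" using ivt[of s'] s \<open>s < s'\<close> by auto
      have "{x. cdf M x \<le> s} \<subseteq> {..c}"
      proof
        fix x assume "x \<in> {x. cdf M x \<le> s}"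
        then show "x \<in> {..c}" using cdf_nondecreasing[of c x] c \<open>s < s'\<close> by (cases "x \<le> c") auto
      qed
      then have "prob {x. cdf M x \<le> s} \<le> prob {..c}" by (intro finite_measure_mono) auto
      then show ?thesis using c by (simp add: cdf_def)
    next
      case False
      then show ?thesis using prob_le_1[of "{x. cdf M x \<le> s}"] by linarith
    qed
  qed
  have ge: "s \<le> prob {x. cdf M x \<le> s}" if s: "0 < s" "s < 1" for s
  proof -
    obtain c where c: "cdf M c = s" using ivt[OF s] by auto
    have [measurable]: "{x. cdf M x \<le> s} \<in> sets M"
      using measurable_sets[OF F, of "{..s}"] by (simp add: vimage_def)
    have "{..c} \<subseteq> {x. cdf M x \<le> s}" using cdf_nondecreasing[of _ c] c by auto
    then have "prob {..c} \<le> prob {x. cdf M x \<le> s}" by (intro finite_measure_mono) auto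
    then show ?thesis using c by (simp add: cdf_def)
  qed
  show "cdf (distr M borel (cdf M)) = cdf uniform01"
  proof
    fix s
    have d: "cdf (distr M borel (cdf M)) s = prob {x. cdf M x \<le> s}"
      unfolding cdf_def[of "distr _ _ _"] by (subst measure_distr) (auto simp: vimage_def)
    consider "s < 0" | "s = 0" | "0 < s" "s < 1" | "s \<ge> 1" by linarith
    then show "cdf (distr M borel (cdf M)) s = cdf uniform01 s"
    proof cases
      case 1
      then have "{x. cdf M x \<le> s} = {}" using cdf_nonneg by (auto simp: not_le intro: less_le_trans)
      then show ?thesis unfolding d cdf_uniform01 using 1 by simp
    next
      case 2
      then show ?thesis unfolding d cdf_uniform01 using le[of 0] by (simp add: measure_le_0_iff)
    next
      case 3
      then show ?thesis unfolding d cdf_uniform01 using le[of s] ge[of s] by simp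
    next
      case 4
      then have "{x. cdf M x \<le> s} = UNIV" using cdf_bounded_prob by (auto intro: order.trans)
      then show ?thesis unfolding d cdf_uniform01 using 4 prob_space by simp
    qed
  qed
qed

text \<open>
  The distribution function turns V into a uniform variable, and the quantile function of the coded
  measure turns this into a variable whose decoded value has law \<nu>.
\<close>

lemma (in prob_space) exists_map_with_law:
  fixes V :: "'a \<Rightarrow> real" and \<nu> :: "(real ^ 'n::finite) measure"
  assumes V[measurable]: "V \<in> borel_measurable M" and atomless: "\<And>c. prob {x\<in>space M. V x = c} = 0"
    and \<nu>: "prob_space \<nu>" "sets \<nu> = sets borel" and \<nu>c: "AE x in \<nu>. x \<in> unit_cube"
  obtains \<omega> where "\<omega> \<in> borel_measurable M" "\<And>x. \<omega> x \<in> unit_cube" "distr M borel \<omega> = \<nu>"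
proof -
  interpret \<nu>: prob_space \<nu> by fact
  have [measurable_cong]: "sets \<nu> = sets borel" by fact
  define D where "D = distr M borel V"
  interpret D: real_distribution D unfolding D_def by (rule real_distribution_distr) simp
  have "measure D {c} = 0" for c
    unfolding D_def using atomless[of c] by (subst measure_distr) (auto simp: vimage_def Int_def conj_commute)
  then have DU: "distr D borel (cdf D) = uniform01" by (rule D.distr_cdf_uniform)
  have F[measurable]: "cdf D \<in> borel_measurable borel"
    by (rule borel_measurable_mono) (auto intro: monoI D.cdf_nondecreasing)
  have enc\<nu>[measurable]: "cube_encode \<in> borel_measurable \<nu>" by measurable
  define E where "E = distr \<nu> borel cube_encode"
  interpret E: cdf_distribution E
    unfolding E_def cdf_distribution_def by (rule \<nu>.real_distribution_distr) simp
  define Q where "Q = (\<lambda>u::real. if u \<in> {0<..<1} then Inf {x. u \<le> cdf E x} else 0)"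
  have Q[measurable]: "Q \<in> borel_measurable borel"
  proof -
    have "(\<lambda>u. indicator {0<..<1} u * Inf {x. u \<le> cdf E x}) \<in> borel_measurable borel"
      using E.measurable_CI by (subst (asm) borel_measurable_restrict_space_iff) auto
    also have "(\<lambda>u. indicator {0<..<1} u * Inf {x. u \<le> cdf E x}) = Q"
      by (auto simp: Q_def indicator_def)
    finally show ?thesis .
  qed
  have QE: "distr uniform01 borel Q = E"
  proof -
    have "distr uniform01 borel Q = distr (restrict_space lborel {0<..<1}) borel Q"
      by (subst distr_distr) (auto simp: comp_def)
    also have "\<dots> = distr (restrict_space lborel {0<..<1}) borel (\<lambda>u. Inf {x. u \<le> cdf E x})"
      by (rule distr_cong) (auto simp: Q_def space_restrict_space)
    also have "\<dots> = E" by (rule E.distr_I_eq_M)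
    finally show ?thesis .
  qed
  define \<omega> where "\<omega> = (\<lambda>x. cube_decode (Q (cdf D (V x))) :: real ^ 'n)"
  show thesis
  proof (rule that[of \<omega>])
    show [measurable]: "\<omega> \<in> borel_measurable M" unfolding \<omega>_def by measurable
    show "\<omega> x \<in> unit_cube" for x unfolding \<omega>_def by (rule cube_decode_in_cube)
    have push: "distr (distr N borel G) borel F = distr N borel (\<lambda>x. F (G x))"
      if "F \<in> borel_measurable borel" "G \<in> borel_measurable N"
      for N :: "'c measure" and G :: "'c \<Rightarrow> real" and F :: "real \<Rightarrow> 'd::topological_space"
      using that by (subst distr_distr) (auto simp: comp_def)
    have "distr D borel (cdf D) = distr M borel (\<lambda>x. cdf D (V x))"
      using push[OF F V] by (simp only: D_def)
    then have "distr (distr D borel (cdf D)) borel Q = distr M borel (\<lambda>x. Q (cdf D (V x)))"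
      using push[OF Q, of "\<lambda>x. cdf D (V x)" M] by simp
    then have "distr (distr (distr D borel (cdf D)) borel Q) borel cube_decode = distr M borel \<omega>"
      using push[OF cube_decode_measurable, of "\<lambda>x. Q (cdf D (V x))" M] unfolding \<omega>_def by simp
    then have "distr M borel \<omega> = distr (distr (distr D borel (cdf D)) borel Q) borel cube_decode" ..
    also have "\<dots> = distr E borel cube_decode" unfolding DU QE ..
    also have "\<dots> = distr \<nu> borel (\<lambda>x. cube_decode (cube_encode x))"
      unfolding E_def by (simp add: distr_distr comp_def)
    also have "\<dots> = distr \<nu> borel (\<lambda>x. x)"
      by (rule distr_cong_AE) (use \<nu>c cube_decode_encode in \<open>auto\<close>)
    also have "\<dots> = \<nu>" by (rule distr_id2) (simp add: \<nu>(2))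
    finally show "distr M borel \<omega> = \<nu>" .
  qed
qed

section \<open>Weak approximation by indicator functions\<close>

text \<open>
  A real variable whose law has no atoms makes it possible to cut off parts of prescribed measure.
\<close>

locale atomless_prob_space = prob_space M for M :: "'a measure" +
  fixes V :: "'a \<Rightarrow> real"
  assumes V_measurable[measurable]: "V \<in> borel_measurable M"
    and V_atomless: "\<And>c. prob {x\<in>space M. V x = c} = 0"
begin

lemma measure_uniform_eq:
  assumes "S \<in> sets M" "prob S > 0" "B \<in> sets M"
  shows "measure (uniform_measure M S) B = prob (S \<inter> B) / prob S"
  using assms by (simp add: measure_uniform_measure emeasure_eq_measure)

lemma subset_with_prob:
  assumes S[measurable]: "S \<in> sets M" and t: "0 \<le> t" "t \<le> prob S"
  obtains T where "T \<in> sets M" "T \<subseteq> S" "prob T = t"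
proof -
  consider "t = 0" | "t = prob S" | "0 < t" "t < prob S" using t by linarith
  then show thesis
  proof cases
    case 3
    then have S0: "prob S > 0" by simp
    interpret U: prob_space "uniform_measure M S"
      by (rule prob_space_uniform_measure) (use S0 in \<open>auto simp: emeasure_eq_measure\<close>)
    define D where "D = distr (uniform_measure M S) borel V"
    interpret D: real_distribution D unfolding D_def by (rule U.real_distribution_distr) simp
    have "measure D {c} = 0" for c
    proof -
      have "measure D {c} = measure (uniform_measure M S) {x\<in>space M. V x = c}"
        unfolding D_def by (subst measure_distr) (auto simp: vimage_def Int_def conj_commute)
      also have "\<dots> = prob (S \<inter> {x\<in>space M. V x = c}) / prob S"
        by (rule measure_uniform_eq) (use S0 in auto)
      also have "prob (S \<inter> {x\<in>space M. V x = c}) = 0"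
        using finite_measure_mono[of "S \<inter> {x\<in>space M. V x = c}" "{x\<in>space M. V x = c}"] V_atomless[of c]
        by (simp add: measure_le_0_iff)
      finally show ?thesis by simp
    qed
    from D.cdf_surj[OF this, of "t / prob S"] 3 obtain c where c: "cdf D c = t / prob S" by auto
    have "cdf D c = measure (uniform_measure M S) {x\<in>space M. V x \<le> c}"
      unfolding D_def cdf_def by (subst measure_distr) (auto simp: vimage_def Int_def conj_commute)
    also have "\<dots> = prob (S \<inter> {x\<in>space M. V x \<le> c}) / prob S"
      by (rule measure_uniform_eq) (use S0 in auto)
    finally have "prob (S \<inter> {x\<in>space M. V x \<le> c}) = t" using c S0 by simp
    then show ?thesis by (intro that[of "S \<inter> {x\<in>space M. V x \<le> c}"]) auto
  qed (use that[of "{}"] that[of S] in auto)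
qed

text \<open>
  On each cell on which P and the roundings of the functions h_k are constant, H takes the proportion
  t P of the cell. Then 1_H / t and P have the same integral over every cell.
\<close>

lemma indicator_weak_approximation:
  fixes P :: "'a \<Rightarrow> real" and h :: "nat \<Rightarrow> 'a \<Rightarrow> real"
  assumes P: "simple_function M P" "\<And>y. 0 \<le> P y" "expectation P = 1" and PT: "\<And>y. y \<in> space M \<Longrightarrow> t * P y \<le> 1"
    and t: "t > 0" and h[measurable]: "\<And>k. h k \<in> borel_measurable M"
    and hC: "\<And>k y. y \<in> space M \<Longrightarrow> \<bar>h k y\<bar> \<le> C" and \<eta>: "\<eta> > 0"
  obtains H where "H \<in> sets M" "prob H = t"
    "\<And>k. k < n \<Longrightarrow> \<bar>pairing M (\<lambda>x. indicator H x / t) (h k) - pairing M P (h k)\<bar> \<le> \<eta>"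
proof -
  define hh where "hh = (\<lambda>k y. grid_round (\<eta> / 2) (h k y))"
  have shh: "simple_function M (hh k)" for k
    unfolding hh_def by (rule simple_function_grid_round[OF h hC]) (use \<eta> in auto)
  define c where "c = (\<lambda>y. (P y, map (\<lambda>k. hh k y) [0..<n]))"
  have c: "simple_function M c"
    unfolding c_def by (intro simple_function_Pair P(1) simple_function_map shh)
  let ?c = "\<lambda>j. c -` {j} \<inter> space M"
  have cell[measurable]: "?c j \<in> sets M" for j using simple_functionD(2)[OF c] .
  have finc: "finite (c ` space M)" using simple_functionD(1)[OF c] .
  have ex: "\<exists>T. j \<in> c ` space M \<longrightarrow> T \<in> sets M \<and> T \<subseteq> ?c j \<and> prob T = t * fst j * prob (?c j)" for j
  proof (cases "j \<in> c ` space M")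
    case True
    then obtain y where y: "y \<in> space M" "j = c y" by auto
    have "0 \<le> t * fst j" "t * fst j \<le> 1" using PT[OF y(1)] P(2)[of y] t y(2) by (auto simp: c_def)
    then have b: "0 \<le> t * fst j * prob (?c j)" "t * fst j * prob (?c j) \<le> prob (?c j)"
      by (simp_all only: mult_nonneg_nonneg mult_left_le_one_le measure_nonneg)
    show ?thesis
    proof (rule subset_with_prob[OF cell b])
      fix T assume "T \<in> sets M" "T \<subseteq> ?c j" "prob T = t * fst j * prob (?c j)"
      then show ?thesis by (intro exI[of _ T] impI conjI)
    qed
  qed auto
  from choice[OF allI[OF ex]] obtain Hj where HjA: "\<forall>j. j \<in> c ` space M \<longrightarrow> Hj j \<in> sets M \<and> Hj j \<subseteq> ?c j \<and>
    prob (Hj j) = t * fst j * prob (?c j)" ..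
  have Hj: "Hj j \<in> sets M" "Hj j \<subseteq> ?c j" "prob (Hj j) = t * fst j * prob (?c j)" if "j \<in> c ` space M" for j
    using mp[OF spec[OF HjA] that] by simp_all
  define H where "H = (\<Union>j\<in>c ` space M. Hj j)"
  have H[measurable]: "H \<in> sets M" unfolding H_def by (rule sets.finite_UN[OF finc Hj(1)])
  have Hcell: "H \<inter> ?c j = Hj j" if "j \<in> c ` space M" for j
  proof
    show "Hj j \<subseteq> H \<inter> ?c j" unfolding H_def by (rule Int_greatest[OF _ Hj(2)[OF that]]) (rule UN_upper[OF that])
    show "H \<inter> ?c j \<subseteq> Hj j"
    proof
      fix y assume y: "y \<in> H \<inter> ?c j"
      then obtain i where i: "i \<in> c ` space M" "y \<in> Hj i" unfolding H_def by (elim IntE UN_E)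
      then have "c y = i" using subsetD[OF Hj(2)[OF i(1)] i(2)] by simp
      then show "y \<in> Hj j" using y i(2) by simp
    qed
  qed
  have i1: "integrable M (\<lambda>y. 1 :: real)" by simp
  have iH: "integrable M (\<lambda>y. indicator H y :: real)"
    by (rule integrable_bounded[of _ 1]) (auto simp: indicator_def)
  have key: "expectation (\<lambda>y. z (c y) * indicator H y) = t * expectation (\<lambda>y. P y * z (c y))" for z :: "_ \<Rightarrow> real"
  proof -
    have "expectation (\<lambda>y. z (c y) * indicator H y)
        = (\<Sum>j\<in>c ` space M. z j * expectation (\<lambda>y. indicator (?c j) y * indicator H y))"
      by (rule integral_over_cells(2)[OF c iH])
    also have "\<dots> = (\<Sum>j\<in>c ` space M. t * (fst j * z j * expectation (\<lambda>y. indicator (?c j) y * 1)))"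
    proof (rule sum.cong[OF refl])
      fix j assume j: "j \<in> c ` space M"
      have "expectation (\<lambda>y. indicator (?c j) y * indicator H y :: real) = expectation (indicator (Hj j))"
        unfolding Hcell[OF j, symmetric]
        by (intro Bochner_Integration.integral_cong) (auto simp: indicator_def)
      also have "\<dots> = prob (Hj j)" using sets.sets_into_space[OF Hj(1)[OF j]] by (simp add: Int_absorb2)
      finally show "z j * expectation (\<lambda>y. indicator (?c j) y * indicator H y)
          = t * (fst j * z j * expectation (\<lambda>y. indicator (?c j) y * 1))"
        using Hj(3)[OF j] by simp
    qed
    also have "\<dots> = t * expectation (\<lambda>y. (fst (c y) * z (c y)) * 1)"
      unfolding sum_distrib_left[symmetric]
      by (subst integral_over_cells(2)[OF c i1, of "\<lambda>j. fst j * z j"]) simp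
    finally show ?thesis by (simp add: c_def)
  qed
  have iP: "integrable M P" using integral_over_cells(1)[OF P(1) i1, of "\<lambda>v. v"] by simp
  have pH: "prob H = t"
  proof -
    have "expectation (indicator H :: 'a \<Rightarrow> real) = t" using key[of "\<lambda>_. 1"] P(3) by simp
    then show ?thesis using sets.sets_into_space[OF H] by (simp add: Int_absorb2)
  qed
  let ?Q = "\<lambda>x. indicator H x / t"
  have Q: "integrable M ?Q" "\<And>y. 0 \<le> ?Q y" "expectation ?Q = 1"
    using iH t pH sets.sets_into_space[OF H] by (auto simp: Int_absorb2)
  show thesis
  proof (rule that[OF H pH])
    fix k assume k: "k < n"
    have hhm: "hh k \<in> borel_measurable M" by (rule borel_measurable_simple_function[OF shh])
    have d: "\<bar>h k y - hh k y\<bar> \<le> \<eta> / 2" for y unfolding hh_def by (rule grid_round_close) (use \<eta> in auto)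
    have hhC: "\<bar>hh k y\<bar> \<le> C + \<eta> / 2" if "y \<in> space M" for y using d[of y] hC[OF that, of k] by linarith
    have close: "\<bar>pairing M p (h k) - pairing M p (hh k)\<bar> \<le> \<eta> / 2"
      if p: "integrable M p" "\<And>y. 0 \<le> p y" "expectation p = 1" for p
    proof -
      have i: "integrable M (\<lambda>y. p y * h k y)" "integrable M (\<lambda>y. p y * hh k y)"
        using density_pairing_le(1)[OF p h hC] density_pairing_le(1)[OF p hhm hhC] by auto
      have "pairing M p (h k) - pairing M p (hh k) = pairing M p (\<lambda>y. h k y - hh k y)"
        unfolding pairing_def using i by (simp add: right_diff_distrib)
      moreover have "\<bar>pairing M p (\<lambda>y. h k y - hh k y)\<bar> \<le> \<eta> / 2"
        by (rule density_pairing_le(2)[OF p]) (use hhm d in auto)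
      ultimately show ?thesis by simp
    qed
    have hk: "snd (c y) ! k = hh k y" for y using k by (simp add: c_def)
    have "pairing M ?Q (hh k) = expectation (\<lambda>y. hh k y * indicator H y) / t"
      unfolding pairing_def by (simp add: mult.commute)
    also have "\<dots> = pairing M P (hh k)"
      using key[of "\<lambda>j. snd j ! k"] t by (simp add: hk pairing_def)
    finally show "\<bar>pairing M ?Q (h k) - pairing M P (h k)\<bar> \<le> \<eta>"
      using close[OF Q] close[OF iP P(2,3)] by linarith
  qed
qed

end

context prob_space
begin

text \<open>
  Continuity of the measure along the increasing level sets of the maximal function.
\<close>

lemma AE_bounded_level:
  fixes S :: "nat \<Rightarrow> 'a \<Rightarrow> real"
  assumes S[measurable]: "\<And>n. S n \<in> borel_measurable M" and b: "AE x in M. \<exists>R. \<forall>n. \<bar>S n x\<bar> \<le> R" and \<epsilon>: "\<epsilon> > 0"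
  obtains R :: nat where "prob {x\<in>space M. \<forall>n. \<bar>S n x\<bar> \<le> real R} > 1 - \<epsilon>"
proof -
  define B where "B = (\<lambda>R::nat. {x\<in>space M. \<forall>n. \<bar>S n x\<bar> \<le> real R})"
  have B[measurable]: "B R \<in> sets M" for R unfolding B_def by measurable
  have "incseq B" unfolding incseq_def B_def by (auto intro: order.trans)
  then have "(\<lambda>R. prob (B R)) \<longlonglongrightarrow> prob (\<Union>R. B R)"
    using B by (intro finite_Lim_measure_incseq) auto
  also have "prob (\<Union>R. B R) = 1"
  proof (rule prob_eq_1[THEN iffD2])
    show "AE x in M. x \<in> (\<Union>R. B R)"
      using b
    proof (rule AE_mp, intro AE_I2 impI)
      fix x assume x: "x \<in> space M" and "\<exists>R. \<forall>n. \<bar>S n x\<bar> \<le> R"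
      then obtain R where R: "\<And>n. \<bar>S n x\<bar> \<le> R" by blast
      obtain k :: nat where "R \<le> real k" using real_arch_simple by blast
      then have "x \<in> B k" using x R order.trans unfolding B_def by blast
      then show "x \<in> (\<Union>R. B R)" by blast
    qed
  qed auto
  finally have "\<forall>\<^sub>F R in sequentially. prob (B R) > 1 - \<epsilon>"
    using \<epsilon> by (intro order_tendstoD) auto
  then obtain R where "prob (B R) > 1 - \<epsilon>" using eventually_happens'[OF sequentially_bot] by blast
  then show thesis using that unfolding B_def by blast
qed

lemma prob_inter_ge:
  assumes "A \<in> sets M" "B \<in> sets M"
  shows "prob (A \<inter> B) \<ge> prob A + prob B - 1"
  using measure_Un3[of A M B] assms prob_le_1[of "A \<union> B"] by (simp add: fmeasurable_eq_sets)

text \<open>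
  If some sequence \<phi>_k is unbounded on a set of positive measure, a single term suffices. Otherwise
  every finite combination has a finite maximal function, which a later term with a large index k
  exceeds although its coefficient is small. The coefficient is chosen so small, in terms of the
  range m of the indices n used so far, that all later terms together change the earlier peaks by at
  most 1.
\<close>

lemma gliding_hump:
  fixes \<phi> :: "nat \<Rightarrow> nat \<Rightarrow> 'a \<Rightarrow> real" and N :: "nat \<Rightarrow> nat"
  assumes \<phi>[measurable]: "\<And>k n. \<phi> k n \<in> borel_measurable M"
    and \<phi>C: "\<And>k n x. x \<in> space M \<Longrightarrow> \<bar>\<phi> k n x\<bar> \<le> C * real n" and C: "C \<ge> 0"
    and \<delta>: "\<delta> > 0" and big: "\<And>k. prob {x\<in>space M. \<exists>n\<le>N k. real k \<le> \<bar>\<phi> k n x\<bar>} \<ge> \<delta>"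
  shows "\<exists>\<kappa> \<alpha>. strict_mono \<kappa> \<and> (\<forall>i. 0 \<le> \<alpha> i \<and> \<alpha> i \<le> (1/2) ^ i) \<and>
    \<not> (AE x in M. \<exists>R. \<forall>n. \<bar>\<Sum>i. \<alpha> i * \<phi> (\<kappa> i) n x\<bar> \<le> R)"
proof (cases "\<forall>k. AE x in M. \<exists>R. \<forall>n. \<bar>\<phi> k n x\<bar> \<le> R")
  case False
  then obtain k where k: "\<not> (AE x in M. \<exists>R. \<forall>n. \<bar>\<phi> k n x\<bar> \<le> R)" by blast
  define \<alpha> where "\<alpha> = (\<lambda>i::nat. if i = 0 then 1 else 0 :: real)"
  have "(\<Sum>i. \<alpha> i * \<phi> (k + i) n x) = \<phi> k n x" for n x
    using suminf_finite[of "{0}" "\<lambda>i. \<alpha> i * \<phi> (k + i) n x"] by (simp add: \<alpha>_def)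
  then show ?thesis
    using k by (intro exI[of _ "\<lambda>i. k + i"] exI[of _ \<alpha>]) (auto simp: \<alpha>_def strict_mono_def)
next
  case True
  define bdd where "bdd = (\<lambda>S :: nat \<Rightarrow> 'a \<Rightarrow> real. (\<forall>n. S n \<in> borel_measurable M) \<and> (AE x in M. \<exists>R. \<forall>n. \<bar>S n x\<bar> \<le> R))"
  \<comment> \<open>A state consists of the last index k and coefficient a, the combination S built so far, and a bound m for the indices n at which peaks have been found.\<close>
  define Q where "Q = (\<lambda>(i::nat) (s :: nat \<times> real \<times> (nat \<Rightarrow> 'a \<Rightarrow> real) \<times> nat) (s' :: nat \<times> real \<times> (nat \<Rightarrow> 'a \<Rightarrow> real) \<times> nat).
    case (s, s') of ((k, a, S, m), (k', a', S', m')) \<Rightarrow>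
      k < k' \<and> 0 \<le> a' \<and> a' * (1 + C * m) \<le> (1/2) ^ Suc i \<and> S' = (\<lambda>n x. S n x + a' * \<phi> k' n x) \<and> m \<le> m' \<and>
      prob {x\<in>space M. \<exists>n\<le>m'. real i \<le> \<bar>S' n x\<bar>} \<ge> \<delta> / 2)"
  define P where "P = (\<lambda>(i::nat) (s :: nat \<times> real \<times> (nat \<Rightarrow> 'a \<Rightarrow> real) \<times> nat). case s of (k, a, S, m) \<Rightarrow>
    bdd S \<and> (i = 0 \<longrightarrow> a = 0 \<and> S = (\<lambda>n x. 0)))"
  have "\<exists>s. \<forall>i. P i (s i) \<and> Q i (s i) (s (Suc i))"
  proof (rule dependent_nat_choice)
    show "\<exists>s. P 0 s"
      by (intro exI[of _ "(0, 0, (\<lambda>n x. 0), 0)"]) (auto simp: P_def bdd_def intro: exI[of _ 0])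
  next
    fix s :: "nat \<times> real \<times> (nat \<Rightarrow> 'a \<Rightarrow> real) \<times> nat" and i :: nat
    assume Ps: "P i s"
    obtain k a S m where s: "s = (k, a, S, m)" by (cases s)
    have S: "\<And>n. S n \<in> borel_measurable M" "AE x in M. \<exists>R. \<forall>n. \<bar>S n x\<bar> \<le> R"
      using Ps by (auto simp: P_def s bdd_def)
    note S(1)[measurable]
    obtain R :: nat where R: "prob {x\<in>space M. \<forall>n. \<bar>S n x\<bar> \<le> real R} > 1 - \<delta> / 2"
      using AE_bounded_level[OF S, of "\<delta> / 2"] \<delta> by auto
    define a' where "a' = (1/2) ^ Suc i / (1 + C * m)"
    have Cm: "1 + C * m > 0" using C by (simp add: add_pos_nonneg)
    have a': "a' > 0" "a' * (1 + C * m) = (1/2) ^ Suc i"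
    proof -
      have "(1/2 :: real) ^ Suc i / c > 0 \<and> (1/2) ^ Suc i / c * c = (1/2) ^ Suc i" if "c > 0" for c :: real
        using that by simp
      from this[OF Cm] show "a' > 0" "a' * (1 + C * m) = (1/2) ^ Suc i" unfolding a'_def by blast+
    qed
    obtain q :: nat where q: "(real R + i) / a' < real q" using reals_Archimedean2 by blast
    define k' where "k' = max (Suc k) q"
    have k': "k < k'" "real R + i \<le> a' * k'"
    proof -
      have "(real R + i) / a' \<le> real k'" using q by (simp add: k'_def)
      then show "real R + i \<le> a' * k'" using a'(1) by (simp add: pos_divide_le_eq mult.commute)
    qed (simp add: k'_def)
    define S' where "S' = (\<lambda>n x. S n x + a' * \<phi> k' n x)"
    have [measurable]: "S' n \<in> borel_measurable M" for n unfolding S'_def by measurable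
    define m' where "m' = max m (N k')"
    let ?Y = "{x\<in>space M. \<exists>n\<le>N k'. real k' \<le> \<bar>\<phi> k' n x\<bar>}" and ?B = "{x\<in>space M. \<forall>n. \<bar>S n x\<bar> \<le> real R}"
    have "\<delta> / 2 \<le> prob ?Y + prob ?B - 1" using big[of k'] R by simp
    also have "\<dots> \<le> prob (?Y \<inter> ?B)" by (rule prob_inter_ge) measurable
    also have "\<dots> \<le> prob {x\<in>space M. \<exists>n\<le>m'. real i \<le> \<bar>S' n x\<bar>}"
    proof (rule finite_measure_mono)
      show "?Y \<inter> ?B \<subseteq> {x\<in>space M. \<exists>n\<le>m'. real i \<le> \<bar>S' n x\<bar>}"
      proof
        fix x assume x: "x \<in> ?Y \<inter> ?B"
        then obtain n where n: "n \<le> N k'" "real k' \<le> \<bar>\<phi> k' n x\<bar>" "\<bar>S n x\<bar> \<le> real R" by blast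
        have "a' * k' \<le> \<bar>a' * \<phi> k' n x\<bar>" using n(2) a'(1) by (simp add: abs_mult)
        then have "real i \<le> \<bar>S' n x\<bar>" using k'(2) n(3) unfolding S'_def by linarith
        moreover have "n \<le> m'" using n(1) by (simp add: m'_def)
        ultimately show "x \<in> {x\<in>space M. \<exists>n\<le>m'. real i \<le> \<bar>S' n x\<bar>}" using x by blast
      qed
    qed measurable
    finally have pr: "\<delta> / 2 \<le> prob {x\<in>space M. \<exists>n\<le>m'. real i \<le> \<bar>S' n x\<bar>}" .
    have "AE x in M. \<exists>R. \<forall>n. \<bar>S' n x\<bar> \<le> R"
      using S(2) True[rule_format, of k']
    proof eventually_elim
      case (elim x)
      then obtain R1 R2 where R: "\<And>n. \<bar>S n x\<bar> \<le> R1" "\<And>n. \<bar>\<phi> k' n x\<bar> \<le> R2" by blast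
      have "\<bar>S' n x\<bar> \<le> R1 + a' * R2" for n
      proof -
        have "\<bar>a' * \<phi> k' n x\<bar> \<le> a' * R2" using R(2)[of n] a'(1) by (simp add: abs_mult)
        then show ?thesis using R(1)[of n] unfolding S'_def by linarith
      qed
      then show ?case by blast
    qed
    then have "P (Suc i) (k', a', S', m')" by (simp add: P_def bdd_def)
    moreover have "Q i s (k', a', S', m')"
      using pr k'(1) a' by (simp add: Q_def s S'_def m'_def)
    ultimately show "\<exists>s'. P (Suc i) s' \<and> Q i s s'" by blast
  qed
  then obtain s where s: "\<And>i. P i (s i)" "\<And>i. Q i (s i) (s (Suc i))" by blast
  define \<kappa> where "\<kappa> = (\<lambda>i. fst (s (Suc i)))"
  define \<alpha> where "\<alpha> = (\<lambda>i. fst (snd (s (Suc i))))"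
  define S where "S = (\<lambda>i. fst (snd (snd (s i))))"
  define m where "m = (\<lambda>i. snd (snd (snd (s i))))"
  have Qs: "fst (s i) < \<kappa> i" "0 \<le> \<alpha> i" "\<alpha> i * (1 + C * m i) \<le> (1/2) ^ Suc i"
    "S (Suc i) = (\<lambda>n x. S i n x + \<alpha> i * \<phi> (\<kappa> i) n x)" "m i \<le> m (Suc i)"
    "prob {x\<in>space M. \<exists>n\<le>m (Suc i). real i \<le> \<bar>S (Suc i) n x\<bar>} \<ge> \<delta> / 2" for i
    using s(2)[of i] by (auto simp: Q_def \<kappa>_def \<alpha>_def S_def m_def split: prod.splits)
  have S0: "S 0 = (\<lambda>n x. 0)" using s(1)[of 0] by (auto simp: P_def S_def split: prod.splits)
  have S: "S i n x = (\<Sum>j<i. \<alpha> j * \<phi> (\<kappa> j) n x)" for i n x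
    by (induction i) (simp_all add: S0 Qs(4))
  have \<kappa>: "strict_mono \<kappa>"
    unfolding strict_mono_Suc_iff using Qs(1) by (simp add: \<kappa>_def)
  have m_mono: "m i \<le> m j" if "i \<le> j" for i j
    using lift_Suc_mono_le[of m, OF Qs(5) that] .
  have \<alpha>1: "\<alpha> i \<le> (1/2) ^ Suc i" for i
  proof -
    have "\<alpha> i * 1 \<le> \<alpha> i * (1 + C * m i)" using C Qs(2) by (intro mult_left_mono) auto
    then show ?thesis using Qs(3)[of i] by simp
  qed
  have sm: "summable (\<lambda>i. \<alpha> i * \<phi> (\<kappa> i) n x)" if x: "x \<in> space M" for n x
  proof (rule summable_comparison_test')
    show "summable (\<lambda>i. (1/2 :: real) ^ i * (C * n))" by (intro summable_mult2 summable_geometric) simp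
    fix i
    have "\<alpha> i \<le> (1/2) ^ i" using \<alpha>1[of i] by (simp add: field_simps)
    then show "norm (\<alpha> i * \<phi> (\<kappa> i) n x) \<le> (1/2) ^ i * (C * n)"
      unfolding real_norm_def abs_mult using \<phi>C[OF x, of "\<kappa> i" n] Qs(2)[of i] by (intro mult_mono) auto
  qed
  have "\<not> (AE x in M. \<exists>R. \<forall>n. \<bar>\<Sum>i. \<alpha> i * \<phi> (\<kappa> i) n x\<bar> \<le> R)"
  proof
    assume ae: "AE x in M. \<exists>R. \<forall>n. \<bar>\<Sum>i. \<alpha> i * \<phi> (\<kappa> i) n x\<bar> \<le> R"
    obtain R :: nat where R: "prob {x\<in>space M. \<forall>n. \<bar>\<Sum>i. \<alpha> i * \<phi> (\<kappa> i) n x\<bar> \<le> real R} > 1 - \<delta> / 2"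
      by (rule AE_bounded_level[OF _ ae, of "\<delta> / 2"]) (use \<delta> in auto)
    define i where "i = R + 2"
    let ?Y = "{x\<in>space M. \<exists>n\<le>m (Suc i). real i \<le> \<bar>S (Suc i) n x\<bar>}"
    let ?B = "{x\<in>space M. \<forall>n. \<bar>\<Sum>i. \<alpha> i * \<phi> (\<kappa> i) n x\<bar> \<le> real R}"
    have [measurable]: "S (Suc i) n \<in> borel_measurable M" for n unfolding S by measurable
    have "prob (?Y \<inter> ?B) \<ge> prob ?Y + prob ?B - 1" by (rule prob_inter_ge) measurable
    then have "prob (?Y \<inter> ?B) > 0" using Qs(6)[of i] R by linarith
    then have "?Y \<inter> ?B \<noteq> {}" by (metis measure_empty less_irrefl)
    then obtain x n where x: "x \<in> space M" and n: "n \<le> m (Suc i)" "real i \<le> \<bar>S (Suc i) n x\<bar>"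
      and B: "\<bar>\<Sum>i. \<alpha> i * \<phi> (\<kappa> i) n x\<bar> \<le> real R" by blast
    have tail: "\<bar>\<Sum>j. \<alpha> (j + Suc i) * \<phi> (\<kappa> (j + Suc i)) n x\<bar> \<le> 1"
    proof -
      have le: "norm (\<alpha> (j + Suc i) * \<phi> (\<kappa> (j + Suc i)) n x) \<le> (1/2) ^ Suc j" for j
      proof -
        have "\<bar>\<phi> (\<kappa> (j + Suc i)) n x\<bar> \<le> 1 + C * m (j + Suc i)"
        proof -
          have "C * n \<le> C * m (j + Suc i)" using n(1) m_mono[of "Suc i" "j + Suc i"] C by (intro mult_left_mono) auto
          then show ?thesis using \<phi>C[OF x, of "\<kappa> (j + Suc i)" n] by linarith
        qed
        then have "\<alpha> (j + Suc i) * \<bar>\<phi> (\<kappa> (j + Suc i)) n x\<bar> \<le> \<alpha> (j + Suc i) * (1 + C * m (j + Suc i))"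
          using Qs(2) by (intro mult_left_mono)
        also have "\<dots> \<le> (1/2) ^ Suc (j + Suc i)" by (rule Qs(3))
        also have "\<dots> \<le> (1/2) ^ Suc j" by (rule power_decreasing) auto
        finally show ?thesis using Qs(2)[of "j + Suc i"] by (simp add: abs_mult)
      qed
      have g: "(\<lambda>j. (1/2 :: real) ^ Suc j) sums 1" by (rule power_half_series)
      have sn: "summable (\<lambda>j. norm (\<alpha> (j + Suc i) * \<phi> (\<kappa> (j + Suc i)) n x))"
        by (rule summable_comparison_test'[OF sums_summable[OF g]]) (use le in auto)
      have "norm (\<Sum>j. \<alpha> (j + Suc i) * \<phi> (\<kappa> (j + Suc i)) n x) \<le> (\<Sum>j. norm (\<alpha> (j + Suc i) * \<phi> (\<kappa> (j + Suc i)) n x))"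
        by (rule summable_norm[OF sn])
      also have "\<dots> \<le> (\<Sum>j. (1/2 :: real) ^ Suc j)"
        by (rule suminf_le[OF le sn sums_summable[OF g]])
      also have "\<dots> = 1" using g by (rule sums_unique[symmetric])
      finally show ?thesis by simp
    qed
    have "(\<Sum>i. \<alpha> i * \<phi> (\<kappa> i) n x) = (\<Sum>j. \<alpha> (j + Suc i) * \<phi> (\<kappa> (j + Suc i)) n x) + S (Suc i) n x"
      unfolding S by (rule suminf_split_initial_segment[OF sm[OF x]])
    then show False using tail n(2) B unfolding i_def by simp
  qed
  moreover have "0 \<le> \<alpha> i \<and> \<alpha> i \<le> (1/2) ^ i" for i
    using \<alpha>1[of i] Qs(2)[of i] by simp
  ultimately show ?thesis using \<kappa> by blast
qed

end

section \<open>Measure preserving maps of the cube\<close>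

lemma cube_sets_iff: "B \<in> sets (cube_measure :: (real ^ 'n) measure) \<longleftrightarrow> B \<in> sets lebesgue \<and> B \<subseteq> unit_cube"
  by (subst sets_restrict_space_iff) auto

lemma emeasure_cube: "B \<in> sets (cube_measure :: (real ^ 'n) measure) \<Longrightarrow> emeasure cube_measure B = emeasure lebesgue B"
  by (subst emeasure_restrict_space) (auto simp: cube_sets_iff)

lemma null_sets_cube_iff:
  "N \<in> null_sets (cube_measure :: (real ^ 'n) measure) \<longleftrightarrow> N \<in> null_sets lebesgue \<and> N \<subseteq> unit_cube"
  by (subst null_sets_restrict_space) auto

lemma null_sets_cube_subset:
  assumes "N' \<in> null_sets (lborel :: (real ^ 'n) measure)" "N \<subseteq> N'" "N \<subseteq> unit_cube"
  shows "N \<in> null_sets cube_measure"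
  unfolding null_sets_cube_iff
  by (intro conjI null_sets_completion_subset[OF assms(2)] null_sets_completionI assms)

lemma prob_space_cube: "prob_space (cube_measure :: (real ^ 'n) measure)"
proof
  have "emeasure lborel (unit_cube :: (real ^ 'n) set) = ennreal (\<Prod>b\<in>Basis. (1 - 0) \<bullet> (b :: real ^ 'n))"
    by (rule emeasure_lborel_cbox) (auto simp: Basis_vec_def inner_axis)
  also have "(\<Prod>b\<in>Basis. (1 - 0) \<bullet> (b :: real ^ 'n)) = 1"
    by (rule prod.neutral) (auto simp: Basis_vec_def inner_axis)
  finally show "emeasure (cube_measure :: (real ^ 'n) measure) (space cube_measure) = 1"
    by (simp add: emeasure_cube)
qed

lemma atomless_cube: "atomless_prob_space (cube_measure :: (real ^ 'n) measure) (\<lambda>x. x $ i)"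
proof -
  interpret prob_space "cube_measure :: (real ^ 'n) measure" by (rule prob_space_cube)
  have V: "(\<lambda>x. x $ i) \<in> borel_measurable (cube_measure :: (real ^ 'n) measure)"
    by (intro measurable_restrict_space1 measurable_completion) simp
  show ?thesis
  proof
    show "(\<lambda>x. x $ i) \<in> borel_measurable (cube_measure :: (real ^ 'n) measure)" by (rule V)
    fix c
    have "{x. x $ i = c} \<in> null_sets (lebesgue :: (real ^ 'n) measure)"
      using negligible_hyperplane[of "axis i (1::real)" c] by (simp add: negligible_iff_null_sets inner_axis')
    then have Z: "emeasure lebesgue {x. x $ i = c} = 0" "{x. x $ i = c} \<in> sets lebesgue"
      by (simp_all only: null_setsD1 null_setsD2)
    let ?S = "{x \<in> space (cube_measure :: (real ^ 'n) measure). x $ i = c}"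
    have "?S = (\<lambda>x. x $ i) -` {c} \<inter> space cube_measure" by auto
    then have S: "?S \<in> sets cube_measure" using measurable_sets[OF V, of "{c}"] by simp
    have "emeasure lebesgue ?S = 0" by (rule emeasure_eq_0[OF Z(2,1)]) auto
    then have "emeasure cube_measure ?S = 0" using emeasure_cube[OF S] by simp
    then show "prob ?S = 0" unfolding measure_def by simp
  qed
qed

lemma cube_set_borel_part:
  assumes "B \<in> sets (cube_measure :: (real ^ 'n) measure)"
  obtains S N N' where "B = S \<union> N" "S \<in> sets borel" "S \<subseteq> unit_cube" "N \<subseteq> N'" "N' \<in> null_sets lborel"
proof -
  from assms have B: "B \<in> sets (completion lborel)" "B \<subseteq> unit_cube" by (auto simp: cube_sets_iff)
  from sets_completionE[OF B(1)] obtain S N N' where "B = S \<union> N" "N \<subseteq> N'" "N' \<in> null_sets lborel" "S \<in> sets lborel" .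
  then show thesis using that[of S N N'] B(2) by auto
qed

lemma AE_cube_not_in:
  assumes "N \<in> null_sets (lborel :: (real ^ 'n) measure)"
  shows "AE x in cube_measure. x \<notin> N"
proof -
  have "AE x in lebesgue. x \<notin> N" using AE_not_in[OF assms] by (rule AE_completion)
  then show ?thesis by (subst AE_restrict_space_iff) auto
qed

lemma cube_countably_generated: "countably_generated_mod_null (cube_measure :: (real ^ 'n) measure)"
proof -
  obtain B :: "(real ^ 'n) set set" where B: "countable B" "topological_basis B" using ex_countable_basis by blast
  define G0 where "G0 = Inter ` {F. F \<subseteq> B \<and> finite F \<and> F \<noteq> {}}"
  have cG0: "countable G0"
  proof -
    have "countable {F. finite F \<and> F \<subseteq> B}" using B(1) by (rule countable_Collect_finite_subset)
    then have "countable {F. F \<subseteq> B \<and> finite F \<and> F \<noteq> {}}" by (rule countable_subset[rotated]) auto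
    then show ?thesis unfolding G0_def by (rule countable_image)
  qed
  have B_open: "open X" if "X \<in> B" for X using topological_basis_open[OF B(2) that] .
  have G0_open: "open X" if "X \<in> G0" for X using that B_open unfolding G0_def by (auto intro!: open_Inter)
  have sigma: "sigma_sets UNIV G0 = sets borel"
  proof -
    have "sets (borel :: (real ^ 'n) measure) = sigma_sets UNIV B"
      by (subst borel_eq_countable_basis[OF B]) (simp add: sets_measure_of)
    moreover have "B \<subseteq> G0"
    proof
      fix X assume "X \<in> B"
      then show "X \<in> G0" unfolding G0_def by (intro image_eqI[of _ _ "{X}"]) auto
    qed
    then have "sigma_sets UNIV B \<subseteq> sigma_sets UNIV G0" by (intro sigma_sets_mono') auto
    moreover have "sigma_sets UNIV G0 \<subseteq> sets (borel :: (real ^ 'n) measure)"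
    proof -
      have "G0 \<subseteq> sets borel" using G0_open by auto
      from sets.sigma_sets_subset[OF this] show ?thesis by simp
    qed
    ultimately show ?thesis by blast
  qed
  define G where "G = (\<lambda>X. unit_cube \<inter> X) ` G0"
  have sG: "sigma_sets unit_cube G = (\<lambda>X. unit_cube \<inter> X) ` sets borel"
    unfolding G_def sigma[symmetric] by (rule sigma_sets_Int[symmetric]) (auto simp: sigma)
  show ?thesis
    unfolding countably_generated_mod_null_def
  proof (intro exI[of _ G] conjI ballI)
    show "countable G" unfolding G_def using cG0 by (rule countable_image)
    show "Int_stable G"
    proof (rule Int_stableI)
      fix X Y assume "X \<in> G" "Y \<in> G"
      then obtain F1 F2 where F: "X = unit_cube \<inter> \<Inter>F1" "Y = unit_cube \<inter> \<Inter>F2"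
        "F1 \<subseteq> B" "finite F1" "F1 \<noteq> {}" "F2 \<subseteq> B" "finite F2" unfolding G_def G0_def by auto
      have "X \<inter> Y = unit_cube \<inter> \<Inter>(F1 \<union> F2)" unfolding F(1,2) by auto
      moreover have "\<Inter>(F1 \<union> F2) \<in> G0" unfolding G0_def using F by (intro imageI) auto
      ultimately show "X \<inter> Y \<in> G" unfolding G_def by auto
    qed
    show "G \<subseteq> sets cube_measure"
    proof
      fix Y assume "Y \<in> G"
      then obtain X where X: "X \<in> G0" "Y = unit_cube \<inter> X" unfolding G_def by (rule imageE)
      have "X \<in> sets borel" using G0_open[OF X(1)] by simp
      then have "Y \<in> sets borel" unfolding X(2) by simp
      then show "Y \<in> sets cube_measure" unfolding cube_sets_iff using X(2) by simp
    qed
    fix D assume D: "D \<in> sets (cube_measure :: (real ^ 'n) measure)"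
    obtain S N N' where S: "D = S \<union> N" "S \<in> sets borel" "S \<subseteq> unit_cube" "N \<subseteq> N'" "N' \<in> null_sets lborel"
      by (rule cube_set_borel_part[OF D])
    have "S \<in> sigma_sets (space cube_measure) G" using S(2,3) by (auto simp: sG image_iff)
    moreover have "AE x in cube_measure. x \<in> D \<longleftrightarrow> x \<in> S"
      using AE_cube_not_in[OF S(5)] by eventually_elim (use S in auto)
    ultimately show "\<exists>D'\<in>sigma_sets (space cube_measure) G. AE x in cube_measure. x \<in> D \<longleftrightarrow> x \<in> D'" by blast
  qed
qed

text \<open>
  Borel sets suffice: every Lebesgue set is a Borel set up to a subset of a Borel null set, and the
  preimage of the latter is again null.
\<close>

lemma measure_preserving_mapI:
  fixes \<omega> :: "real ^ 'n \<Rightarrow> real ^ 'n"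
  assumes \<omega>[measurable]: "\<omega> \<in> borel_measurable cube_measure" and cube: "\<And>x. \<omega> x \<in> unit_cube"
    and eq: "\<And>S. S \<in> sets borel \<Longrightarrow> S \<subseteq> unit_cube \<Longrightarrow> emeasure cube_measure (\<omega> -` S \<inter> unit_cube) = emeasure cube_measure S"
  shows "measure_preserving_map cube_measure \<omega>"
proof -
  have main: "\<omega> -` B \<inter> unit_cube \<in> sets cube_measure \<and> emeasure cube_measure (\<omega> -` B \<inter> unit_cube) = emeasure cube_measure B"
    if B: "B \<in> sets cube_measure" for B
  proof -
    obtain S N N' where S: "B = S \<union> N" "S \<in> sets borel" "S \<subseteq> unit_cube" "N \<subseteq> N'" "N' \<in> null_sets lborel"
      by (rule cube_set_borel_part[OF B])
    have pre[measurable]: "\<omega> -` X \<inter> unit_cube \<in> sets cube_measure" if "X \<in> sets borel" for X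
      using measurable_sets[OF \<omega> that] by simp
    have N': "N' \<inter> unit_cube \<in> sets borel" using null_setsD2[OF S(5)] by simp
    have "N' \<inter> unit_cube \<in> null_sets cube_measure" using S(5) by (rule null_sets_cube_subset) auto
    then have 0: "emeasure cube_measure (\<omega> -` (N' \<inter> unit_cube) \<inter> unit_cube) = 0"
      using eq[OF N'] by (simp only: null_setsD1 Int_lower2)
    let ?Y = "\<omega> -` (N' \<inter> unit_cube) \<inter> unit_cube" and ?X = "\<omega> -` N \<inter> unit_cube"
    have "?Y \<in> null_sets cube_measure" by (rule null_setsI[OF 0 pre[OF N']])
    then have Y: "?Y \<in> null_sets lebesgue" by (simp only: null_sets_cube_iff)
    have XY: "?X \<subseteq> ?Y"
    proof
      fix x assume "x \<in> ?X"
      then have "\<omega> x \<in> N'" "x \<in> unit_cube" using S(4) by (auto simp del: mem_box_cart)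
      then show "x \<in> ?Y" using cube[of x] by (simp only: vimage_eq Int_iff)
    qed
    have XM: "?X \<in> null_sets cube_measure"
      unfolding null_sets_cube_iff using null_sets_completion_subset[OF XY Y] by simp
    have Ncube: "N \<subseteq> unit_cube" using B S(1) unfolding cube_sets_iff by blast
    have NM: "N \<in> null_sets cube_measure" by (rule null_sets_cube_subset[OF S(5,4) Ncube])
    have SM: "S \<in> sets cube_measure" using S(2,3) unfolding cube_sets_iff by simp
    have eqs: "\<omega> -` B \<inter> unit_cube = (\<omega> -` S \<inter> unit_cube) \<union> ?X" unfolding S(1) by auto
    show ?thesis
    proof
      show "\<omega> -` B \<inter> unit_cube \<in> sets cube_measure" unfolding eqs using pre[OF S(2)] XM by auto
      have "emeasure cube_measure (\<omega> -` B \<inter> unit_cube) = emeasure cube_measure (\<omega> -` S \<inter> unit_cube)"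
        unfolding eqs by (rule emeasure_Un_null_set[OF pre[OF S(2)] XM])
      also have "\<dots> = emeasure cube_measure S" by (rule eq[OF S(2,3)])
      also have "\<dots> = emeasure cube_measure B"
        unfolding S(1) by (rule emeasure_Un_null_set[OF SM NM, symmetric])
      finally show "emeasure cube_measure (\<omega> -` B \<inter> unit_cube) = emeasure cube_measure B" .
    qed
  qed
  have "\<omega> \<in> cube_measure \<rightarrow>\<^sub>M cube_measure"
    unfolding measurable_def using main cube by auto
  then show ?thesis unfolding measure_preserving_map_def using main by simp
qed

text \<open>
  The uniform measure on H has an atomless coordinate, so it can be mapped to the uniform measure on
  G. Null sets are treated separately since they carry no uniform measure.
\<close>

lemma exists_transport:
  fixes H G :: "(real ^ 'n) set"
  assumes H: "H \<in> sets cube_measure" and G: "G \<in> sets cube_measure"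
    and HG: "emeasure cube_measure H = emeasure cube_measure G"
  obtains \<omega> :: "real ^ 'n \<Rightarrow> real ^ 'n" where "\<omega> \<in> borel_measurable cube_measure" "\<And>x. \<omega> x \<in> unit_cube"
    "\<And>S. S \<in> sets borel \<Longrightarrow> S \<subseteq> unit_cube \<Longrightarrow>
      emeasure cube_measure (\<omega> -` S \<inter> H) = emeasure cube_measure (S \<inter> G)"
proof -
  interpret prob_space "cube_measure :: (real ^ 'n) measure" by (rule prob_space_cube)
  define i :: 'n where "i = undefined"
  interpret atomless_prob_space "cube_measure :: (real ^ 'n) measure" "\<lambda>x. x $ i" by (rule atomless_cube)
  show thesis
  proof (cases "emeasure cube_measure H = 0")
    case True
    have Z: "emeasure cube_measure (X \<inter> Y) = 0" if "Y \<in> sets cube_measure" "emeasure cube_measure Y = 0" for X Y :: "(real ^ 'n) set"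
      by (rule emeasure_eq_0[OF that]) (rule Int_lower2)
    have G0: "emeasure cube_measure G = 0" using True HG by simp
    show thesis
    proof (rule that[of "\<lambda>_. 0"])
      show "(0 :: real ^ 'n) \<in> unit_cube" by (simp add: mem_box_cart)
      show "emeasure cube_measure ((\<lambda>_. 0) -` S \<inter> H) = emeasure cube_measure (S \<inter> G)" for S :: "(real ^ 'n) set"
        unfolding Z[OF H True] Z[OF G G0] ..
    qed (rule borel_measurable_const)
  next
    case False
    let ?H = "uniform_measure cube_measure H" and ?G = "uniform_measure cube_measure G"
    have fin: "emeasure cube_measure X \<noteq> \<infinity>" for X :: "(real ^ 'n) set" by simp
    interpret UH: prob_space ?H by (rule prob_space_uniform_measure[OF False fin])
    interpret UG: prob_space ?G by (rule prob_space_uniform_measure[OF _ fin]) (simp only: HG[symmetric] False not_False_eq_True)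
    have "prob H \<noteq> 0" using False unfolding emeasure_eq_measure by simp
    then have H0: "prob H > 0" using measure_nonneg[of _ H] by (simp only: zero_less_measure_iff) simp
    have id: "(\<lambda>x. x) \<in> borel_measurable (cube_measure :: (real ^ 'n) measure)"
      by (intro measurable_restrict_space1 measurable_completion) simp
    then have idG: "(\<lambda>x. x) \<in> borel_measurable ?G" by simp
    define \<nu> where "\<nu> = distr ?G borel (\<lambda>x. x)"
    have \<nu>: "prob_space \<nu>" "sets \<nu> = sets borel"
      unfolding \<nu>_def by (auto intro!: UG.prob_space_distr idG)
    have \<nu>c: "AE x in \<nu>. x \<in> unit_cube"
      unfolding \<nu>_def by (subst AE_distr_iff[OF idG]) (auto intro: AE_I2)
    have VH: "(\<lambda>x. x $ i) \<in> borel_measurable ?H" using V_measurable by simp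
    have UH0: "UH.prob {x\<in>space ?H. x $ i = c} = 0" for c
    proof -
      have c[measurable]: "{x\<in>space (cube_measure :: (real ^ 'n) measure). x $ i = c} \<in> sets cube_measure" by measurable
      have "UH.prob {x\<in>space ?H. x $ i = c} = prob (H \<inter> {x\<in>space cube_measure. x $ i = c}) / prob H"
        using measure_uniform_eq[OF H H0 c] by simp
      also have "prob (H \<inter> {x\<in>space cube_measure. x $ i = c}) = 0"
        using finite_measure_mono[OF Int_lower2 c, of H] V_atomless[of c]
        by (simp add: measure_le_0_iff)
      finally show ?thesis by simp
    qed
    obtain \<omega> :: "real ^ 'n \<Rightarrow> real ^ 'n"
      where \<omega>: "\<omega> \<in> borel_measurable ?H" "\<And>x. \<omega> x \<in> unit_cube" "distr ?H borel \<omega> = \<nu>"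
      by (rule UH.exists_map_with_law[OF VH _ \<nu> \<nu>c]) (rule UH0, rule that)
    have \<omega>m: "\<omega> \<in> borel_measurable cube_measure" using \<omega>(1) by simp
    show thesis
    proof (rule that[OF \<omega>m \<omega>(2)])
      fix S :: "(real ^ 'n) set" assume S: "S \<in> sets borel" "S \<subseteq> unit_cube"
      have SM: "S \<in> sets cube_measure" using S by (simp add: cube_sets_iff)
      have pre: "\<omega> -` S \<inter> unit_cube \<in> sets cube_measure" using measurable_sets[OF \<omega>m S(1)] by simp
      have HM: "H \<subseteq> unit_cube" using H by (simp add: cube_sets_iff)
      have "emeasure ?H (\<omega> -` S \<inter> unit_cube) = emeasure (distr ?H borel \<omega>) S"
        by (subst emeasure_distr[OF \<omega>(1) S(1)]) simp
      also have "\<dots> = emeasure ?G S"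
        unfolding \<omega>(3) \<nu>_def using S(2) by (subst emeasure_distr[OF idG S(1)]) (simp add: Int_absorb2)
      finally have "emeasure cube_measure (H \<inter> (\<omega> -` S \<inter> unit_cube)) / emeasure cube_measure H
          = emeasure cube_measure (G \<inter> S) / emeasure cube_measure H"
        using pre SM H G HG by simp
      moreover have "H \<inter> (\<omega> -` S \<inter> unit_cube) = \<omega> -` S \<inter> H" using HM by auto
      ultimately have "measure cube_measure (\<omega> -` S \<inter> H) / prob H = measure cube_measure (S \<inter> G) / prob H"
        using H0 by (simp add: emeasure_eq_measure divide_ennreal Int_commute)
      then show "emeasure cube_measure (\<omega> -` S \<inter> H) = emeasure cube_measure (S \<inter> G)"
        using H0 by (simp add: emeasure_eq_measure)
    qed
  qed
qed

text \<open>
  The complements of the two unions have equal measure and are added to the families, so that the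
  pieces form partitions of the cube; the transports of the single pieces are then glued together.
\<close>

lemma exists_measure_preserving_rearrangement:
  fixes H G :: "nat \<Rightarrow> (real ^ 'n) set"
  assumes H: "\<And>k. H k \<in> sets cube_measure" and G: "\<And>k. G k \<in> sets cube_measure"
    and dH: "disjoint_family H" and dG: "disjoint_family G"
    and HG: "\<And>k. emeasure cube_measure (H k) = emeasure cube_measure (G k)"
  obtains \<omega> where "measure_preserving_map cube_measure \<omega>"
    "\<And>k. AE x in cube_measure. x \<in> H k \<longrightarrow> \<omega> x \<in> G k"
proof -
  interpret prob_space "cube_measure :: (real ^ 'n) measure" by (rule prob_space_cube)
  define ext where "ext = (\<lambda>(X :: nat \<Rightarrow> (real ^ 'n) set) k. case k of 0 \<Rightarrow> unit_cube - (\<Union>k. X k) | Suc k \<Rightarrow> X k)"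
  have e0: "ext X 0 = unit_cube - (\<Union>k. X k)" and eS: "ext X (Suc k) = X k" for X k
    by (simp_all add: ext_def)
  have cubeM: "unit_cube \<in> sets (cube_measure :: (real ^ 'n) measure)" by (simp add: cube_sets_iff)
  have ext_meas: "ext X k \<in> sets cube_measure" if "\<And>k. X k \<in> sets cube_measure" for X k
  proof (cases k)
    case 0
    have "(\<Union>k. X k) \<in> sets cube_measure" by (rule sets.countable_UN') (use that in auto)
    then show ?thesis unfolding 0 e0 by (rule sets.Diff[OF cubeM])
  qed (simp only: eS that)
  have ext_disj: "disjoint_family (ext X)" if d: "disjoint_family X" for X
  proof (unfold disjoint_family_on_def, intro ballI impI)
    fix a b :: nat assume "a \<noteq> b"
    then show "ext X a \<inter> ext X b = {}"
      using d by (cases a; cases b) (auto simp only: e0 eS disjoint_family_on_def UNIV_I nat.inject Ball_def)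
  qed
  have ext_cover: "(\<Union>k. ext X k) = unit_cube" if X: "\<And>k. X k \<in> sets cube_measure" for X
  proof
    have "X k \<subseteq> unit_cube" for k using X[of k] unfolding cube_sets_iff by simp
    then have "ext X k \<subseteq> unit_cube" for k by (cases k) (simp_all only: e0 eS Diff_subset)
    then show "(\<Union>k. ext X k) \<subseteq> unit_cube" by (rule UN_least)
    show "unit_cube \<subseteq> (\<Union>k. ext X k)"
    proof
      fix x :: "real ^ 'n" assume x: "x \<in> unit_cube"
      show "x \<in> (\<Union>k. ext X k)"
      proof (cases "x \<in> (\<Union>k. X k)")
        case True
        then obtain k where "x \<in> X k" by (rule UN_E)
        then show ?thesis unfolding eS[of X k, symmetric] by (rule UN_I[OF UNIV_I])
      next
        case False
        then have "x \<in> ext X 0" unfolding e0 using x by (rule DiffI[rotated])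
        then show ?thesis by (rule UN_I[OF UNIV_I])
      qed
    qed
  qed
  have ext_eq: "emeasure cube_measure (ext H k) = emeasure cube_measure (ext G k)" for k
  proof (cases k)
    case 0
    have "emeasure cube_measure (\<Union>k. H k) = (\<Sum>k. emeasure cube_measure (H k))"
      by (rule suminf_emeasure[OF _ dH, symmetric]) (use H in blast)
    also have "\<dots> = emeasure cube_measure (\<Union>k. G k)"
      unfolding HG by (rule suminf_emeasure[OF _ dG]) (use G in blast)
    finally have "prob (\<Union>k. H k) = prob (\<Union>k. G k)" by (simp add: measure_def)
    then have "prob (space cube_measure - (\<Union>k. H k)) = prob (space cube_measure - (\<Union>k. G k))"
      using H G by (subst (1 2) prob_compl) auto
    then show ?thesis unfolding 0 e0 emeasure_eq_measure by simp
  qed (simp only: eS HG)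
  have ex: "\<exists>\<omega>. \<omega> \<in> borel_measurable cube_measure \<and> (\<forall>x. \<omega> x \<in> unit_cube) \<and>
    (\<forall>S. S \<in> sets borel \<longrightarrow> S \<subseteq> unit_cube \<longrightarrow>
      emeasure cube_measure (\<omega> -` S \<inter> ext H k) = emeasure cube_measure (S \<inter> ext G k))" for k
  proof (rule exists_transport[OF ext_meas[of H, OF H] ext_meas[of G, OF G] ext_eq[of k]])
    fix \<omega> :: "real ^ 'n \<Rightarrow> real ^ 'n"
    assume "\<omega> \<in> borel_measurable cube_measure" "\<And>x. \<omega> x \<in> unit_cube" "\<And>S. S \<in> sets borel \<Longrightarrow> S \<subseteq> unit_cube \<Longrightarrow>
      emeasure cube_measure (\<omega> -` S \<inter> ext H k) = emeasure cube_measure (S \<inter> ext G k)"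
    then show ?thesis by (intro exI[of _ \<omega>] conjI allI impI)
  qed
  from choice[OF allI[OF ex]] obtain W :: "nat \<Rightarrow> real ^ 'n \<Rightarrow> real ^ 'n" where WA:
    "\<forall>k. W k \<in> borel_measurable cube_measure \<and> (\<forall>x. W k x \<in> unit_cube) \<and>
    (\<forall>S. S \<in> sets borel \<longrightarrow> S \<subseteq> unit_cube \<longrightarrow>
      emeasure cube_measure (W k -` S \<inter> ext H k) = emeasure cube_measure (S \<inter> ext G k))" ..
  have W: "W k \<in> borel_measurable cube_measure" "W k x \<in> unit_cube"
    "S \<in> sets borel \<Longrightarrow> S \<subseteq> unit_cube \<Longrightarrow>
      emeasure cube_measure (W k -` S \<inter> ext H k) = emeasure cube_measure (S \<inter> ext G k)" for k x S
    using spec[OF WA, of k] by simp_all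
  define idx where "idx = (\<lambda>x. SOME k. x \<in> ext H k)"
  define \<omega> where "\<omega> = (\<lambda>x. W (idx x) x)"
  have idx: "idx x = k" if "x \<in> ext H k" for x k
  proof -
    have "x \<in> ext H (idx x)" unfolding idx_def using that by (rule someI)
    then show ?thesis using ext_disj[OF dH] that by (auto simp: disjoint_family_on_def)
  qed
  have ext_sub: "ext H k \<subseteq> unit_cube" for k using ext_meas[of H k, OF H] by (simp add: cube_sets_iff)
  have pre: "\<omega> -` S \<inter> unit_cube = (\<Union>k. W k -` S \<inter> ext H k)" for S
    unfolding ext_cover[of H, OF H, symmetric] by (auto simp: \<omega>_def idx)
  have pieceM: "W k -` S \<inter> ext H k \<in> sets cube_measure" if S: "S \<in> sets borel" for S k
  proof -
    have "W k -` S \<inter> ext H k = (W k -` S \<inter> space cube_measure) \<inter> ext H k" using ext_sub by auto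
    then show ?thesis using measurable_sets[OF W(1)[of k] S] ext_meas[of H k, OF H] by auto
  qed
  have dp: "disjoint_family (\<lambda>k. W k -` S \<inter> ext H k)" for S
    using ext_disj[OF dH] by (auto simp: disjoint_family_on_def)
  have mp: "measure_preserving_map cube_measure \<omega>"
  proof (rule measure_preserving_mapI)
    show "\<omega> \<in> borel_measurable cube_measure"
    proof (rule measurableI)
      fix S :: "(real ^ 'n) set" assume "S \<in> sets borel"
      then show "\<omega> -` S \<inter> space cube_measure \<in> sets cube_measure"
        using pre[of S] pieceM by auto
    qed simp
    show "\<omega> x \<in> unit_cube" for x unfolding \<omega>_def by (rule W(2))
    fix S :: "(real ^ 'n) set" assume S: "S \<in> sets borel" "S \<subseteq> unit_cube"
    have SM: "S \<in> sets cube_measure" using S by (simp add: cube_sets_iff)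
    have "emeasure cube_measure (\<omega> -` S \<inter> unit_cube) = (\<Sum>k. emeasure cube_measure (W k -` S \<inter> ext H k))"
      unfolding pre by (rule suminf_emeasure[symmetric]) (use pieceM[OF S(1)] dp in auto)
    also have "\<dots> = (\<Sum>k. emeasure cube_measure (S \<inter> ext G k))" using W(3)[OF S] by simp
    also have "\<dots> = emeasure cube_measure (\<Union>k. S \<inter> ext G k)"
      by (rule suminf_emeasure) (use SM ext_meas[of G, OF G] ext_disj[OF dG] in \<open>auto simp: disjoint_family_on_def\<close>)
    also have "(\<Union>k. S \<inter> ext G k) = S" using ext_cover[of G, OF G] S(2) by auto
    finally show "emeasure cube_measure (\<omega> -` S \<inter> unit_cube) = emeasure cube_measure S" .
  qed
  show thesis
  proof (rule that[OF mp])
    fix k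
    obtain S N N' where S: "G k = S \<union> N" "S \<in> sets borel" "S \<subseteq> unit_cube" "N \<subseteq> N'" "N' \<in> null_sets lborel"
      by (rule cube_set_borel_part[OF G[of k]])
    let ?S = "unit_cube - S"
    have S': "?S \<in> sets borel" "?S \<subseteq> unit_cube" using S(2) by auto
    have "emeasure cube_measure (W (Suc k) -` ?S \<inter> ext H (Suc k)) = emeasure cube_measure (?S \<inter> ext G (Suc k))"
      by (rule W(3)[OF S'])
    also have "?S \<inter> ext G (Suc k) \<subseteq> N' \<inter> unit_cube" using S by (auto simp: ext_def)
    then have "emeasure cube_measure (?S \<inter> ext G (Suc k)) \<le> emeasure cube_measure (N' \<inter> unit_cube)"
      using S(5) by (intro emeasure_mono) (auto simp: cube_sets_iff)
    also have "emeasure cube_measure (N' \<inter> unit_cube) = 0"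
    proof -
      have "N' \<inter> unit_cube \<in> null_sets cube_measure" using S(5) by (rule null_sets_cube_subset) auto
      then show ?thesis by (rule null_setsD1)
    qed
    finally have "W (Suc k) -` ?S \<inter> ext H (Suc k) \<in> null_sets cube_measure"
      using pieceM[OF S'(1), of "Suc k"] by (simp add: null_sets_def)
    from AE_not_in[OF this] show "AE x in cube_measure. x \<in> H k \<longrightarrow> \<omega> x \<in> G k"
    proof eventually_elim
      case (elim x)
      show ?case
      proof
        assume x: "x \<in> H k"
        then have x': "x \<in> ext H (Suc k)" by (simp add: ext_def)
        then have "\<omega> x = W (Suc k) x" using idx by (simp add: \<omega>_def)
        then show "\<omega> x \<in> G k" using elim x' W(2)[of "Suc k" x] S(1) by auto
      qed
    qed
  qed
qed

section \<open>Scales on which the exponent is close to one\<close>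

text \<open>
  At such a scale t a function of height 1/t on a subset of B has at each point a p-th power of at
  most K/t, so that the modular of such a block is comparable with its L1 norm.
\<close>

definition small_exponent_scales :: "(real ^ 'n \<Rightarrow> real) \<Rightarrow> real \<Rightarrow> bool" where
  "small_exponent_scales p K \<longleftrightarrow> (\<forall>\<epsilon>>0. \<exists>t>0. t < \<epsilon> \<and> (\<exists>B\<in>sets cube_measure.
     t < measure cube_measure B \<and> (\<forall>x\<in>B. (1 / t) powr (p x - 1) \<le> K)))"

lemma frequently_of_Limsup_pos:
  fixes u :: "'a \<Rightarrow> ereal"
  assumes "Limsup F u > 0"
  obtains c :: real where "c > 0" "\<exists>\<^sub>F t in F. u t > ereal c"
proof -
  obtain c :: real where c: "0 < c" "ereal c < Limsup F u"
    using ereal_dense2[OF assms] by (metis ereal_less(2))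
  have "\<exists>\<^sub>F t in F. u t > ereal c"
  proof (rule ccontr)
    assume "\<not> ?thesis"
    then have "\<forall>\<^sub>F t in F. u t \<le> ereal c" by (simp add: not_frequently not_less)
    then show False using Limsup_bounded[of u "ereal c" F] c(2) by simp
  qed
  then show thesis using that c(1) by blast
qed

text \<open>
  If the rearrangement of p' at t exceeds \<alpha> = c ln(e/t), then p' > \<alpha> on a set of measure
  more than t. There p - 1 is at most 2/\<alpha> as soon as \<alpha> is at least 2, and
  ln(1/t) (p - 1) is at most 2/c.
\<close>

lemma small_exponent_scales_of_Limsup:
  fixes p :: "real ^ 'n \<Rightarrow> real"
  assumes p[measurable]: "p \<in> borel_measurable cube_measure"
    and p1: "\<And>x. x \<in> unit_cube \<Longrightarrow> 1 \<le> p x"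
    and lim: "Limsup (at_right 0) (\<lambda>t. decreasing_rearrangement cube_measure (holder_conjugate p) t
                / ereal (ln (exp 1 / t))) > 0"
  obtains K where "small_exponent_scales p K"
proof -
  interpret prob_space "cube_measure :: (real ^ 'n) measure" by (rule prob_space_cube)
  obtain c :: real where c: "c > 0" and fr: "\<exists>\<^sub>F t in at_right 0.
      decreasing_rearrangement cube_measure (holder_conjugate p) t / ereal (ln (exp 1 / t)) > ereal c"
    using frequently_of_Limsup_pos[OF lim] by blast
  show thesis
  proof (rule that[of "exp (2 / c)"], unfold small_exponent_scales_def, intro allI impI)
    fix \<epsilon> :: real assume \<epsilon>: "\<epsilon> > 0"
    define \<epsilon>' where "\<epsilon>' = min \<epsilon> (exp (1 - 2 / c))"
    have "\<forall>\<^sub>F t in at_right 0. 0 < t \<and> t < min \<epsilon>' 1"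
      unfolding eventually_at_right_field using \<epsilon> by (intro exI[of _ "min \<epsilon>' 1"]) (auto simp: \<epsilon>'_def)
    from frequently_ex[OF frequently_eventually_conj[OF fr this]] obtain t where t: "0 < t" "t < \<epsilon>" "t < exp (1 - 2 / c)" "t < 1"
      and big: "decreasing_rearrangement cube_measure (holder_conjugate p) t / ereal (ln (exp 1 / t)) > ereal c"
      by (auto simp: \<epsilon>'_def)
    define l where "l = ln (exp 1 / t)"
    have l: "l = 1 - ln t" using t(1) by (simp add: l_def ln_div)
    have "ln t < 1 - 2 / c" using t(1,3) by (metis exp_gt_zero ln_exp ln_less_cancel_iff)
    then have l2: "l > 2 / c" by (simp add: l)
    then have l0: "l > 0" using c by (meson divide_pos_pos less_trans zero_less_numeral)
    define \<alpha> where "\<alpha> = c * l"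
    have \<alpha>: "\<alpha> > 2" using l2 c by (simp add: \<alpha>_def divide_less_eq mult.commute)
    define B where "B = {x \<in> space (cube_measure :: (real ^ 'n) measure). \<bar>holder_conjugate p x\<bar> > ereal \<alpha>}"
    have [measurable]: "holder_conjugate p \<in> borel_measurable cube_measure"
      unfolding holder_conjugate_def by measurable
    have B: "B \<in> sets cube_measure" unfolding B_def by measurable
    have tB: "t < prob B"
    proof (rule ccontr)
      assume "\<not> t < prob B"
      then have "emeasure cube_measure B \<le> ennreal t" by (simp add: emeasure_eq_measure ennreal_leI)
      then have "ereal \<alpha> \<in> {ereal \<alpha> | \<alpha>. 0 \<le> \<alpha> \<and> emeasure cube_measure {x \<in> space cube_measure. \<bar>holder_conjugate p x\<bar> > ereal \<alpha>} \<le> ennreal t}"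
        using \<alpha> unfolding B_def by (intro CollectI exI[of _ \<alpha>]) auto
      then have "decreasing_rearrangement cube_measure (holder_conjugate p) t \<le> ereal \<alpha>"
        unfolding decreasing_rearrangement_def by (rule Inf_lower)
      then have "decreasing_rearrangement cube_measure (holder_conjugate p) t / ereal l \<le> ereal \<alpha> / ereal l"
        by (rule ereal_divide_right_mono) (use l0 in simp)
      also have "\<dots> = ereal c" using l0 by (simp add: \<alpha>_def)
      finally show False using big by (simp add: l_def)
    qed
    have "(1 / t) powr (p x - 1) \<le> exp (2 / c)" if x: "x \<in> B" for x
    proof -
      have px: "1 \<le> p x" using p1 x by (simp add: B_def)
      have "p x - 1 \<le> 2 / \<alpha>"
      proof (cases "p x = 1")
        case False
        then have p0: "p x - 1 > 0" using px by simp
        then have "p x / (p x - 1) > \<alpha>" using x px False by (simp add: B_def holder_conjugate_def)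
        then have "\<alpha> * (p x - 1) < p x" using p0 by (simp add: less_divide_eq)
        then have "(\<alpha> - 1) * (p x - 1) < 1" by (simp add: algebra_simps)
        moreover have "\<alpha> / 2 * (p x - 1) \<le> (\<alpha> - 1) * (p x - 1)"
          using \<alpha> p0 by (intro mult_right_mono) auto
        ultimately have "\<alpha> / 2 * (p x - 1) \<le> 1" by linarith
        then show ?thesis using \<alpha> by (simp add: le_divide_eq mult.commute)
      qed (use \<alpha> in simp)
      moreover have "0 \<le> - ln t" using t by simp
      ultimately have "(p x - 1) * (- ln t) \<le> (2 / \<alpha>) * l"
        using px \<alpha> l by (intro mult_mono) auto
      also have "\<dots> = 2 / c" using l0 c by (simp add: \<alpha>_def)
      finally show ?thesis using t(1) by (simp add: powr_def ln_div)
    qed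
    then show "\<exists>t>0. t < \<epsilon> \<and> (\<exists>B\<in>sets cube_measure. t < measure cube_measure B \<and> (\<forall>x\<in>B. (1 / t) powr (p x - 1) \<le> exp (2 / c)))"
      using t B tB by blast
  qed
qed

text \<open>
  Unboundedness leaves the sign open: it is settled by passing to the negative of the function if
  necessary.
\<close>

lemma unbounded_limsup:
  fixes S :: "nat \<Rightarrow> real"
  assumes "\<not> (\<exists>R. \<forall>n. \<bar>S n\<bar> \<le> R)"
  shows "limsup (\<lambda>n. ereal (S n)) = \<infinity> \<or> limsup (\<lambda>n. ereal (- S n)) = \<infinity>"
proof (rule ccontr)
  assume neg: "\<not> ?thesis"
  have ev: "\<exists>C. \<forall>\<^sub>F n in sequentially. s n \<le> C" if "limsup (\<lambda>n. ereal (s n)) \<noteq> \<infinity>" for s :: "nat \<Rightarrow> real"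
  proof -
    have "limsup (\<lambda>n. ereal (s n)) < \<infinity>" using that by simp
    then obtain C :: real where C: "limsup (\<lambda>n. ereal (s n)) < ereal C" using ereal_dense2 by blast
    have "\<forall>\<^sub>F n in sequentially. ereal (s n) < ereal C" using Limsup_lessD[OF C] .
    then show ?thesis by (intro exI[of _ C]) (auto elim: eventually_mono)
  qed
  obtain C1 C2 where "\<forall>\<^sub>F n in sequentially. S n \<le> C1" "\<forall>\<^sub>F n in sequentially. - S n \<le> C2"
    using ev[of S] ev[of "\<lambda>n. - S n"] neg by blast
  then have "\<forall>\<^sub>F n in sequentially. norm (S n) \<le> max C1 C2" by eventually_elim auto
  then have "Bseq S" by (rule BfunI)
  then obtain R where "\<forall>n. norm (S n) \<le> R" by (auto elim: BseqE)
  then show False using assms by auto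
qed

text \<open>
  It is the later sets that are removed because in the applications they are far smaller, so that each
  set keeps most of its measure.
\<close>

lemma disjoint_family_minus_later:
  "disjoint_family (\<lambda>k::nat. X k - (\<Union>j. X (Suc (k + j))))"
proof -
  have "(X a - (\<Union>j. X (Suc (a + j)))) \<inter> (X b - (\<Union>j. X (Suc (b + j)))) = {}" if "a < b" for a b
  proof -
    have "b = Suc (a + (b - Suc a))" using that by simp
    then have "X b \<subseteq> (\<Union>j. X (Suc (a + j)))" by (metis UNIV_I UN_upper)
    then show ?thesis by blast
  qed
  then show ?thesis unfolding disjoint_family_on_def by (metis inf_commute linorder_neqE_nat)
qed

text \<open>
  The scales are chosen one after the other, each small compared with the preceding one and with a
  given bound.
\<close>

lemma exists_scales:
  fixes p :: "real ^ 'n \<Rightarrow> real" and T \<beta> :: "nat \<Rightarrow> real"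
  assumes sc: "small_exponent_scales p K" and T: "\<And>k. T k > 0" and \<beta>: "\<And>k. \<beta> k > 0"
  obtains t :: "nat \<Rightarrow> real" and B :: "nat \<Rightarrow> (real ^ 'n) set" where
    "\<And>k. t k > 0" "\<And>k. t k * T k \<le> 1" "\<And>k. t (Suc k) \<le> \<beta> k * t k"
    "\<And>k. B k \<in> sets cube_measure" "\<And>k. t k < measure cube_measure (B k)"
    "\<And>k x. x \<in> B k \<Longrightarrow> (1 / t k) powr (p x - 1) \<le> K"
proof -
  define P where "P = (\<lambda>(k::nat) (s :: real \<times> (real ^ 'n) set). 0 < fst s \<and> fst s * T k \<le> 1 \<and> snd s \<in> sets cube_measure \<and>
    fst s < measure cube_measure (snd s) \<and> (\<forall>x\<in>snd s. (1 / fst s) powr (p x - 1) \<le> K))"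
  have ex: "\<exists>s. P k s \<and> fst s \<le> e" if "e > 0" for k e
  proof -
    have "min e (1 / T k) > 0" using that T[of k] by simp
    with sc obtain t B where "0 < t" "t < min e (1 / T k)" "B \<in> sets cube_measure"
      "t < measure cube_measure B" "\<forall>x\<in>B. (1 / t) powr (p x - 1) \<le> K"
      unfolding small_exponent_scales_def by blast
    moreover then have "t * T k \<le> 1" using T[of k] by (simp add: less_divide_eq)
    ultimately show ?thesis by (intro exI[of _ "(t, B)"]) (simp add: P_def)
  qed
  have "\<exists>s. \<forall>k. P k (s k) \<and> fst (s (Suc k)) \<le> \<beta> k * fst (s k)"
  proof (rule dependent_nat_choice)
    show "\<exists>s. P 0 s" using ex[of 1 0] by auto
    show "\<exists>s'. P (Suc k) s' \<and> fst s' \<le> \<beta> k * fst s" if "P k s" for s k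
      using ex[of "\<beta> k * fst s" "Suc k"] that \<beta>[of k] by (simp add: P_def)
  qed
  then obtain s where s: "\<And>k. P k (s k)" "\<And>k. fst (s (Suc k)) \<le> \<beta> k * fst (s k)" by auto
  show thesis
    by (rule that[of "\<lambda>k. fst (s k)" "\<lambda>k. snd (s k)"]) (use s in \<open>auto simp: P_def\<close>)
qed

section \<open>Disjoint blocks adapted to the exponent\<close>

lemma (in prob_space) simple_function_bounded_above:
  fixes P :: "'a \<Rightarrow> real"
  assumes P: "simple_function M P"
  obtains T where "T > 0" "\<And>y. y \<in> space M \<Longrightarrow> P y \<le> T"
proof (rule that[of "1 + (\<Sum>v\<in>P ` space M. \<bar>v\<bar>)"])
  have fin: "finite (P ` space M)" using simple_functionD(1)[OF P] .
  have "0 \<le> (\<Sum>v\<in>P ` space M. \<bar>v\<bar>)" by (rule sum_nonneg) simp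
  then show "1 + (\<Sum>v\<in>P ` space M. \<bar>v\<bar>) > 0" by linarith
  fix y assume y: "y \<in> space M"
  have "\<bar>P y\<bar> \<le> (\<Sum>v\<in>P ` space M. \<bar>v\<bar>)"
    by (rule member_le_sum[OF imageI[OF y] _ fin]) simp
  then show "P y \<le> 1 + (\<Sum>v\<in>P ` space M. \<bar>v\<bar>)" by linarith
qed

lemma geometric_tail:
  fixes t :: "nat \<Rightarrow> real" and \<beta> :: real
  assumes t0: "\<And>k. t k > 0" and half: "\<And>k. t (Suc k) \<le> t k / 2" and step: "t (Suc k) \<le> \<beta> * t k"
  shows "summable (\<lambda>j. t (Suc (k + j)))" "(\<Sum>j. t (Suc (k + j))) \<le> 2 * \<beta> * t k"
proof -
  have le: "t (Suc (k + j)) \<le> t (Suc k) * (1/2) ^ j" for j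
  proof (induction j)
    case (Suc j)
    then show ?case using half[of "Suc (k + j)"] by simp
  qed simp
  have g: "(\<lambda>j. t (Suc k) * (1/2 :: real) ^ j) sums (t (Suc k) * (1 / (1 - 1/2)))"
    by (intro sums_mult geometric_sums) simp
  show s: "summable (\<lambda>j. t (Suc (k + j)))"
    by (rule summable_comparison_test'[OF sums_summable[OF g]]) (use le t0 in \<open>simp add: abs_of_pos\<close>)
  have "(\<Sum>j. t (Suc (k + j))) \<le> (\<Sum>j. t (Suc k) * (1/2 :: real) ^ j)"
    by (rule suminf_le[OF le s sums_summable[OF g]])
  also have "\<dots> = 2 * t (Suc k)" using sums_unique[OF g] by simp
  finally show "(\<Sum>j. t (Suc (k + j))) \<le> 2 * \<beta> * t k" using step by simp
qed

lemma (in prob_space) prob_minus_later: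
  assumes X: "\<And>k. X k \<in> sets M" and s: "\<And>k. prob (X k) \<le> s k"
    and sm: "summable (\<lambda>j. s (Suc (k + j)))"
  shows "X k - (\<Union>j. X (Suc (k + j))) \<in> sets M"
    "prob (X k) - (\<Sum>j. s (Suc (k + j))) \<le> prob (X k - (\<Union>j. X (Suc (k + j))))"
proof -
  let ?U = "\<Union>j. X (Suc (k + j))"
  have U: "?U \<in> sets M" by (rule sets.countable_UN') (use X in auto)
  show D: "X k - ?U \<in> sets M" by (rule sets.Diff[OF X U])
  have sm': "summable (\<lambda>j. prob (X (Suc (k + j))))"
    by (rule summable_comparison_test'[OF sm]) (use s in simp)
  have "prob ?U \<le> (\<Sum>j. prob (X (Suc (k + j))))"
    by (rule finite_measure_subadditive_countably[OF _ sm']) (use X in blast)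
  also have "\<dots> \<le> (\<Sum>j. s (Suc (k + j)))" by (rule suminf_le[OF s sm' sm])
  finally have u: "prob ?U \<le> (\<Sum>j. s (Suc (k + j)))" .
  have "prob (X k) \<le> prob ((X k - ?U) \<union> ?U)" by (rule finite_measure_mono[OF _ sets.Un[OF D U]]) blast
  also have "\<dots> \<le> prob (X k - ?U) + prob ?U" by (rule measure_Un_le[OF D U])
  finally show "prob (X k) - (\<Sum>j. s (Suc (k + j))) \<le> prob (X k - ?U)" using u by linarith
qed

lemma (in bounded_biorthonormal) partial_sum_close:
  assumes "x \<in> space M" "\<And>j. j < n \<Longrightarrow> \<bar>pairing M P (g j) - pairing M Q (g j)\<bar> \<le> e"
  shows "\<bar>partial_sum M f g P n x - partial_sum M f g Q n x\<bar> \<le> real n * (e * A)"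
proof -
  have "\<bar>pairing M P (g j) * f j x - pairing M Q (g j) * f j x\<bar> \<le> e * A" if "j < n" for j
    unfolding left_diff_distrib[symmetric] abs_mult
    by (rule mult_mono[OF assms(2)[OF that] f_le[OF assms(1)] _ abs_ge_zero])
      (rule order.trans[OF abs_ge_zero assms(2)[OF that]])
  then show ?thesis
    unfolding partial_sum_def sum_subtractf[symmetric]
    using abs_sum_le_card_mult[of "{..<n}" "\<lambda>j. pairing M P (g j) * f j x - pairing M Q (g j) * f j x" "e * A"] by simp
qed

text \<open>
  The k-th density is replaced by 1_H / |H| with |H| = t_k / 2, where t_k is a scale so small that
  the density is at most 1 / t_k. The scales decrease so fast that removing the later sets from H
  changes the relevant partial sums by at most 1/2. Parts of measure t_k of the sets where the exponent
  is small are made disjoint in the same way and keep at least half of their measure, so that each of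
  them has room for a copy of the k-th block.
\<close>

lemma concentrated_blocks:
  fixes f g :: "nat \<Rightarrow> real ^ 'n \<Rightarrow> real" and p :: "real ^ 'n \<Rightarrow> real"
  assumes bb: "bounded_biorthonormal cube_measure f g A" and sc: "small_exponent_scales p K"
    and large: "\<And>R. \<exists>P n0. simple_function cube_measure P \<and> (\<forall>y. 0 \<le> P y) \<and> integral\<^sup>L cube_measure P = 1 \<and>
      measure cube_measure {x\<in>space cube_measure. \<exists>n\<le>n0. R \<le> \<bar>partial_sum cube_measure f g P n x\<bar>} \<ge> \<delta>"
  obtains \<omega> :: "real ^ 'n \<Rightarrow> real ^ 'n" and H :: "nat \<Rightarrow> (real ^ 'n) set" and t :: "nat \<Rightarrow> real" and N :: "nat \<Rightarrow> nat" where
    "measure_preserving_map cube_measure \<omega>" "\<And>k. H k \<in> sets cube_measure" "disjoint_family H" "\<And>k. t k > 0"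
    "\<And>k. measure cube_measure (H k) \<le> t k / 2"
    "\<And>k. AE x in cube_measure. x \<in> H k \<longrightarrow> (1 / t k) powr (p (\<omega> x) - 1) \<le> K"
    "\<And>k. \<delta> \<le> measure cube_measure {x\<in>space cube_measure. \<exists>n\<le>N k.
        real k \<le> \<bar>partial_sum cube_measure f g (\<lambda>x. indicator (H k) x / (t k / 2)) n x\<bar>}"
proof -
  interpret bounded_biorthonormal "cube_measure :: (real ^ 'n) measure" f g A by fact
  define i :: 'n where "i = undefined"
  interpret atomless_prob_space "cube_measure :: (real ^ 'n) measure" "\<lambda>x. x $ i" by (rule atomless_cube)
  have "\<forall>k. \<exists>s. simple_function cube_measure (fst s) \<and> (\<forall>y. 0 \<le> fst s y) \<and> expectation (fst s) = 1 \<and>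
      \<delta> \<le> prob {x\<in>space cube_measure. \<exists>n\<le>snd s. real k + 1 \<le> \<bar>partial_sum cube_measure f g (fst s) n x\<bar>}"
  proof
    fix k
    from large[of "real k + 1"] obtain P n0 where "simple_function cube_measure P" "\<forall>y. 0 \<le> P y" "expectation P = 1"
      "\<delta> \<le> prob {x\<in>space cube_measure. \<exists>n\<le>n0. real k + 1 \<le> \<bar>partial_sum cube_measure f g P n x\<bar>}"
      by (elim exE conjE)
    then show "\<exists>s. simple_function cube_measure (fst s) \<and> (\<forall>y. 0 \<le> fst s y) \<and> expectation (fst s) = 1 \<and>
      \<delta> \<le> prob {x\<in>space cube_measure. \<exists>n\<le>snd s. real k + 1 \<le> \<bar>partial_sum cube_measure f g (fst s) n x\<bar>}"
      by (intro exI[of _ "(P, n0)"]) simp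
  qed
  from choice[OF this] obtain s where sA: "\<forall>k. simple_function cube_measure (fst (s k)) \<and> (\<forall>y. 0 \<le> fst (s k) y) \<and> expectation (fst (s k)) = 1 \<and>
      \<delta> \<le> prob {x\<in>space cube_measure. \<exists>n\<le>snd (s k). real k + 1 \<le> \<bar>partial_sum cube_measure f g (fst (s k)) n x\<bar>}" ..
  define P where "P = (\<lambda>k. fst (s k))"
  define N where "N = (\<lambda>k. snd (s k))"
  have P: "simple_function cube_measure (P k)" "0 \<le> P k y" "expectation (P k) = 1"
      "\<delta> \<le> prob {x\<in>space cube_measure. \<exists>n\<le>N k. real k + 1 \<le> \<bar>partial_sum cube_measure f g (P k) n x\<bar>}" for k y
    using spec[OF sA, of k] by (simp_all add: P_def N_def)
  have "\<forall>k. \<exists>T. T > 0 \<and> (\<forall>y\<in>space cube_measure. P k y \<le> T)"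
  proof
    fix k
    show "\<exists>T. T > 0 \<and> (\<forall>y\<in>space cube_measure. P k y \<le> T)"
      by (rule simple_function_bounded_above[OF P(1)[of k]]) (intro exI conjI ballI)
  qed
  from choice[OF this] obtain T where TA: "\<forall>k. T k > 0 \<and> (\<forall>y\<in>space cube_measure. P k y \<le> T k)" ..
  have T: "T k > 0" "y \<in> space cube_measure \<Longrightarrow> P k y \<le> T k" for k y using TA by auto
  \<comment> \<open>A bound for the ratio of consecutive scales, and thus for the proportion of a block that is lost
    to later blocks.\<close>
  define \<beta> where "\<beta> = (\<lambda>k. 1 / (4 * (1 + real (N k) * A * A)))"
  have A0: "A > 0" using A_ge_1 by simp
  have NA: "real (N k) * A * A \<ge> 0" for k using A0 by simp
  have \<beta>: "\<beta> k > 0" "\<beta> k \<le> 1/4" "real (N k) * A * A * \<beta> k \<le> 1/4" for k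
  proof -
    have "1 / (4 * (1 + c)) > 0 \<and> 1 / (4 * (1 + c)) \<le> 1/4 \<and> c * (1 / (4 * (1 + c))) \<le> 1/4" if "c \<ge> 0" for c :: real
      using that by (simp add: field_simps)
    from this[OF NA[of k]] show "\<beta> k > 0" "\<beta> k \<le> 1/4" "real (N k) * A * A * \<beta> k \<le> 1/4"
      unfolding \<beta>_def by blast+
  qed
  obtain t B where t: "\<And>k. t k > 0" "\<And>k. t k * T k \<le> 1" "\<And>k. t (Suc k) \<le> \<beta> k * t k"
    and B: "\<And>k. B k \<in> sets cube_measure" "\<And>k. t k < prob (B k)"
      "\<And>k x. x \<in> B k \<Longrightarrow> (1 / t k) powr (p x - 1) \<le> K"
    by (rule exists_scales[where T=T and \<beta>=\<beta>, OF sc T(1) \<beta>(1)]) (rule that)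
  have half: "t (Suc k) \<le> t k / 2" for k
  proof -
    have "\<beta> k * t k \<le> 1/2 * t k" using \<beta>(2)[of k] t(1)[of k] by (intro mult_right_mono) auto
    then show ?thesis using t(3)[of k] by simp
  qed
  note tail = geometric_tail[where t=t, OF t(1) half t(3)]
  have tail2: "summable (\<lambda>j. t (Suc (k + j)) / 2)" "(\<Sum>j. t (Suc (k + j)) / 2) \<le> \<beta> k * t k" for k
    using tail[of k] by (simp_all add: summable_divide suminf_divide)
  define \<eta> where "\<eta> = (\<lambda>k. 1 / (2 * (1 + real (N k) * A)))"
  have \<eta>: "\<eta> k > 0" "real (N k) * A * \<eta> k \<le> 1/2" for k
  proof -
    have "1 / (2 * (1 + c)) > 0 \<and> c * (1 / (2 * (1 + c))) \<le> 1/2" if "c \<ge> 0" for c :: real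
      using that by (simp add: field_simps)
    from this[of "real (N k) * A"] A0 show "\<eta> k > 0" "real (N k) * A * \<eta> k \<le> 1/2"
      unfolding \<eta>_def by simp_all
  qed
  have "\<forall>k. \<exists>H. H \<in> sets cube_measure \<and> prob H = t k / 2 \<and>
     (\<forall>j<N k. \<bar>pairing cube_measure (\<lambda>x. indicator H x / (t k / 2)) (g j) - pairing cube_measure (P k) (g j)\<bar> \<le> \<eta> k)"
  proof
    fix k
    have PT: "t k / 2 * P k y \<le> 1" if "y \<in> space cube_measure" for y
    proof -
      have "t k / 2 * P k y \<le> t k / 2 * T k" using T(2)[OF that, of k] t(1)[of k] by (intro mult_left_mono) auto
      then show ?thesis using t(2)[of k] by simp
    qed
    show "\<exists>H. H \<in> sets cube_measure \<and> prob H = t k / 2 \<and>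
     (\<forall>j<N k. \<bar>pairing cube_measure (\<lambda>x. indicator H x / (t k / 2)) (g j) - pairing cube_measure (P k) (g j)\<bar> \<le> \<eta> k)"
    proof (rule indicator_weak_approximation[where P="P k" and t="t k / 2" and h=g and C=A and \<eta>="\<eta> k" and n="N k"])
      show "t k / 2 > 0" using t(1)[of k] by simp
      fix H assume "H \<in> sets cube_measure" "prob H = t k / 2"
        "\<And>j. j < N k \<Longrightarrow> \<bar>pairing cube_measure (\<lambda>x. indicator H x / (t k / 2)) (g j) - pairing cube_measure (P k) (g j)\<bar> \<le> \<eta> k"
      then show "\<exists>H. H \<in> sets cube_measure \<and> prob H = t k / 2 \<and>
         (\<forall>j<N k. \<bar>pairing cube_measure (\<lambda>x. indicator H x / (t k / 2)) (g j) - pairing cube_measure (P k) (g j)\<bar> \<le> \<eta> k)"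
        by (intro exI[of _ H] conjI allI impI)
    qed (fact P(1) P(2) P(3) PT g g_le \<eta>(1))+
  qed
  from choice[OF this] obtain H where HA: "\<forall>k. H k \<in> sets cube_measure \<and> prob (H k) = t k / 2 \<and>
     (\<forall>j<N k. \<bar>pairing cube_measure (\<lambda>x. indicator (H k) x / (t k / 2)) (g j) - pairing cube_measure (P k) (g j)\<bar> \<le> \<eta> k)" ..
  have H: "H k \<in> sets cube_measure" "prob (H k) = t k / 2"
    "j < N k \<Longrightarrow> \<bar>pairing cube_measure (\<lambda>x. indicator (H k) x / (t k / 2)) (g j) - pairing cube_measure (P k) (g j)\<bar> \<le> \<eta> k" for k j
    using spec[OF HA, of k] by simp_all
  define H' where "H' = (\<lambda>k. H k - (\<Union>j. H (Suc (k + j))))"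
  have H'M: "H' k \<in> sets cube_measure" and H'ge: "t k / 2 - \<beta> k * t k \<le> prob (H' k)" for k
    using prob_minus_later[of H "\<lambda>k. t k / 2" k, OF H(1) _ tail2(1)] tail2(2)[of k] H(2) by (simp_all add: H'_def)
  have dH': "disjoint_family H'" unfolding H'_def by (rule disjoint_family_minus_later)
  have H'H: "H' k \<subseteq> H k" for k unfolding H'_def by (rule Diff_subset)
  have H'le: "prob (H' k) \<le> t k / 2" for k
    using finite_measure_mono[OF H'H H(1), of k] H(2) by simp
  have "\<forall>k. \<exists>V. V \<in> sets cube_measure \<and> V \<subseteq> B k \<and> prob V = t k"
  proof
    fix k
    show "\<exists>V. V \<in> sets cube_measure \<and> V \<subseteq> B k \<and> prob V = t k"
      by (rule subset_with_prob[OF B(1)[of k] less_imp_le[OF t(1)[of k]] less_imp_le[OF B(2)[of k]]]) (intro exI conjI)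
  qed
  from choice[OF this] obtain V where VA: "\<forall>k. V k \<in> sets cube_measure \<and> V k \<subseteq> B k \<and> prob (V k) = t k" ..
  have V: "V k \<in> sets cube_measure" "V k \<subseteq> B k" "prob (V k) = t k" for k using spec[OF VA, of k] by simp_all
  define V' where "V' = (\<lambda>k. V k - (\<Union>j. V (Suc (k + j))))"
  have V'M: "V' k \<in> sets cube_measure" and V'ge: "t k / 2 \<le> prob (V' k)" for k
  proof -
    have *: "prob (V k) \<le> t k" for k using V(3) by simp
    note pm = prob_minus_later[of V t k, OF V(1) * tail(1)]
    show "V' k \<in> sets cube_measure" unfolding V'_def by (rule pm(1))
    have "2 * \<beta> k * t k \<le> 1/2 * t k" using \<beta>(2)[of k] t(1)[of k] by (intro mult_right_mono) auto
    then show "t k / 2 \<le> prob (V' k)" using pm(2) tail(2)[of k] V(3)[of k] unfolding V'_def by simp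
  qed
  have "\<forall>k. \<exists>G. G \<in> sets cube_measure \<and> G \<subseteq> V' k \<and> prob G = prob (H' k)"
  proof
    fix k
    show "\<exists>G. G \<in> sets cube_measure \<and> G \<subseteq> V' k \<and> prob G = prob (H' k)"
      by (rule subset_with_prob[OF V'M[of k] measure_nonneg order.trans[OF H'le[of k] V'ge[of k]]]) (intro exI conjI)
  qed
  from choice[OF this] obtain G where GA: "\<forall>k. G k \<in> sets cube_measure \<and> G k \<subseteq> V' k \<and> prob (G k) = prob (H' k)" ..
  have G: "G k \<in> sets cube_measure" "G k \<subseteq> V' k" "prob (G k) = prob (H' k)" for k using spec[OF GA, of k] by simp_all
  have dG: "disjoint_family G"
  proof -
    have "disjoint_family V'" unfolding V'_def by (rule disjoint_family_minus_later)
    then show ?thesis by (rule disjoint_family_on_bisimulation) (use G(2) in blast)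
  qed
  have GB: "G k \<subseteq> B k" for k using G(2)[of k] V(2)[of k] unfolding V'_def by blast
  have HG: "emeasure cube_measure (H' k) = emeasure cube_measure (G k)" for k
    unfolding emeasure_eq_measure G(3) ..
  obtain \<omega> where \<omega>: "measure_preserving_map cube_measure \<omega>" "\<And>k. AE x in cube_measure. x \<in> H' k \<longrightarrow> \<omega> x \<in> G k"
    using exists_measure_preserving_rearrangement[of H' G, OF H'M G(1) dH' dG HG] by blast
  show thesis
  proof (rule that[OF \<omega>(1) H'M dH' t(1) H'le])
    show "AE x in cube_measure. x \<in> H' k \<longrightarrow> (1 / t k) powr (p (\<omega> x) - 1) \<le> K" for k
      using \<omega>(2)[of k]
    proof eventually_elim
      case (elim x)
      show ?case using elim subsetD[OF GB] B(3) by (intro impI) blast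
    qed
    fix k
    let ?q = "\<lambda>x. indicator (H k) x / (t k / 2)" and ?q' = "\<lambda>x. indicator (H' k) x / (t k / 2)"
    have iI: "integrable cube_measure (\<lambda>x. indicator S x / (t k / 2) :: real)" if "S \<in> sets cube_measure" for S :: "(real ^ 'n) set"
    proof -
      have "integrable cube_measure (\<lambda>x. indicator S x :: real)"
        by (rule integrable_bounded[of _ 1]) (use that in \<open>auto simp: indicator_def\<close>)
      then show ?thesis by (rule Bochner_Integration.integrable_divide)
    qed
    have qq: "?q x - ?q' x = indicator (H k - H' k) x / (t k / 2)" for x
      using H'H[of k] by (auto simp: indicator_def)
    have DM: "H k - H' k \<in> sets cube_measure" by (rule sets.Diff[OF H(1) H'M])
    have Dle: "prob (H k - H' k) \<le> \<beta> k * t k"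
      using finite_measure_Diff[OF H(1) H'M H'H, of k] H'ge[of k] H(2)[of k] by simp
    have close: "\<bar>pairing cube_measure ?q' (g j) - pairing cube_measure (P k) (g j)\<bar> \<le> \<eta> k + A * (2 * \<beta> k)" if "j < N k" for j
    proof -
      have "pairing cube_measure ?q (g j) - pairing cube_measure ?q' (g j) = pairing cube_measure (\<lambda>x. indicator (H k - H' k) x / (t k / 2)) (g j)"
      proof -
        have i: "integrable cube_measure (\<lambda>y. indicator S y / (t k / 2) * g j y)" if "S \<in> sets cube_measure" for S :: "(real ^ 'n) set"
          by (rule pairing_abs_le(1)[OF iI[OF that] _ g g_le]) (use t(1)[of k] in simp)
        show ?thesis
          unfolding pairing_def qq[symmetric] left_diff_distrib
          by (rule Bochner_Integration.integral_diff[OF i[OF H(1)] i[OF H'M], symmetric])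
      qed
      moreover have "\<bar>pairing cube_measure (\<lambda>x. indicator (H k - H' k) x / (t k / 2)) (g j)\<bar> \<le> A * (2 * \<beta> k)"
      proof -
        have "\<bar>pairing cube_measure (\<lambda>x. indicator (H k - H' k) x / (t k / 2)) (g j)\<bar>
            \<le> A * expectation (\<lambda>x. indicator (H k - H' k) x / (t k / 2))"
          by (rule pairing_abs_le(2)[OF iI[OF DM] _ g g_le]) (use t(1)[of k] in simp)
        also have "expectation (\<lambda>x. indicator (H k - H' k) x / (t k / 2)) = prob (H k - H' k) / (t k / 2)"
          using sets.sets_into_space[OF DM] by (simp add: Int_absorb2)
        also have "A * (prob (H k - H' k) / (t k / 2)) \<le> A * (2 * \<beta> k)"
        proof (rule mult_left_mono)
          show "prob (H k - H' k) / (t k / 2) \<le> 2 * \<beta> k" using Dle t(1)[of k] by (simp add: divide_le_eq)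
        qed (use A0 in simp)
        finally show ?thesis .
      qed
      ultimately show ?thesis using H(3)[OF that] by linarith
    qed
    have tot: "real (N k) * ((\<eta> k + A * (2 * \<beta> k)) * A) \<le> 1"
      using \<eta>(2)[of k] \<beta>(3)[of k] by (simp add: algebra_simps)
    have "\<delta> \<le> prob {x\<in>space cube_measure. \<exists>n\<le>N k. real k + 1 \<le> \<bar>partial_sum cube_measure f g (P k) n x\<bar>}" by (rule P(4))
    also have "\<dots> \<le> prob {x\<in>space cube_measure. \<exists>n\<le>N k. real k \<le> \<bar>partial_sum cube_measure f g ?q' n x\<bar>}"
    proof (rule finite_measure_mono)
      have [measurable]: "partial_sum cube_measure f g ?q' n \<in> borel_measurable cube_measure" for n
        unfolding partial_sum_def by measurable
      show "{x\<in>space cube_measure. \<exists>n\<le>N k. real k \<le> \<bar>partial_sum cube_measure f g ?q' n x\<bar>} \<in> sets cube_measure" by measurable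
      show "{x\<in>space cube_measure. \<exists>n\<le>N k. real k + 1 \<le> \<bar>partial_sum cube_measure f g (P k) n x\<bar>}
          \<subseteq> {x\<in>space cube_measure. \<exists>n\<le>N k. real k \<le> \<bar>partial_sum cube_measure f g ?q' n x\<bar>}"
      proof
        fix x assume "x \<in> {x\<in>space cube_measure. \<exists>n\<le>N k. real k + 1 \<le> \<bar>partial_sum cube_measure f g (P k) n x\<bar>}"
        then obtain n where x: "x \<in> space cube_measure" and n: "n \<le> N k" "real k + 1 \<le> \<bar>partial_sum cube_measure f g (P k) n x\<bar>"
          by (elim CollectE conjE exE)
        have "\<bar>partial_sum cube_measure f g ?q' n x - partial_sum cube_measure f g (P k) n x\<bar> \<le> real n * ((\<eta> k + A * (2 * \<beta> k)) * A)"
          by (rule partial_sum_close[OF x close]) (use n(1) in simp)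
        also have "\<dots> \<le> real (N k) * ((\<eta> k + A * (2 * \<beta> k)) * A)"
          using n(1) \<eta>(1)[of k] \<beta>(1)[of k] A0 by (intro mult_right_mono) (auto intro!: mult_nonneg_nonneg add_nonneg_nonneg)
        finally have "\<bar>partial_sum cube_measure f g ?q' n x - partial_sum cube_measure f g (P k) n x\<bar> \<le> 1" using tot by linarith
        then have "real k \<le> \<bar>partial_sum cube_measure f g ?q' n x\<bar>" using n(2) by linarith
        then show "x \<in> {x\<in>space cube_measure. \<exists>n\<le>N k. real k \<le> \<bar>partial_sum cube_measure f g ?q' n x\<bar>}"
          using x n(1) by (intro CollectI conjI exI[of _ n])
      qed
    qed
    finally show "\<delta> \<le> prob {x\<in>space cube_measure. \<exists>n\<le>N k. real k \<le> \<bar>partial_sum cube_measure f g ?q' n x\<bar>}" .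
  qed
qed

section \<open>Divergence in the space of variable exponent\<close>

text \<open>
  The function is a sum of the disjoint blocks with the coefficients of the gliding hump. Since the
  blocks are disjoint, its modular is the sum of the modulars of its blocks, each of which is at most
  K times its coefficient.
\<close>

lemma divergence_of_large_maximal_function:
  fixes f g :: "nat \<Rightarrow> real ^ 'n \<Rightarrow> real" and p :: "real ^ 'n \<Rightarrow> real"
  assumes bb: "bounded_biorthonormal cube_measure f g A" and \<delta>: "\<delta> > 0"
    and p[measurable]: "p \<in> borel_measurable cube_measure" and p1: "\<And>x. x \<in> unit_cube \<Longrightarrow> 1 \<le> p x"
    and sc: "small_exponent_scales p K"
    and large: "\<And>R. \<exists>P n0. simple_function cube_measure P \<and> (\<forall>y. 0 \<le> P y) \<and> integral\<^sup>L cube_measure P = 1 \<and>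
      measure cube_measure {x\<in>space cube_measure. \<exists>n\<le>n0. R \<le> \<bar>partial_sum cube_measure f g P n x\<bar>} \<ge> \<delta>"
  shows "\<exists>\<omega> :: real ^ 'n \<Rightarrow> real ^ 'n. measure_preserving_map cube_measure \<omega> \<and>
    (\<exists>F \<in> variable_Lebesgue cube_measure (\<lambda>x. p (\<omega> x)).
     \<exists>E \<in> sets cube_measure. emeasure cube_measure E > 0 \<and>
       (\<forall>x\<in>E. limsup (\<lambda>N. ereal (partial_sum cube_measure f g F N x)) = \<infinity>))"
proof -
  interpret bounded_biorthonormal "cube_measure :: (real ^ 'n) measure" f g A by fact
  obtain \<omega> :: "real ^ 'n \<Rightarrow> real ^ 'n" and H t N where
    \<omega>: "measure_preserving_map cube_measure \<omega>"
    and H[measurable]: "\<And>k. H k \<in> sets cube_measure" and dH: "disjoint_family H" and t: "\<And>k. t k > 0"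
    and Ht: "\<And>k. prob (H k) \<le> t k / 2"
    and pK: "\<And>k. AE x in cube_measure. x \<in> H k \<longrightarrow> (1 / t k) powr (p (\<omega> x) - 1) \<le> K"
    and big: "\<And>k. \<delta> \<le> prob {x\<in>space cube_measure. \<exists>n\<le>N k.
        real k \<le> \<bar>partial_sum cube_measure f g (\<lambda>x. indicator (H k) x / (t k / 2)) n x\<bar>}"
    by (rule concentrated_blocks[OF bb sc large]) (rule that)
  define q where "q = (\<lambda>k x. indicator (H k) x / (t k / 2) :: real)"
  have q0: "0 \<le> q k x" for k x using t[of k] by (simp add: q_def)
  have iI: "integrable cube_measure (\<lambda>x. indicator (H k) x :: real)" for k
    by (rule integrable_bounded[of _ 1]) (use H in \<open>auto simp: indicator_def\<close>)
  have iq: "integrable cube_measure (q k)" for k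
    unfolding q_def by (intro Bochner_Integration.integrable_divide iI)
  have q_meas[measurable]: "q k \<in> borel_measurable cube_measure" for k
    using iq by (rule borel_measurable_integrable)
  have Eq: "expectation (q k) \<le> 1" for k
  proof -
    have "expectation (q k) = prob (H k) / (t k / 2)"
      unfolding q_def using sets.sets_into_space[OF H] by (simp add: Int_absorb2)
    then show ?thesis using Ht[of k] t[of k] by (simp add: divide_le_eq)
  qed
  have A0: "A \<ge> 0" using A_ge_1 by simp
  have pq: "\<bar>pairing cube_measure (q k) (g j)\<bar> \<le> A" "expectation (\<lambda>y. \<bar>q k y * g j y\<bar>) \<le> A"
      "integrable cube_measure (\<lambda>y. q k y * g j y)" for k j
  proof -
    have "A * expectation (q k) \<le> A" using mult_left_mono[OF Eq[of k] A0] by simp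
    then show "\<bar>pairing cube_measure (q k) (g j)\<bar> \<le> A" "expectation (\<lambda>y. \<bar>q k y * g j y\<bar>) \<le> A"
      using pairing_abs_le(2,3)[OF iq[of k] q0 g g_le, of j] by linarith+
    show "integrable cube_measure (\<lambda>y. q k y * g j y)" by (rule pairing_abs_le(1)[OF iq[of k] q0 g g_le])
  qed
  define \<phi> where "\<phi> = (\<lambda>k. partial_sum cube_measure f g (q k))"
  have \<phi>m: "\<phi> k n \<in> borel_measurable cube_measure" for k n
    unfolding \<phi>_def partial_sum_def by measurable
  have \<phi>C: "\<bar>\<phi> k n x\<bar> \<le> A * A * real n" if x: "x \<in> space cube_measure" for k n x
  proof -
    have "\<bar>\<phi> k n x\<bar> \<le> real (card {..<n}) * (A * A)"
      unfolding \<phi>_def partial_sum_def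
    proof (rule abs_sum_le_card_mult)
      show "\<bar>pairing cube_measure (q k) (g j) * f j x\<bar> \<le> A * A" for j
        unfolding abs_mult using pq(1)[of k j] f_le[OF x, of j] A0 by (intro mult_mono) auto
    qed
    then show ?thesis by (simp add: mult.commute)
  qed
  have "\<exists>\<kappa> \<alpha>. strict_mono \<kappa> \<and> (\<forall>i. 0 \<le> \<alpha> i \<and> \<alpha> i \<le> (1/2) ^ i) \<and>
    \<not> (AE x in cube_measure. \<exists>R. \<forall>n. \<bar>\<Sum>i. \<alpha> i * \<phi> (\<kappa> i) n x\<bar> \<le> R)"
  proof (rule gliding_hump[where \<phi>=\<phi> and C="A * A" and \<delta>=\<delta> and N=N])
    show "\<delta> \<le> prob {x\<in>space cube_measure. \<exists>n\<le>N k. real k \<le> \<bar>\<phi> k n x\<bar>}" for k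
      using big[of k] unfolding \<phi>_def q_def .
  qed (use \<phi>m \<phi>C A0 \<delta> in simp_all)
  then obtain \<kappa> \<alpha> where \<kappa>: "strict_mono \<kappa>" and \<alpha>: "\<forall>i. 0 \<le> \<alpha> i \<and> \<alpha> i \<le> (1/2) ^ i"
    and unb: "\<not> (AE x in cube_measure. \<exists>R. \<forall>n. \<bar>\<Sum>i. \<alpha> i * \<phi> (\<kappa> i) n x\<bar> \<le> R)" by (elim exE conjE)
  have \<alpha>0: "0 \<le> \<alpha> i" and \<alpha>2: "\<alpha> i \<le> (1/2) ^ i" for i using \<alpha> by auto
  have \<alpha>1: "\<alpha> i \<le> 1" for i using \<alpha>2[of i] power_le_one[of "1/2 :: real" i] by simp
  have sm\<alpha>: "summable \<alpha>"
    by (rule summable_comparison_test'[OF summable_geometric[of "1/2 :: real"]]) (use \<alpha>0 \<alpha>2 in auto)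
  have inj: "i = j" if "x \<in> H (\<kappa> i)" "x \<in> H (\<kappa> j)" for x i j
  proof (rule ccontr)
    assume "i \<noteq> j"
    then have "\<kappa> i \<noteq> \<kappa> j" using strict_mono_eq[OF \<kappa>] by simp
    then have "H (\<kappa> i) \<inter> H (\<kappa> j) = {}" using dH by (simp add: disjoint_family_on_def)
    then show False using that by blast
  qed
  define F where "F = (\<lambda>x. \<Sum>i. \<alpha> i * q (\<kappa> i) x)"
  have Fm[measurable]: "F \<in> borel_measurable cube_measure" unfolding F_def by measurable
  have F_in: "F x = \<alpha> i * (2 / t (\<kappa> i))" if "x \<in> H (\<kappa> i)" for x i
  proof -
    have "F x = (\<Sum>j\<in>{i}. \<alpha> j * q (\<kappa> j) x)"
      unfolding F_def by (rule suminf_finite) (use inj[OF that] in \<open>auto simp: q_def indicator_def\<close>)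
    then show ?thesis using that by (simp add: q_def)
  qed
  have F_out: "F x = 0" if "\<And>i. x \<notin> H (\<kappa> i)" for x
    unfolding F_def using that by (simp add: q_def)
  have fin_supp: "finite {i. x \<in> H (\<kappa> i)}" for x
  proof (cases "\<exists>i. x \<in> H (\<kappa> i)")
    case True
    then obtain i where "x \<in> H (\<kappa> i)" ..
    then have "{i. x \<in> H (\<kappa> i)} \<subseteq> {i}" using inj by blast
    then show ?thesis by (rule finite_subset) simp
  qed simp
  have pairF: "(\<lambda>i. \<alpha> i * pairing cube_measure (q (\<kappa> i)) (g j)) sums pairing cube_measure F (g j)" for j
  proof -
    have sx: "summable (\<lambda>i. norm (\<alpha> i * (q (\<kappa> i) x * g j x)))" for x
      by (rule summable_finite[OF fin_supp[of x]]) (simp add: q_def)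
    have sx': "summable (\<lambda>i. \<alpha> i * q (\<kappa> i) x)" for x
      by (rule summable_finite[OF fin_supp[of x]]) (simp add: q_def)
    have "(\<lambda>i. LINT x|cube_measure. \<alpha> i * (q (\<kappa> i) x * g j x)) sums (LINT x|cube_measure. (\<Sum>i. \<alpha> i * (q (\<kappa> i) x * g j x)))"
    proof (rule sums_integral)
      show "integrable cube_measure (\<lambda>x. \<alpha> i * (q (\<kappa> i) x * g j x))" for i
        by (intro integrable_mult_right pq(3))
      show "AE x in cube_measure. summable (\<lambda>i. norm (\<alpha> i * (q (\<kappa> i) x * g j x)))"
        by (rule AE_I2) (rule sx)
      show "summable (\<lambda>i. LINT x|cube_measure. norm (\<alpha> i * (q (\<kappa> i) x * g j x)))"
      proof (rule summable_comparison_test'[OF summable_mult2[OF sm\<alpha>, of A]])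
        fix i
        have "(LINT x|cube_measure. norm (\<alpha> i * (q (\<kappa> i) x * g j x))) = \<alpha> i * expectation (\<lambda>x. \<bar>q (\<kappa> i) x * g j x\<bar>)"
          using \<alpha>0[of i] by (simp add: abs_mult[of "\<alpha> i"])
        also have "\<dots> \<le> \<alpha> i * A" by (rule mult_left_mono[OF pq(2) \<alpha>0])
        finally have "(LINT x|cube_measure. norm (\<alpha> i * (q (\<kappa> i) x * g j x))) \<le> \<alpha> i * A" .
        moreover have "0 \<le> (LINT x|cube_measure. norm (\<alpha> i * (q (\<kappa> i) x * g j x)))" by simp
        ultimately show "norm (LINT x|cube_measure. norm (\<alpha> i * (q (\<kappa> i) x * g j x))) \<le> \<alpha> i * A" by simp
      qed
    qed
    also have "(\<lambda>x. \<Sum>i. \<alpha> i * (q (\<kappa> i) x * g j x)) = (\<lambda>x. F x * g j x)"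
      unfolding F_def suminf_mult2[OF sx'] by (simp add: mult.assoc)
    finally show ?thesis by (simp add: pairing_def)
  qed
  have psF: "partial_sum cube_measure f g F n x = (\<Sum>i. \<alpha> i * \<phi> (\<kappa> i) n x)" for n x
  proof -
    have "(\<lambda>i. \<Sum>j<n. \<alpha> i * pairing cube_measure (q (\<kappa> i)) (g j) * f j x) sums (\<Sum>j<n. pairing cube_measure F (g j) * f j x)"
      by (intro sums_sum sums_mult2 pairF)
    then have "(\<lambda>i. \<alpha> i * \<phi> (\<kappa> i) n x) sums partial_sum cube_measure f g F n x"
      unfolding \<phi>_def partial_sum_def sum_distrib_left by (simp add: mult.assoc)
    then show ?thesis by (rule sums_unique)
  qed
  \<comment> \<open>The heights of the blocks are the coefficients times 2 / t; halving them leaves multiples of 1 / t.\<close>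
  have modular: "(\<integral>\<^sup>+ x. ennreal ((\<bar>F x\<bar> / 2) powr p (\<omega> x)) \<partial>cube_measure) < \<infinity>"
  proof -
    \<comment> \<open>If K is negative all blocks are null; the maximum keeps the estimates uniform.\<close>
    let ?K = "max K 0"
    have bnd: "AE x in cube_measure. \<forall>i. x \<in> H (\<kappa> i) \<longrightarrow> (1 / t (\<kappa> i)) powr (p (\<omega> x) - 1) \<le> ?K"
      unfolding AE_all_countable
    proof
      fix i
      show "AE x in cube_measure. x \<in> H (\<kappa> i) \<longrightarrow> (1 / t (\<kappa> i)) powr (p (\<omega> x) - 1) \<le> ?K"
        using pK[of "\<kappa> i"] by eventually_elim auto
    qed
    have \<omega>c: "\<omega> x \<in> unit_cube" if "x \<in> unit_cube" for x
      using \<omega> that unfolding measure_preserving_map_def by (auto dest: measurable_space)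
    have "(\<integral>\<^sup>+ x. ennreal ((\<bar>F x\<bar> / 2) powr p (\<omega> x)) \<partial>cube_measure)
      \<le> (\<integral>\<^sup>+ x. (\<Sum>i. ennreal (?K * \<alpha> i / t (\<kappa> i)) * indicator (H (\<kappa> i)) x) \<partial>cube_measure)"
    proof (rule nn_integral_mono_AE)
      show "AE x in cube_measure. ennreal ((\<bar>F x\<bar> / 2) powr p (\<omega> x)) \<le> (\<Sum>i. ennreal (?K * \<alpha> i / t (\<kappa> i)) * indicator (H (\<kappa> i)) x)"
        using bnd AE_space
      proof eventually_elim
        case (elim x)
        show ?case
        proof (cases "\<exists>i. x \<in> H (\<kappa> i)")
          case True
          then obtain i where i: "x \<in> H (\<kappa> i)" ..
          define s where "s = p (\<omega> x)"
          have s: "1 \<le> s" using p1[OF \<omega>c] elim(2) by (simp add: s_def)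
          have "\<bar>F x\<bar> / 2 = \<alpha> i * (1 / t (\<kappa> i))"
            using F_in[OF i] \<alpha>0[of i] t[of "\<kappa> i"] by (simp add: abs_mult)
          then have "(\<bar>F x\<bar> / 2) powr s = \<alpha> i powr s * (1 / t (\<kappa> i)) powr s"
            by (simp only: powr_mult)
          also have "\<dots> \<le> \<alpha> i * ((1 / t (\<kappa> i)) * ?K)"
          proof (rule mult_mono)
            show "\<alpha> i powr s \<le> \<alpha> i"
            proof (cases "\<alpha> i = 0")
              case False
              then have "\<alpha> i > 0" using \<alpha>0[of i] by simp
              then have "\<alpha> i powr s \<le> \<alpha> i powr 1" using \<alpha>1[of i] s by (intro powr_mono') auto
              then show ?thesis using \<open>\<alpha> i > 0\<close> by simp
            qed simp
            have "(1 / t (\<kappa> i)) powr s = (1 / t (\<kappa> i)) powr (1 + (s - 1))" by simp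
            also have "\<dots> = (1 / t (\<kappa> i)) powr 1 * (1 / t (\<kappa> i)) powr (s - 1)" by (rule powr_add)
            also have "\<dots> \<le> (1 / t (\<kappa> i)) * ?K"
              using elim(1) i t[of "\<kappa> i"] unfolding s_def by (intro mult_mono) auto
            finally show "(1 / t (\<kappa> i)) powr s \<le> (1 / t (\<kappa> i)) * ?K" .
          qed (use \<alpha>0 in auto)
          also have "\<dots> = ?K * \<alpha> i / t (\<kappa> i)" by simp
          finally have "ennreal ((\<bar>F x\<bar> / 2) powr s) \<le> ennreal (?K * \<alpha> i / t (\<kappa> i)) * indicator (H (\<kappa> i)) x"
            using i by (simp add: ennreal_leI)
          also have "\<dots> \<le> (\<Sum>i. ennreal (?K * \<alpha> i / t (\<kappa> i)) * indicator (H (\<kappa> i)) x)"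
          proof -
            have "h i \<le> suminf h" for h :: "nat \<Rightarrow> ennreal" using sum_le_suminf[of h "{i}"] by simp
            from this[of "\<lambda>i. ennreal (?K * \<alpha> i / t (\<kappa> i)) * indicator (H (\<kappa> i)) x"] show ?thesis .
          qed
          finally show ?thesis by (simp add: s_def)
        next
          case False
          then show ?thesis using F_out by simp
        qed
      qed
    qed
    also have "\<dots> = (\<Sum>i. \<integral>\<^sup>+ x. ennreal (?K * \<alpha> i / t (\<kappa> i)) * indicator (H (\<kappa> i)) x \<partial>cube_measure)"
      by (rule nn_integral_suminf) measurable
    also have "\<dots> \<le> (\<Sum>i. ennreal (?K * \<alpha> i))"
    proof (rule suminf_le[OF _ summableI summableI])
      fix i
      have "(\<integral>\<^sup>+ x. ennreal (?K * \<alpha> i / t (\<kappa> i)) * indicator (H (\<kappa> i)) x \<partial>cube_measure)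
          = ennreal (?K * \<alpha> i / t (\<kappa> i)) * emeasure cube_measure (H (\<kappa> i))"
        by (rule nn_integral_cmult_indicator) (rule H)
      also have "\<dots> = ennreal (?K * \<alpha> i / t (\<kappa> i) * prob (H (\<kappa> i)))"
        unfolding emeasure_eq_measure using \<alpha>0[of i] t[of "\<kappa> i"] by (subst ennreal_mult) auto
      also have "\<dots> \<le> ennreal (?K * \<alpha> i)"
      proof (rule ennreal_leI)
        have "?K * \<alpha> i / t (\<kappa> i) * prob (H (\<kappa> i)) \<le> ?K * \<alpha> i / t (\<kappa> i) * t (\<kappa> i)"
          using Ht[of "\<kappa> i"] t[of "\<kappa> i"] \<alpha>0[of i] by (intro mult_left_mono) auto
        then show "?K * \<alpha> i / t (\<kappa> i) * prob (H (\<kappa> i)) \<le> ?K * \<alpha> i" using t[of "\<kappa> i"] by simp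
      qed
      finally show "(\<integral>\<^sup>+ x. ennreal (?K * \<alpha> i / t (\<kappa> i)) * indicator (H (\<kappa> i)) x \<partial>cube_measure) \<le> ennreal (?K * \<alpha> i)" .
    qed
    also have "(\<Sum>i. ennreal (?K * \<alpha> i)) = ennreal (\<Sum>i. ?K * \<alpha> i)"
      by (rule suminf_ennreal2) (use \<alpha>0 summable_mult[OF sm\<alpha>] in auto)
    also have "\<dots> < \<infinity>" by simp
    finally show ?thesis .
  qed
  have FV: "(\<lambda>x. s * F x) \<in> variable_Lebesgue cube_measure (\<lambda>x. p (\<omega> x))" if "\<bar>s\<bar> = 1" for s :: real
  proof -
    have "\<bar>s * F x\<bar> = \<bar>F x\<bar>" for x using that by (simp add: abs_mult)
    then show ?thesis unfolding variable_Lebesgue_def using modular by (auto intro!: exI[of _ 2])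
  qed
  have ps_scale: "partial_sum cube_measure f g (\<lambda>x. s * F x) n x = s * partial_sum cube_measure f g F n x" for s n x
    unfolding partial_sum_def pairing_def by (simp add: sum_distrib_left mult.assoc)
  define U where "U = (\<lambda>s::real. {x\<in>space (cube_measure :: (real ^ 'n) measure).
     limsup (\<lambda>n. ereal (partial_sum cube_measure f g (\<lambda>x. s * F x) n x)) = \<infinity>})"
  have UM: "U s \<in> sets cube_measure" for s
  proof -
    have [measurable]: "partial_sum cube_measure f g (\<lambda>x. s * F x) n \<in> borel_measurable cube_measure" for n
      unfolding partial_sum_def by measurable
    show ?thesis unfolding U_def by measurable
  qed
  have "\<exists>s. \<bar>s\<bar> = 1 \<and> emeasure cube_measure (U s) > 0"
  proof (rule ccontr)
    assume "\<not> ?thesis"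
    then have "emeasure cube_measure (U 1) = 0" "emeasure cube_measure (U (-1)) = 0"
      by (auto simp: not_less dest: spec[of _ 1] spec[of _ "-1"])
    then have "U 1 \<in> null_sets cube_measure" "U (-1) \<in> null_sets cube_measure" using UM by (simp_all add: null_setsI)
    from AE_not_in[OF this(1)] AE_not_in[OF this(2)] AE_space
    have "AE x in cube_measure. \<exists>R. \<forall>n. \<bar>\<Sum>i. \<alpha> i * \<phi> (\<kappa> i) n x\<bar> \<le> R"
    proof eventually_elim
      case (elim x)
      show ?case
      proof (rule ccontr)
        assume "\<not> ?thesis"
        from unbounded_limsup[OF this] show False
          using elim by (simp add: U_def ps_scale psF)
      qed
    qed
    then show False using unb by contradiction
  qed
  then obtain s where s: "\<bar>s\<bar> = 1" "emeasure cube_measure (U s) > 0" by blast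
  show ?thesis
  proof (intro exI[of _ \<omega>] conjI \<omega> bexI[of _ "\<lambda>x. s * F x"] bexI[of _ "U s"] s(2) ballI)
    show "limsup (\<lambda>N. ereal (partial_sum cube_measure f g (\<lambda>x. s * F x) N x)) = \<infinity>" if "x \<in> U s" for x
      using that unfolding U_def by simp
  qed (use UM FV[OF s(1)] in simp_all)
qed

section \<open>The divergence theorem\<close>

lemma zero_in_variable_Lebesgue: "(\<lambda>x. 0) \<in> variable_Lebesgue M r"
  unfolding variable_Lebesgue_def by (auto intro!: exI[of _ 1])

text \<open>
  For each R one of the two families has large partial sums, and having them for R is stronger than
  for smaller values; so one family has them for all R.
\<close>

lemma (in bounded_biorthonormal) large_one_sided:
  defines "large \<equiv> \<lambda>f' g' R. \<exists>P n0. simple_function M P \<and> (\<forall>y. 0 \<le> P y) \<and> expectation P = 1 \<and>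
    prob {x\<in>space M. \<exists>n\<le>n0. R \<le> \<bar>partial_sum M f' g' P n x\<bar>} \<ge> 1 / (16 * A\<^sup>2)"
  shows "(\<forall>R. large f g R) \<or> (\<forall>R. large g f R)"
proof -
  have either: "large f g R \<or> large g f R" for R
    using large_maximal_function[of R] unfolding large_def by (elim exE conjE disjE) (intro disjI1 exI conjI, assumption+, intro disjI2 exI conjI, assumption+)
  have anti: "large f' g' R" if l: "large f' g' R'" and "R \<le> R'" and [measurable]: "\<And>k. f' k \<in> borel_measurable M" for f' g' R R'
  proof -
    obtain P n0 where P: "simple_function M P" "\<forall>y. 0 \<le> P y" "expectation P = 1"
      "prob {x\<in>space M. \<exists>n\<le>n0. R' \<le> \<bar>partial_sum M f' g' P n x\<bar>} \<ge> 1 / (16 * A\<^sup>2)"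
      using l unfolding large_def by (elim exE conjE)
    have [measurable]: "partial_sum M f' g' P n \<in> borel_measurable M" for n
      unfolding partial_sum_def by measurable
    have "prob {x\<in>space M. \<exists>n\<le>n0. R' \<le> \<bar>partial_sum M f' g' P n x\<bar>} \<le> prob {x\<in>space M. \<exists>n\<le>n0. R \<le> \<bar>partial_sum M f' g' P n x\<bar>}"
    proof (rule finite_measure_mono)
      show "{x\<in>space M. \<exists>n\<le>n0. R' \<le> \<bar>partial_sum M f' g' P n x\<bar>} \<subseteq> {x\<in>space M. \<exists>n\<le>n0. R \<le> \<bar>partial_sum M f' g' P n x\<bar>}"
        using \<open>R \<le> R'\<close> order.trans by blast
    qed measurable
    with P show ?thesis unfolding large_def by (intro exI[of _ P] exI[of _ n0] conjI) auto
  qed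
  show ?thesis
  proof (cases "\<forall>R. large f g R")
    case False
    then obtain R0 where R0: "\<not> large f g R0" by blast
    have "large g f R" for R
    proof -
      have "\<not> large f g (max R R0)" using anti[of f g "max R R0" R0] R0 f by auto
      then have "large g f (max R R0)" using either by blast
      then show ?thesis using anti[of g f "max R R0" R] g by auto
    qed
    then show ?thesis by blast
  qed simp
qed

text \<open>
  The functions are clipped at a bound that they exceed on null sets only.
\<close>

lemma bounded_biorthonormal_of_system:
  fixes f g :: "nat \<Rightarrow> real ^ 'n \<Rightarrow> real"
  assumes biorth: "biorthonormal cube_measure f g"
    and bounded: "\<And>n. n \<ge> 1 \<Longrightarrow>
          Linfty_norm cube_measure (f n) \<le> ereal A \<and> Linfty_norm cube_measure (g n) \<le> ereal A"
    and means: "\<And>D. D \<in> sets cube_measure \<Longrightarrow>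
          (\<lambda>n. LINT x:D|cube_measure. f n x) \<longlonglongrightarrow> 0 \<and>
          (\<lambda>n. LINT x:D|cube_measure. g n x) \<longlonglongrightarrow> 0"
  obtains f' g' A' where "bounded_biorthonormal cube_measure f' g' A'"
    "\<And>k. AE x in cube_measure. f' k x = f (Suc k) x" "\<And>k. AE x in cube_measure. g' k x = g (Suc k) x"
    "\<And>k. f (Suc k) \<in> borel_measurable cube_measure" "\<And>k. g (Suc k) \<in> borel_measurable cube_measure"
proof -
  interpret prob_space "cube_measure :: (real ^ 'n) measure" by (rule prob_space_cube)
  define A' where "A' = max A 1"
  define cl where "cl = (\<lambda>(h :: nat \<Rightarrow> real ^ 'n \<Rightarrow> real) k x. max (- A') (min A' (h (Suc k) x)))"
  have meas: "f (Suc k) \<in> borel_measurable cube_measure" "g (Suc k) \<in> borel_measurable cube_measure" for k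
    using biorth unfolding biorthonormal_def Linfty_def by auto
  have clm: "cl h k \<in> borel_measurable cube_measure" if [measurable]: "h (Suc k) \<in> borel_measurable cube_measure" for h k
    unfolding cl_def by measurable
  have clb: "\<bar>cl h k x\<bar> \<le> A'" for h k x unfolding cl_def A'_def by linarith
  have cl_AE: "AE x in cube_measure. cl h k x = h (Suc k) x" if "Linfty_norm cube_measure (h (Suc k)) \<le> ereal A" for h k
    using esssup_AE[of "\<lambda>x. ereal \<bar>h (Suc k) x\<bar>" "cube_measure :: (real ^ 'n) measure"]
  proof eventually_elim
    case (elim x)
    then have "ereal \<bar>h (Suc k) x\<bar> \<le> ereal A" using that unfolding Linfty_norm_def by (rule order.trans)
    then have "\<bar>h (Suc k) x\<bar> \<le> A" by simp
    then show ?case unfolding cl_def A'_def by linarith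
  qed
  have fAE: "AE x in cube_measure. cl f k x = f (Suc k) x" and gAE: "AE x in cube_measure. cl g k x = g (Suc k) x" for k
    by (rule cl_AE, use bounded[of "Suc k"] in simp)+
  have null: "(\<lambda>n. expectation (\<lambda>x. indicator D x * cl h n x)) \<longlonglongrightarrow> 0"
    if D: "D \<in> sets cube_measure" and hm: "\<And>k. h (Suc k) \<in> borel_measurable cube_measure"
      and ae: "\<And>k. AE x in cube_measure. cl h k x = h (Suc k) x"
      and lim: "(\<lambda>n. LINT x:D|cube_measure. h n x) \<longlonglongrightarrow> 0" for D h
  proof -
    have "expectation (\<lambda>x. indicator D x * cl h n x) = (LINT x:D|cube_measure. h (Suc n) x)" for n
      unfolding set_lebesgue_integral_def
    proof (rule integral_cong_AE)
      show "(\<lambda>x. indicator D x * cl h n x) \<in> borel_measurable cube_measure"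
        using D clm[of h n, OF hm] by (intro borel_measurable_times borel_measurable_indicator)
      show "(\<lambda>x. indicator D x *\<^sub>R h (Suc n) x) \<in> borel_measurable cube_measure"
        using D hm[of n] by (intro borel_measurable_scaleR borel_measurable_indicator)
      show "AE x in cube_measure. indicator D x * cl h n x = indicator D x *\<^sub>R h (Suc n) x"
        using ae[of n] by eventually_elim simp
    qed
    then show ?thesis using LIMSEQ_Suc[OF lim] by simp
  qed
  have "bounded_biorthonormal cube_measure (cl f) (cl g) A'"
  proof
    show "countably_generated_mod_null (cube_measure :: (real ^ 'n) measure)" by (rule cube_countably_generated)
    show "cl f k \<in> borel_measurable cube_measure" "cl g k \<in> borel_measurable cube_measure" for k
      by (rule clm meas)+
    show "\<bar>cl f k x\<bar> \<le> A'" "\<bar>cl g k x\<bar> \<le> A'" for k x by (rule clb)+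
    show "A' \<ge> 1" by (simp add: A'_def)
    show "expectation (\<lambda>x. cl f i x * cl g j x) = (if i = j then 1 else 0)" for i j
    proof -
      have "expectation (\<lambda>x. cl f i x * cl g j x) = pairing cube_measure (f (Suc i)) (g (Suc j))"
        unfolding pairing_def
      proof (rule integral_cong_AE)
        show "AE x in cube_measure. cl f i x * cl g j x = f (Suc i) x * g (Suc j) x"
          using fAE[of i] gAE[of j] by eventually_elim simp
      qed (intro borel_measurable_times clm meas)+
      also have "\<dots> = (if i = j then 1 else 0)" using biorth unfolding biorthonormal_def by simp
      finally show ?thesis .
    qed
    show "(\<lambda>n. expectation (\<lambda>x. indicator D x * cl f n x)) \<longlonglongrightarrow> 0" if "D \<in> sets cube_measure" for D
      by (rule null[OF that meas(1) fAE]) (use means[OF that] in simp)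
    show "(\<lambda>n. expectation (\<lambda>x. indicator D x * cl g n x)) \<longlonglongrightarrow> 0" if "D \<in> sets cube_measure" for D
      by (rule null[OF that meas(2) gAE]) (use means[OF that] in simp)
  qed
  then show thesis by (rule that[OF _ fAE gAE meas])
qed

text \<open>
  The points where a clipped function differs from the original one are removed from E.
\<close>

lemma divergence_transfer:
  fixes f g f' g' :: "nat \<Rightarrow> 'a \<Rightarrow> real" and F :: "'a \<Rightarrow> real"
  assumes E: "E \<in> sets M" "emeasure M E > 0"
    and lim: "\<forall>x\<in>E. limsup (\<lambda>N. ereal (partial_sum M f' g' F N x)) = \<infinity>"
    and m: "\<And>k. f' k \<in> borel_measurable M" "\<And>k. g' k \<in> borel_measurable M"
      "\<And>k. f (Suc k) \<in> borel_measurable M" "\<And>k. g (Suc k) \<in> borel_measurable M" "F \<in> borel_measurable M"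
    and ae: "\<And>k. AE x in M. f' k x = f (Suc k) x" "\<And>k. AE x in M. g' k x = g (Suc k) x"
  shows "\<exists>E\<in>sets M. emeasure M E > 0 \<and>
    (\<forall>x\<in>E. limsup (\<lambda>N. ereal (\<Sum>n=1..N. pairing M F (g n) * f n x)) = \<infinity>)"
proof -
  note m[measurable]
  define E' where "E' = {x\<in>E. \<forall>k. f' k x = f (Suc k) x}"
  have "E' = E \<inter> {x\<in>space M. \<forall>k. f' k x = f (Suc k) x}" using sets.sets_into_space[OF E(1)] by (auto simp: E'_def)
  moreover have "{x\<in>space M. \<forall>k. f' k x = f (Suc k) x} \<in> sets M" by measurable
  ultimately have E'M: "E' \<in> sets M" using E(1) by simp
  have "AE x in M. \<forall>k. f' k x = f (Suc k) x" unfolding AE_all_countable using ae(1) ..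
  then have "emeasure M E = emeasure M E'"
    by (intro emeasure_eq_AE E(1) E'M) (auto simp: E'_def elim: eventually_mono)
  then have E'0: "emeasure M E' > 0" using E(2) by simp
  have pg: "pairing M F (g' k) = pairing M F (g (Suc k))" for k
    unfolding pairing_def
  proof (rule integral_cong_AE)
    show "AE x in M. F x * g' k x = F x * g (Suc k) x" using ae(2)[of k] by eventually_elim simp
  qed (intro borel_measurable_times m)+
  have "(\<Sum>n=1..N. pairing M F (g n) * f n x) = partial_sum M f' g' F N x" if "x \<in> E'" for x N
    using that by (simp add: partial_sum_def pg E'_def sum.atLeast1_atMost_eq)
  then show ?thesis using E'M E'0 lim by (intro bexI[of _ E'] conjI ballI) (simp_all add: E'_def)
qed

theorem theorem1p4:
  fixes f g :: "nat \<Rightarrow> real ^ 'n \<Rightarrow> real"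
    and p :: "real ^ 'n \<Rightarrow> real"
    and A :: real
  assumes biorth: "biorthonormal cube_measure f g"
    and bounded: "\<And>n. n \<ge> 1 \<Longrightarrow>
          Linfty_norm cube_measure (f n) \<le> ereal A \<and> Linfty_norm cube_measure (g n) \<le> ereal A"
    and means: "\<And>D. D \<in> sets cube_measure \<Longrightarrow>
          (\<lambda>n. LINT x:D|cube_measure. f n x) \<longlonglongrightarrow> 0 \<and>
          (\<lambda>n. LINT x:D|cube_measure. g n x) \<longlonglongrightarrow> 0"
    and p_measurable: "p \<in> borel_measurable cube_measure"
    and p_ge_1: "\<And>x. x \<in> unit_cube \<Longrightarrow> 1 \<le> p x"
    and p_limsup: "Limsup (at_right 0)
          (\<lambda>t. decreasing_rearrangement cube_measure (holder_conjugate p) t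
                / ereal (ln (exp 1 / t))) > 0"
  shows "\<exists>\<omega> :: real ^ 'n \<Rightarrow> real ^ 'n. measure_preserving_map cube_measure \<omega> \<and>
    (\<exists>F\<^sub>1 \<in> variable_Lebesgue cube_measure (\<lambda>x. p (\<omega> x)).
     \<exists>F\<^sub>2 \<in> variable_Lebesgue cube_measure (\<lambda>x. p (\<omega> x)).
     \<exists>E \<in> sets cube_measure. emeasure cube_measure E > 0 \<and>
       (\<forall>x\<in>E. limsup (\<lambda>N. ereal (\<Sum>n=1..N.
            pairing cube_measure F\<^sub>1 (g n) * f n x + pairing cube_measure F\<^sub>2 (f n) * g n x)) = \<infinity>))"
proof -
  obtain K where K: "small_exponent_scales p K"
    by (rule small_exponent_scales_of_Limsup[OF p_measurable p_ge_1 p_limsup])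
  obtain f' g' A' where bb: "bounded_biorthonormal cube_measure f' g' A'"
    and ae: "\<And>k. AE x in cube_measure. f' k x = f (Suc k) x" "\<And>k. AE x in cube_measure. g' k x = g (Suc k) x"
    and m: "\<And>k. f (Suc k) \<in> borel_measurable cube_measure" "\<And>k. g (Suc k) \<in> borel_measurable cube_measure"
    by (rule bounded_biorthonormal_of_system[OF biorth bounded means]) (assumption, assumption, rule that)
  interpret bounded_biorthonormal "cube_measure :: (real ^ 'n) measure" f' g' A' by (rule bb)
  have \<delta>: "1 / (16 * A'\<^sup>2) > 0" using A_ge_1 by simp
  have VM: "F \<in> borel_measurable cube_measure" if "F \<in> variable_Lebesgue cube_measure r" for F r
    using that unfolding variable_Lebesgue_def by simp
  have p0: "pairing cube_measure (\<lambda>x. 0) h = 0" for h :: "real ^ 'n \<Rightarrow> real" by (simp add: pairing_def)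
  from large_one_sided show ?thesis
  proof
    assume large: "\<forall>R. \<exists>P n0. simple_function cube_measure P \<and> (\<forall>y. 0 \<le> P y) \<and> expectation P = 1 \<and>
      1 / (16 * A'\<^sup>2) \<le> prob {x\<in>space cube_measure. \<exists>n\<le>n0. R \<le> \<bar>partial_sum cube_measure f' g' P n x\<bar>}"
    from divergence_of_large_maximal_function[OF bb \<delta> p_measurable p_ge_1 K spec[OF large]]
    obtain \<omega> F E where \<omega>: "measure_preserving_map cube_measure \<omega>" and F: "F \<in> variable_Lebesgue cube_measure (\<lambda>x. p (\<omega> x))"
      and E: "E \<in> sets cube_measure" "emeasure cube_measure E > 0"
        "\<forall>x\<in>E. limsup (\<lambda>N. ereal (partial_sum cube_measure f' g' F N x)) = \<infinity>" by blast
    from divergence_transfer[where f=f and g=g, OF E f g m VM[OF F] ae] obtain E' where "E' \<in> sets cube_measure" "emeasure cube_measure E' > 0"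
      "\<forall>x\<in>E'. limsup (\<lambda>N. ereal (\<Sum>n=1..N. pairing cube_measure F (g n) * f n x)) = \<infinity>" by blast
    then show ?thesis
      by (intro exI[of _ \<omega>] conjI \<omega> bexI[of _ F] F bexI[of _ "\<lambda>x. 0"] zero_in_variable_Lebesgue bexI[of _ E'])
        (simp_all add: p0)
  next
    assume large: "\<forall>R. \<exists>P n0. simple_function cube_measure P \<and> (\<forall>y. 0 \<le> P y) \<and> expectation P = 1 \<and>
      1 / (16 * A'\<^sup>2) \<le> prob {x\<in>space cube_measure. \<exists>n\<le>n0. R \<le> \<bar>partial_sum cube_measure g' f' P n x\<bar>}"
    from divergence_of_large_maximal_function[OF swapped \<delta> p_measurable p_ge_1 K spec[OF large]]
    obtain \<omega> F E where \<omega>: "measure_preserving_map cube_measure \<omega>" and F: "F \<in> variable_Lebesgue cube_measure (\<lambda>x. p (\<omega> x))"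
      and E: "E \<in> sets cube_measure" "emeasure cube_measure E > 0"
        "\<forall>x\<in>E. limsup (\<lambda>N. ereal (partial_sum cube_measure g' f' F N x)) = \<infinity>" by blast
    from divergence_transfer[where f=g and g=f, OF E g f m(2,1) VM[OF F] ae(2,1)] obtain E' where "E' \<in> sets cube_measure" "emeasure cube_measure E' > 0"
      "\<forall>x\<in>E'. limsup (\<lambda>N. ereal (\<Sum>n=1..N. pairing cube_measure F (f n) * g n x)) = \<infinity>" by blast
    then show ?thesis
      by (intro exI[of _ \<omega>] conjI \<omega> bexI[of _ "\<lambda>x. 0"] zero_in_variable_Lebesgue bexI[of _ F] F bexI[of _ E'])
        (simp_all add: p0)
  qed
qed

end
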